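(* Let $n\ge3$ and let $V$ be a unitary on $n$ qubits. Then $V$ can be realized with the interaction $R=(X\otimes X+Y\otimes Y)/2$ alone, without any ancilla qubits, if and only if all of the following hold: 1. $V$ is energy-conserving: $[V,\sum_{j=1}^nZ_j]=0$; 2. $V$ satisfies the $\mathbb{Z}_2$ symmetry $X^{\otimes n}VX^{\otimes n}=V$; 3. $\det(V^{(m)})=1$ for $m=0,\dots,n$, where $V^{(m)}$ is the component of $V=\bigoplus_{m=0}^nV^{(m)}$ in the subspace with Hamming weight $m$; 4. when $n$ is even, $\det(V^{(n/2,+)})=\det(V^{(n/2,-)})=1$, where $V^{(n/2,\pm)}$ is the component of $V$ in the joint eigensubspace of $\sum_jZ_j$ and $X^{\otimes n}$ with eigenvalues $0$ and $\pm1$ respectively, so that $V^{(n/2)}=V^{(n/2,+)}\oplus V^{(n/2,-)}$. Furthermore, any unitary satisfying these conditions can be realized with $\mathcal{O}(4^nn^{3/2})$ gates $\exp(i\theta R)$, $\theta\in(-\pi,\pi]$.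
   Context: $X,Y,Z$ are the Pauli matrices and $Z_j$ is $Z$ on qubit $j$. The subspace with Hamming weight $m$ is spanned by the computational basis vectors $|\mathbf b\rangle$, $\mathbf b\in\{0,1\}^n$, with exactly $m$ ones; it is the eigenspace of $\sum_jZ_j$ with eigenvalue $n-2m$. $R_{ij}$ denotes $R$ acting on qubits $i,j$. "Realized with the interaction $R$ alone" means equal to a finite product of unitaries $\exp(i\theta R_{ij})$, $\theta\in(-\pi,\pi]$, over arbitrary pairs $i\ne j$ of the $n$ qubits. The implied constant in $\mathcal{O}$ is independent of $n$ and $V$. *)

theory Defs
  imports
    "Jordan_Normal_Form.Schur_Decomposition"
    "Jordan_Normal_Form.DL_Rank"
begin

section \<open>Linear maps on finite-dimensional complex spaces\<close>

definition unitary :: "nat \<Rightarrow> complex mat \<Rightarrow> bool" where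
  "unitary N U \<longleftrightarrow> U \<in> carrier_mat N N \<and> mat_adjoint U * U = 1\<^sub>m N \<and> U * mat_adjoint U = 1\<^sub>m N"

text \<open>The exponential power series, summed entrywise; only meant for square matrices.\<close>

definition mat_exp :: "complex mat \<Rightarrow> complex mat" where
  "mat_exp A = mat (dim_row A) (dim_row A) (\<lambda>(a, b). \<Sum>k. (A ^\<^sub>m k) $$ (a, b) / fact k)"

definition vec_span :: "nat \<Rightarrow> complex vec set \<Rightarrow> complex vec set" where
  "vec_span N S = LinearCombinations.module.span class_ring (module_vec TYPE(complex) N) S"

definition subspace_basis :: "nat \<Rightarrow> complex vec list \<Rightarrow> complex vec set \<Rightarrow> bool" where
  "subspace_basis N bs W \<longleftrightarrow>
     set bs \<subseteq> carrier_vec N \<and> distinct bs \<and>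
     \<not> LinearCombinations.module.lin_dep class_ring (module_vec TYPE(complex) N) (set bs) \<and>
     vec_span N (set bs) = W"

text \<open>
  The matrix \<open>M\<close> represents, in the basis \<open>bs\<close> of \<open>W\<close>, the restriction to \<open>W\<close> of the
  linear map \<open>A\<close>. Such an \<open>M\<close> exists exactly if \<open>A\<close> leaves \<open>W\<close> invariant.
\<close>

definition restriction_matrix ::
    "nat \<Rightarrow> complex mat \<Rightarrow> complex vec set \<Rightarrow> complex vec list \<Rightarrow> complex mat \<Rightarrow> bool" where
  "restriction_matrix N A W bs M \<longleftrightarrow>
     subspace_basis N bs W \<and> M \<in> carrier_mat (length bs) (length bs) \<and>
     A * mat_of_cols N bs = mat_of_cols N bs * M"

text \<open>
  The determinant of the restriction of \<open>A\<close> to an invariant subspace \<open>W\<close>; independence of the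
  choice of basis is shown in \<open>det_on_eq\<close> below. Meaningless if \<open>W\<close> is not invariant.
\<close>

definition det_on :: "nat \<Rightarrow> complex mat \<Rightarrow> complex vec set \<Rightarrow> complex" where
  "det_on N A W = (THE d. \<exists>bs M. restriction_matrix N A W bs M \<and> det M = d)"

lemma subspace_basis_coords:
  assumes "subspace_basis N bs W" "subspace_basis N cs W"
  obtains S where "S \<in> carrier_mat (length bs) (length cs)"
    and "mat_of_cols N cs = mat_of_cols N bs * S"
proof -
  interpret vec_space "TYPE(complex)" N .
  have bs: "set bs \<subseteq> carrier_vec N" and cs: "set cs \<subseteq> carrier_vec N"
    and sp: "span (set bs) = span (set cs)"
    using assms by (auto simp: subspace_basis_def vec_span_def)
  have "\<exists>x. x \<in> carrier_vec (length bs) \<and> cs ! j = mat_of_cols N bs *\<^sub>v x" if "j < length cs" for j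
  proof -
    have "cs ! j \<in> span (set cs)"
      using that cs by (meson in_own_span nth_mem subsetD)
    then have "cs ! j \<in> span_list bs"
      using sp bs by (simp add: span_list_as_span)
    then obtain c where "cs ! j = lincomb_list c bs"
      by (auto simp: span_list_def)
    then show ?thesis
      using bs by (intro exI[of _ "vec (length bs) c"]) (auto simp: lincomb_list_as_mat_mult subset_iff)
  qed
  then obtain f where f: "\<And>j. j < length cs \<Longrightarrow>
      f j \<in> carrier_vec (length bs) \<and> cs ! j = mat_of_cols N bs *\<^sub>v f j"
    by metis
  let ?S = "mat_of_cols (length bs) (map f [0..<length cs])"
  have S: "?S \<in> carrier_mat (length bs) (length cs)" by (simp add: carrier_matI)
  have "mat_of_cols N cs = mat_of_cols N bs * ?S"
  proof (rule mat_col_eqI)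
    fix j assume "j < dim_col (mat_of_cols N bs * ?S)"
    then have j: "j < length cs" by simp
    have "col (mat_of_cols N bs * ?S) j = mat_of_cols N bs *\<^sub>v col ?S j"
      using j by (intro col_mult2[OF _ S]) auto
    also have "\<dots> = cs ! j" using f[OF j] j by simp
    finally show "col (mat_of_cols N cs) j = col (mat_of_cols N bs * ?S) j"
      using j cs by (simp add: subset_iff)
  qed auto
  with S show thesis by (rule that)
qed

lemma subspace_basis_cancel:
  assumes b: "subspace_basis N bs W"
    and P: "P \<in> carrier_mat (length bs) k" and Q: "Q \<in> carrier_mat (length bs) k"
    and eq: "mat_of_cols N bs * P = mat_of_cols N bs * Q"
  shows "P = Q"
proof -
  interpret vec_space "TYPE(complex)" N .
  let ?B = "mat_of_cols N bs"
  have B: "?B \<in> carrier_mat N (length bs)" by simp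
  have cols: "cols ?B = bs"
    using b by (intro cols_mat_of_cols) (auto simp: subspace_basis_def)
  show ?thesis
  proof (rule mat_col_eqI)
    fix j assume "j < dim_col Q"
    then have j: "j < k" using Q by simp
    let ?v = "col P j - col Q j"
    have v: "?v \<in> carrier_vec (length bs)"
      using P Q by (metis carrier_matD(1) col_dim minus_carrier_vec)
    have "?B *\<^sub>v col P j = col (?B * P) j" using j by (intro col_mult2[OF B P, symmetric]) auto
    also have "\<dots> = ?B *\<^sub>v col Q j" unfolding eq using j by (intro col_mult2[OF B Q]) auto
    finally have e: "?B *\<^sub>v col P j = ?B *\<^sub>v col Q j" .
    have cP: "col P j \<in> carrier_vec (length bs)" and cQ: "col Q j \<in> carrier_vec (length bs)"
      using P Q by (simp_all add: carrier_vecI)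
    have "?B *\<^sub>v ?v = ?B *\<^sub>v col P j - ?B *\<^sub>v col Q j"
      using cP cQ by (rule mult_minus_distrib_mat_vec[OF B])
    also have "\<dots> = 0\<^sub>v N" unfolding e
      using B by (intro minus_cancel_vec) (metis mult_mat_vec_carrier col_carrier_vec j Q carrier_matD)
    finally have "?B *\<^sub>v ?v = 0\<^sub>v N" .
    then have z: "?v = 0\<^sub>v (length bs)"
      using lin_depI[OF B v] b cols by (auto simp: subspace_basis_def)
    show "col P j = col Q j"
    proof (rule eq_vecI)
      fix i assume "i < dim_vec (col Q j)"
      then have i: "i < length bs" using Q by simp
      have "?v $ i = 0" using z i by simp
      then show "col P j $ i = col Q j $ i" using i P Q by simp
    qed (use P Q in auto)
  qed (use P Q in auto)
qed

lemma det_on_eq: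
  assumes A: "A \<in> carrier_mat N N" and M: "restriction_matrix N A W bs M"
  shows "det_on N A W = det M"
  unfolding det_on_def
proof (rule the_equality)
  show "\<exists>bs M'. restriction_matrix N A W bs M' \<and> det M' = det M" using M by blast
next
  fix d assume "\<exists>bs M. restriction_matrix N A W bs M \<and> det M = d"
  then obtain cs L where L: "restriction_matrix N A W cs L" and d: "det L = d" by blast
  let ?B = "mat_of_cols N bs" and ?C = "mat_of_cols N cs"
  let ?b = "length bs" and ?c = "length cs"
  have b: "subspace_basis N bs W" and c: "subspace_basis N cs W"
    and Mc: "M \<in> carrier_mat ?b ?b" and Lc: "L \<in> carrier_mat ?c ?c"
    and AB: "A * ?B = ?B * M" and AC: "A * ?C = ?C * L"
    using M L by (auto simp: restriction_matrix_def)
  have B: "?B \<in> carrier_mat N ?b" and C: "?C \<in> carrier_mat N ?c" by auto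
  obtain S where S: "S \<in> carrier_mat ?b ?c" and CS: "?C = ?B * S"
    by (rule subspace_basis_coords[OF b c])
  obtain T where T: "T \<in> carrier_mat ?c ?b" and BT: "?B = ?C * T"
    by (rule subspace_basis_coords[OF c b])
  have ST: "S * T = 1\<^sub>m ?b"
  proof (rule subspace_basis_cancel[OF b])
    have "?B * (S * T) = ?C * T"
      unfolding CS by (rule assoc_mult_mat[OF B S T, symmetric])
    also have "\<dots> = ?B * 1\<^sub>m ?b"
      unfolding BT[symmetric] by (rule right_mult_one_mat[OF B, symmetric])
    finally show "?B * (S * T) = ?B * 1\<^sub>m ?b" .
  qed (use S T in auto)
  have TS: "T * S = 1\<^sub>m ?c"
  proof (rule subspace_basis_cancel[OF c])
    have "?C * (T * S) = ?B * S"
      unfolding BT by (rule assoc_mult_mat[OF C T S, symmetric])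
    also have "\<dots> = ?C * 1\<^sub>m ?c"
      unfolding CS[symmetric] by (rule right_mult_one_mat[OF C, symmetric])
    finally show "?C * (T * S) = ?C * 1\<^sub>m ?c" .
  qed (use S T in auto)
  have len: "?b = ?c"
  proof -
    have "(\<Sum>i<?b. (S * T) $$ (i, i)) = (\<Sum>i<?b. \<Sum>j<?c. S $$ (i, j) * T $$ (j, i))"
      using S T by (intro sum.cong refl) (simp add: scalar_prod_def lessThan_atLeast0)
    also have "\<dots> = (\<Sum>j<?c. \<Sum>i<?b. T $$ (j, i) * S $$ (i, j))"
      by (subst sum.swap) (simp add: mult.commute)
    also have "\<dots> = (\<Sum>j<?c. (T * S) $$ (j, j))"
      using S T by (intro sum.cong refl) (simp add: scalar_prod_def lessThan_atLeast0)
    finally have "(of_nat ?b :: complex) = of_nat ?c" unfolding ST TS by simp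
    then show ?thesis by (simp only: of_nat_eq_iff)
  qed
  have "?B * (M * S) = ?B * (S * L)"
  proof -
    have "?B * (M * S) = ?B * M * S" by (rule assoc_mult_mat[OF B Mc S, symmetric])
    also have "\<dots> = A * ?B * S" by (simp only: AB)
    also have "\<dots> = A * ?C" unfolding CS by (rule assoc_mult_mat[OF A B S])
    also have "\<dots> = ?B * S * L" unfolding AC by (simp only: CS)
    also have "\<dots> = ?B * (S * L)" by (rule assoc_mult_mat[OF B S Lc])
    finally show ?thesis .
  qed
  from subspace_basis_cancel[OF b mult_carrier_mat[OF Mc S] mult_carrier_mat[OF S Lc] this]
  have "M * S = S * L" .
  then have "det M * det S = det S * det L"
    using det_mult[of M ?b S] det_mult[of S ?b L] Mc S Lc len by auto
  moreover have "det S * det T = 1"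
    using det_mult[of S ?b T] S T ST len by simp
  ultimately show "d = det M"
    using d by (auto simp: mult.commute[of "det M"])
qed


section \<open>Qubits\<close>

text \<open>
  The computational basis vector with bits \<open>b\<^sub>0, \<dots>, b\<^sub>n\<^sub>-\<^sub>1\<close> is \<open>unit_vec (2 ^ n) b\<close> for the number
  \<open>b\<close> whose binary digit \<open>j\<close> is \<open>b\<^sub>j\<close>; the qubits are numbered \<open>0, \<dots>, n - 1\<close>.
\<close>

definition hamming_weight :: "nat \<Rightarrow> nat \<Rightarrow> nat" where
  "hamming_weight n b = card {j. j < n \<and> bit b j}"

definition pauli_X :: "complex mat" where
  "pauli_X = mat_of_rows_list 2 [[0, 1], [1, 0]]"

definition pauli_Y :: "complex mat" where
  "pauli_Y = mat_of_rows_list 2 [[0, - \<i>], [\<i>, 0]]"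

definition pauli_Z :: "complex mat" where
  "pauli_Z = mat_of_rows_list 2 [[1, 0], [0, - 1]]"

text \<open>The tensor product of the \<open>2 \<times> 2\<close> matrices \<open>P j\<close> acting on the qubits \<open>j < n\<close>.\<close>

definition qubit_tensor :: "nat \<Rightarrow> (nat \<Rightarrow> complex mat) \<Rightarrow> complex mat" where
  "qubit_tensor n P = mat (2 ^ n) (2 ^ n)
     (\<lambda>(a, b). \<Prod>j<n. P j $$ (of_bool (bit a j), of_bool (bit b j)))"

definition on_qubits :: "nat \<Rightarrow> nat set \<Rightarrow> complex mat \<Rightarrow> complex mat" where
  "on_qubits n J P = qubit_tensor n (\<lambda>j. if j \<in> J then P else 1\<^sub>m 2)"

definition total_Z :: "nat \<Rightarrow> complex mat" where
  "total_Z n = mat (2 ^ n) (2 ^ n) (\<lambda>ab. \<Sum>j<n. on_qubits n {j} pauli_Z $$ ab)"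

definition all_X :: "nat \<Rightarrow> complex mat" where
  "all_X n = qubit_tensor n (\<lambda>_. pauli_X)"

definition xy_interaction :: "nat \<Rightarrow> nat \<Rightarrow> nat \<Rightarrow> complex mat" where
  "xy_interaction n i j =
     (1 / 2) \<cdot>\<^sub>m (on_qubits n {i, j} pauli_X + on_qubits n {i, j} pauli_Y)"

definition xy_gate :: "nat \<Rightarrow> real \<times> nat \<times> nat \<Rightarrow> complex mat" where
  "xy_gate n = (\<lambda>(\<theta>, i, j). mat_exp ((\<i> * complex_of_real \<theta>) \<cdot>\<^sub>m xy_interaction n i j))"

definition xy_circuit :: "nat \<Rightarrow> (real \<times> nat \<times> nat) list \<Rightarrow> bool" where
  "xy_circuit n gs \<longleftrightarrow>
     (\<forall>(\<theta>, i, j) \<in> set gs. - pi < \<theta> \<and> \<theta> \<le> pi \<and> i < n \<and> j < n \<and> i \<noteq> j)"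

definition circuit_unitary :: "nat \<Rightarrow> (real \<times> nat \<times> nat) list \<Rightarrow> complex mat" where
  "circuit_unitary n gs = foldr (\<lambda>g U. xy_gate n g * U) gs (1\<^sub>m (2 ^ n))"

definition weight_space :: "nat \<Rightarrow> nat \<Rightarrow> complex vec set" where
  "weight_space n m =
     vec_span (2 ^ n) {unit_vec (2 ^ n) b | b. b < 2 ^ n \<and> hamming_weight n b = m}"

definition joint_eigenspace :: "nat \<Rightarrow> complex \<Rightarrow> complex \<Rightarrow> complex vec set" where
  "joint_eigenspace n z x =
     {v \<in> carrier_vec (2 ^ n). total_Z n *\<^sub>v v = z \<cdot>\<^sub>v v \<and> all_X n *\<^sub>v v = x \<cdot>\<^sub>v v}"

definition energy_conserving :: "nat \<Rightarrow> complex mat \<Rightarrow> bool" where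
  "energy_conserving n V \<longleftrightarrow> V * total_Z n - total_Z n * V = 0\<^sub>m (2 ^ n) (2 ^ n)"

text \<open>
  The first two conjuncts make the subspaces in the last two invariant under \<open>V\<close>, so that
  \<open>det_on\<close> is applied only where it is meaningful.
\<close>

definition xy_constraints :: "nat \<Rightarrow> complex mat \<Rightarrow> bool" where
  "xy_constraints n V \<longleftrightarrow>
     energy_conserving n V \<and>
     all_X n * V * all_X n = V \<and>
     (\<forall>m\<le>n. det_on (2 ^ n) V (weight_space n m) = 1) \<and>
     (even n \<longrightarrow> det_on (2 ^ n) V (joint_eigenspace n 0 1) = 1 \<and>
                  det_on (2 ^ n) V (joint_eigenspace n 0 (- 1)) = 1)"

end

theory Submission
  imports Defs
begin

text \<open>
  Circuits satisfy the constraints on determinants because every gate is a group commutator of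
  circuits: \<open>exp (i \<theta> R)\<close> is the commutator of \<open>exp (i (\<theta> / 2) R)\<close> with a diagonal circuit that flips
  the sign of \<open>R\<close>.

  For the converse, conjugation of gates on three qubits yields rotations of a pair of qubits
  about the \<open>Y\<close> and \<open>Z\<close> axes whose sense is controlled by a third qubit. A group commutator of two
  controlled rotations whose sets of controls overlap is a rotation controlled by the union of
  these sets; doubling the number of controls in this way costs a factor of four, so that \<open>O (n\<^sup>2)\<close>
  gates rotate two basis vectors at Hamming distance two (and their bitwise complements) and fix
  all others. Givens rotations along the edges of a spanning tree of each weight class then reduce
  \<open>V\<close> to the identity, the last entry being given by the determinant. When \<open>n\<close> is even,
  these rotations act alike on both eigenspaces of \<open>X\<^sup>\<otimes>\<^sup>n\<close> in the middle weight class. The product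
  of the rotations of \<open>x, y\<close> and of \<open>x\<close> and the complement of \<open>y\<close> acts on one of them only; it
  costs \<open>O (n\<^sup>3)\<close> gates but is needed only a constant number of times per column. The count is
  \<open>O (n\<^sup>2)\<close> times the sum of the squares of the binomial coefficients, which is the central binomial
  coefficient \<open>O (4\<^sup>n / \<surd>n)\<close>.
\<close>

section \<open>Bit strings\<close>

text \<open>The flip symmetry has the consequence that two basis vectors can only be rotated
  together with their complements. Away from the middle weight the complements lie in another weight
  class, so the classes below the middle can be treated one by one and those above follow. At middle
  weight a vector and its complement span a sum and a difference, which is where the two additional
  determinants come from. A rotation of x and y has the same matrix on sums as on differences.
  Replacing y by its complement keeps the sense of rotation on one of them and reverses it on the
  other. With half the angle in each of the two rotations, the angles add up on one eigenspace and
  cancel on the other. The path from x to the complement of y may change all n bits, hence the extra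
  factor n. If each of the order of N^2 rotations in a class of size N paid it, the final exponent
  of n would be 5/2. Paid only O(N) times, it contributes n^3 2^n, which is dominated by 4^n
  n^(3/2).\<close>

definition flip2 :: "nat \<Rightarrow> nat \<Rightarrow> nat \<Rightarrow> nat" where
  "flip2 i j b = flip_bit i (flip_bit j b)"

definition flip_all :: "nat \<Rightarrow> nat \<Rightarrow> nat" where
  "flip_all n b = xor (mask n) b"

lemma bit_flip2: "i \<noteq> j \<Longrightarrow> bit (flip2 i j b) k \<longleftrightarrow> bit b k \<noteq> (k = i \<or> k = j)"
  by (auto simp: flip2_def bit_flip_bit_iff)

lemma bit_flip_all: "bit (flip_all n b) k \<longleftrightarrow> bit b k \<noteq> (k < n)"
  by (auto simp: flip_all_def bit_xor_iff bit_mask_iff)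

lemma less_two_power_iff: "b < 2 ^ n \<longleftrightarrow> (\<forall>k\<ge>n. \<not> bit (b::nat) k)"
proof
  assume "b < 2 ^ n"
  then have "take_bit n b = b" by (simp add: take_bit_nat_eq_self_iff)
  then show "\<forall>k\<ge>n. \<not> bit b k" by (metis bit_take_bit_iff not_le)
next
  assume "\<forall>k\<ge>n. \<not> bit b k"
  then have "take_bit n b = b" by (intro bit_eqI) (metis bit_take_bit_iff not_le)
  then show "b < 2 ^ n" by (simp add: take_bit_nat_eq_self_iff)
qed

lemma eq_if_low_bits:
  "a < 2 ^ n \<Longrightarrow> b < 2 ^ n \<Longrightarrow> (\<And>k. k < n \<Longrightarrow> bit a k \<longleftrightarrow> bit b k) \<Longrightarrow> a = (b::nat)"
  by (intro bit_eqI) (metis less_two_power_iff not_le)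

lemma flip2_flip2 [simp]: "i \<noteq> j \<Longrightarrow> flip2 i j (flip2 i j b) = b"
  by (intro bit_eqI) (auto simp: bit_flip2)

lemma flip2_swap: "i \<noteq> j \<Longrightarrow> flip2 i j b = flip2 j i b"
  by (intro bit_eqI) (auto simp: bit_flip2)

lemma flip_all_flip_all [simp]: "flip_all n (flip_all n b) = b"
  by (intro bit_eqI) (auto simp: bit_flip_all)

lemma flip_all_flip2: "i \<noteq> j \<Longrightarrow> flip_all n (flip2 i j b) = flip2 i j (flip_all n b)"
  by (intro bit_eqI) (auto simp: bit_flip2 bit_flip_all)

lemma flip2_neq [simp]: "i \<noteq> j \<Longrightarrow> flip2 i j b \<noteq> b"
  by (metis bit_flip2)

lemma flip2_neq' [simp]: "i \<noteq> j \<Longrightarrow> b \<noteq> flip2 i j b"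
  by (metis bit_flip2)

lemma flip_all_neq: "0 < n \<Longrightarrow> flip_all n b \<noteq> b"
  by (metis bit_flip_all)

lemma flip_all_eq_iff: "flip_all n a = b \<longleftrightarrow> a = flip_all n b"
  by (metis flip_all_flip_all)

lemma flip_all_inj [simp]: "flip_all n a = flip_all n b \<longleftrightarrow> a = b"
  by (metis flip_all_flip_all)

lemma flip2_less [simp]: "i \<noteq> j \<Longrightarrow> i < n \<Longrightarrow> j < n \<Longrightarrow> flip2 i j b < 2 ^ n \<longleftrightarrow> b < 2 ^ n"
  by (auto simp: less_two_power_iff bit_flip2)

lemma flip_all_less [simp]: "flip_all n b < 2 ^ n \<longleftrightarrow> b < 2 ^ n"
  by (auto simp: less_two_power_iff bit_flip_all)

lemma bij_flip2: "i \<noteq> j \<Longrightarrow> i < n \<Longrightarrow> j < n \<Longrightarrow> bij_betw (flip2 i j) {..<2 ^ n} {..<2 ^ n}"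
  by (rule bij_betwI[where g = "flip2 i j"]) auto

lemma bij_flip_all: "bij_betw (flip_all n) {..<2 ^ n} {..<2 ^ n}"
  by (rule bij_betwI[where g = "flip_all n"]) auto

lemma hamming_weight_flip2:
  assumes "i \<noteq> j" "i < n" "j < n" "bit b i \<noteq> bit b j"
  shows "hamming_weight n (flip2 i j b) = hamming_weight n b"
proof -
  have swap: "hamming_weight n (flip2 i j b) = hamming_weight n b"
    if "i \<noteq> j" "i < n" "j < n" "bit b i" "\<not> bit b j" for i j
  proof -
    let ?A = "{k. k < n \<and> bit b k}"
    have i: "i \<in> ?A" using that by simp
    have "{k. k < n \<and> bit (flip2 i j b) k} = insert j (?A - {i})"
      using that by (auto simp: bit_flip2)
    moreover have "card (insert j (?A - {i})) = Suc (card (?A - {i}))"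
      using that by (intro card_insert_disjoint) auto
    moreover have "\<dots> = card ?A" using i by (intro card_Suc_Diff1) auto
    ultimately show ?thesis by (simp add: hamming_weight_def)
  qed
  show ?thesis
  proof (cases "bit b i")
    case True then show ?thesis using assms swap by blast
  next
    case False then show ?thesis using assms swap[of j i] flip2_swap by metis
  qed
qed

lemma hamming_weight_flip_all: "hamming_weight n (flip_all n b) + hamming_weight n b = n"
proof -
  have "card ({k. k < n \<and> \<not> bit b k} \<union> {k. k < n \<and> bit b k}) =
      card {k. k < n \<and> \<not> bit b k} + card {k. k < n \<and> bit b k}"
    by (rule card_Un_disjoint) auto
  moreover have "{k. k < n \<and> \<not> bit b k} \<union> {k. k < n \<and> bit b k} = {..<n}" by auto
  moreover have "{k. k < n \<and> bit (flip_all n b) k} = {k. k < n \<and> \<not> bit b k}" by (auto simp: bit_flip_all)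
  ultimately show ?thesis by (simp add: hamming_weight_def)
qed

text \<open>The set of positions of ones is a bijection between numbers below \<open>2 ^ n\<close>
  and subsets of \<open>{..<n}\<close>: it is injective by extensionality of bits and surjective
  because both sides have \<open>2 ^ n\<close> elements.\<close>

lemma card_hamming_weight: "card {b. b < 2 ^ n \<and> hamming_weight n b = m} = n choose m"
proof -
  let ?f = "\<lambda>b::nat. {k. k < n \<and> bit b k}"
  have inj: "inj_on ?f {..<2 ^ n}"
    by (intro inj_onI eq_if_low_bits[of _ n]) auto
  have surj: "K \<in> ?f ` {..<2 ^ n}" if "K \<subseteq> {..<n}" for K
  proof -
    have "card (?f ` {..<2 ^ n}) = 2 ^ n" using card_image[OF inj] by simp
    moreover have "card (Pow {..<n}) = 2 ^ n" by (simp add: card_Pow)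
    moreover have "?f ` {..<2 ^ n} \<subseteq> Pow {..<n}" by auto
    ultimately have "?f ` {..<2 ^ n} = Pow {..<n}" by (intro card_subset_eq) auto
    then show ?thesis using that by blast
  qed
  have "?f ` {b. b < 2 ^ n \<and> hamming_weight n b = m} = {K. K \<subseteq> {..<n} \<and> card K = m}"
  proof (intro equalityI subsetI)
    fix K assume K: "K \<in> {K. K \<subseteq> {..<n} \<and> card K = m}"
    then obtain b where "b < 2 ^ n" "K = ?f b" using surj[of K] by blast
    then show "K \<in> ?f ` {b. b < 2 ^ n \<and> hamming_weight n b = m}" using K by (auto simp: hamming_weight_def)
  qed (auto simp: hamming_weight_def)
  moreover have "card (?f ` {b. b < 2 ^ n \<and> hamming_weight n b = m}) =
      card {b. b < 2 ^ n \<and> hamming_weight n b = m}"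
    by (intro card_image inj_on_subset[OF inj]) auto
  ultimately show ?thesis by (simp add: n_subsets)
qed

section \<open>Matrices acting on amplitude functions\<close>

text \<open>Amplitudes are functions on all numbers, so that operators can be written pointwise by
  \<open>flip2\<close> and \<open>flip_all\<close> without carrier conditions. Arguments from
  \<open>2 ^ n\<close> on are ignored in the input and yield zero in the output.\<close>

definition mat_act :: "nat \<Rightarrow> complex mat \<Rightarrow> (nat \<Rightarrow> complex) \<Rightarrow> nat \<Rightarrow> complex" where
  "mat_act n M \<psi> a = (if a < 2 ^ n then \<Sum>b<2 ^ n. M $$ (a, b) * \<psi> b else 0)"

lemma mat_act_cong: "(\<And>b. b < 2 ^ n \<Longrightarrow> \<psi> b = \<phi> b) \<Longrightarrow> mat_act n M \<psi> = mat_act n M \<phi>"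
  by (auto simp: mat_act_def fun_eq_iff)

lemma mat_act_ge [simp]: "\<not> a < 2 ^ n \<Longrightarrow> mat_act n M \<psi> a = 0"
  by (simp add: mat_act_def)

lemma mat_act_mult:
  assumes "A \<in> carrier_mat (2 ^ n) (2 ^ n)" "B \<in> carrier_mat (2 ^ n) (2 ^ n)"
  shows "mat_act n (A * B) \<psi> = mat_act n A (mat_act n B \<psi>)"
proof
  fix a
  show "mat_act n (A * B) \<psi> a = mat_act n A (mat_act n B \<psi>) a"
  proof (cases "a < 2 ^ n")
    case True
    then have "mat_act n (A * B) \<psi> a = (\<Sum>b<2 ^ n. (\<Sum>c<2 ^ n. A $$ (a, c) * B $$ (c, b)) * \<psi> b)"
      using assms by (simp add: mat_act_def scalar_prod_def lessThan_atLeast0)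
    also have "\<dots> = (\<Sum>c<2 ^ n. \<Sum>b<2 ^ n. A $$ (a, c) * B $$ (c, b) * \<psi> b)"
      by (simp add: sum_distrib_right) (rule sum.swap)
    also have "\<dots> = mat_act n A (mat_act n B \<psi>) a"
      using True by (simp add: mat_act_def sum_distrib_left mult.assoc)
    finally show ?thesis .
  qed simp
qed

lemma mat_act_one: "a < 2 ^ n \<Longrightarrow> mat_act n (1\<^sub>m (2 ^ n)) \<psi> a = \<psi> a"
  by (simp add: mat_act_def if_distrib[of "\<lambda>x. x * _"] cong: if_cong)

lemma mat_act_delta:
  assumes "a < 2 ^ n" "b < 2 ^ n"
  shows "mat_act n M (\<lambda>c. of_bool (c = b)) a = M $$ (a, b)"
  using assms by (simp add: mat_act_def of_bool_def if_distrib[of "(*) _"] cong: if_cong)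

lemma mat_eq_if_act_eq:
  assumes "A \<in> carrier_mat (2 ^ n) (2 ^ n)" "B \<in> carrier_mat (2 ^ n) (2 ^ n)"
    and "\<And>\<psi> a. a < 2 ^ n \<Longrightarrow> mat_act n A \<psi> a = mat_act n B \<psi> a"
  shows "A = B"
proof (rule eq_matI)
  fix a b assume "a < dim_row B" "b < dim_col B"
  then have "a < 2 ^ n" "b < 2 ^ n" using assms by auto
  then show "A $$ (a, b) = B $$ (a, b)" using assms(3) mat_act_delta by metis
qed (use assms in auto)

lemma mat_act_add: "mat_act n M (\<lambda>b. \<psi> b + \<phi> b) = (\<lambda>a. mat_act n M \<psi> a + mat_act n M \<phi> a)"
  by (auto simp: mat_act_def fun_eq_iff distrib_left sum.distrib)

lemma mat_act_scale: "mat_act n M (\<lambda>b. c * \<psi> b) = (\<lambda>a. c * mat_act n M \<psi> a)"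
  by (auto simp: mat_act_def fun_eq_iff sum_distrib_left mult.left_commute)

section \<open>Circuits as operators\<close>

text \<open>The number \<open>k\<close> is an upper bound on the gates and not their exact number,
  so that bounds can be weakened.\<close>

definition realizable :: "nat \<Rightarrow> nat \<Rightarrow> complex mat \<Rightarrow> bool" where
  "realizable n k M \<longleftrightarrow> (\<exists>gs. xy_circuit n gs \<and> M = circuit_unitary n gs \<and> length gs \<le> k)"

text \<open>The comparison stops at \<open>2 ^ n\<close>: formulas such as \<open>rot\<close> need
  not vanish beyond it, whereas \<open>mat_act\<close> does.\<close>

definition acts :: "nat \<Rightarrow> complex mat \<Rightarrow> ((nat \<Rightarrow> complex) \<Rightarrow> nat \<Rightarrow> complex) \<Rightarrow> bool" where
  "acts n M F \<longleftrightarrow> M \<in> carrier_mat (2 ^ n) (2 ^ n) \<and> (\<forall>\<psi>. \<forall>a<2 ^ n. mat_act n M \<psi> a = F \<psi> a)"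

lemma mat_mult_index:
  assumes "A \<in> carrier_mat N N" "B \<in> carrier_mat N N" "a < N" "b < N"
  shows "(A * B) $$ (a, b) = (\<Sum>c<N. A $$ (a, c) * B $$ (c, b))"
  using assms by (simp add: scalar_prod_def lessThan_atLeast0)

definition realizable_op :: "nat \<Rightarrow> nat \<Rightarrow> ((nat \<Rightarrow> complex) \<Rightarrow> nat \<Rightarrow> complex) \<Rightarrow> bool" where
  "realizable_op n k F \<longleftrightarrow> (\<exists>M. realizable n k M \<and> acts n M F)"

definition rot :: "nat \<Rightarrow> nat \<Rightarrow> real \<Rightarrow> (nat \<Rightarrow> complex) \<Rightarrow> nat \<Rightarrow> complex" where
  "rot i j \<theta> \<psi> a =
     (if bit a i = bit a j then \<psi> a
      else of_real (cos \<theta>) * \<psi> a + \<i> * of_real (sin \<theta>) * \<psi> (flip2 i j a))"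

section \<open>Matrix entries of the interaction and of its exponential\<close>

lemma prod_of_bool: "finite A \<Longrightarrow> (\<Prod>k\<in>A. of_bool (Q k) :: complex) = of_bool (\<forall>k\<in>A. Q k)"
  by (induction A rule: finite_induct) auto

lemma one_mat_of_bool: "1\<^sub>m 2 $$ (of_bool p, of_bool q) = (of_bool (p = q) :: complex)"
  by (cases p; cases q) auto

lemma pauli_X_of_bool: "pauli_X $$ (of_bool p, of_bool q) = of_bool (p \<noteq> q)"
  by (cases p; cases q) (auto simp: pauli_X_def mat_of_rows_list_def)

lemma pauli_Y_of_bool: "pauli_Y $$ (of_bool p, of_bool q) = (if p = q then 0 else if p then \<i> else - \<i>)"
  by (cases p; cases q) (auto simp: pauli_Y_def mat_of_rows_list_def)

lemma pauli_Z_of_bool: "pauli_Z $$ (of_bool p, of_bool q) = (if p \<noteq> q then 0 else if p then - 1 else 1)"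
  by (cases p; cases q) (auto simp: pauli_Z_def mat_of_rows_list_def)

lemma on_qubits_pair:
  assumes "i \<noteq> j" "i < n" "j < n" "a < 2 ^ n" "b < 2 ^ n"
  shows "on_qubits n {i, j} P $$ (a, b) =
    P $$ (of_bool (bit a i), of_bool (bit b i)) * P $$ (of_bool (bit a j), of_bool (bit b j)) *
    of_bool (\<forall>k<n. k \<noteq> i \<longrightarrow> k \<noteq> j \<longrightarrow> bit a k = bit b k)"
proof -
  let ?F = "\<lambda>k. (if k \<in> {i, j} then P else 1\<^sub>m 2) $$ (of_bool (bit a k), of_bool (bit b k))"
  have "on_qubits n {i, j} P $$ (a, b) = prod ?F {..<n}"
    using assms by (simp add: on_qubits_def qubit_tensor_def)
  also have "\<dots> = prod ?F {i, j} * prod ?F ({..<n} - {i, j})"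
    using assms by (subst prod.subset_diff[of "{i, j}" "{..<n}"]) (auto simp: mult.commute)
  also have "prod ?F {i, j} =
      P $$ (of_bool (bit a i), of_bool (bit b i)) * P $$ (of_bool (bit a j), of_bool (bit b j))"
    using assms by simp
  also have "prod ?F ({..<n} - {i, j}) = (\<Prod>k\<in>{..<n} - {i, j}. of_bool (bit a k = bit b k))"
    by (intro prod.cong) (auto simp: one_mat_of_bool)
  also have "\<dots> = of_bool (\<forall>k<n. k \<noteq> i \<longrightarrow> k \<noteq> j \<longrightarrow> bit a k = bit b k)"
    by (subst prod_of_bool) auto
  finally show ?thesis .
qed

lemma eq_flip2_iff:
  assumes "i \<noteq> j" "i < n" "j < n" "a < 2 ^ n" "b < 2 ^ n"
  shows "a = flip2 i j b \<longleftrightarrow> bit a i \<noteq> bit b i \<and> bit a j \<noteq> bit b j \<and>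
    (\<forall>k<n. k \<noteq> i \<longrightarrow> k \<noteq> j \<longrightarrow> bit a k = bit b k)"
proof
  assume "a = flip2 i j b" then show "bit a i \<noteq> bit b i \<and> bit a j \<noteq> bit b j \<and>
    (\<forall>k<n. k \<noteq> i \<longrightarrow> k \<noteq> j \<longrightarrow> bit a k = bit b k)" using assms by (auto simp: bit_flip2)
next
  assume "bit a i \<noteq> bit b i \<and> bit a j \<noteq> bit b j \<and>
    (\<forall>k<n. k \<noteq> i \<longrightarrow> k \<noteq> j \<longrightarrow> bit a k = bit b k)"
  then show "a = flip2 i j b" using assms by (intro eq_if_low_bits[of _ n]) (auto simp: bit_flip2)
qed

text \<open>On equal bits the \<open>X\<close> and \<open>Y\<close> terms cancel, on different bits
  they coincide: the interaction exchanges 01 and 10 and kills 00 and 11.\<close>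

lemma xy_interaction_index:
  assumes "i \<noteq> j" "i < n" "j < n" "a < 2 ^ n" "b < 2 ^ n"
  shows "xy_interaction n i j $$ (a, b) = of_bool (bit b i \<noteq> bit b j \<and> a = flip2 i j b)"
proof -
  have d: "on_qubits n {i, j} P \<in> carrier_mat (2 ^ n) (2 ^ n)" for P
    by (simp add: on_qubits_def qubit_tensor_def)
  have "xy_interaction n i j $$ (a, b) =
      1 / 2 * (on_qubits n {i, j} pauli_X $$ (a, b) + on_qubits n {i, j} pauli_Y $$ (a, b))"
    unfolding xy_interaction_def using assms d[of pauli_X] d[of pauli_Y]
    by (subst index_smult_mat) auto
  moreover define Q where "Q \<longleftrightarrow> (\<forall>k<n. k \<noteq> i \<longrightarrow> k \<noteq> j \<longrightarrow> bit a k = bit b k)"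
  ultimately show ?thesis
    unfolding eq_flip2_iff[OF assms] on_qubits_pair[OF assms] pauli_X_of_bool pauli_Y_of_bool Q_def[symmetric]
    by (cases "bit a i"; cases "bit a j"; cases "bit b i"; cases "bit b j") simp_all
qed

lemma xy_interaction_carrier: "xy_interaction n i j \<in> carrier_mat (2 ^ n) (2 ^ n)"
  by (simp add: xy_interaction_def on_qubits_def qubit_tensor_def)

text \<open>The interaction is an involution on strings with different bits at \<open>i\<close> and
  \<open>j\<close>, so its powers alternate there; on the other strings only the zeroth power
  survives.\<close>

lemma xy_interaction_pow_index:
  assumes ij: "i \<noteq> j" "i < n" "j < n" and "a < 2 ^ n" "b < 2 ^ n"
  shows "((c \<cdot>\<^sub>m xy_interaction n i j) ^\<^sub>m k) $$ (a, b) =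
    (if bit b i = bit b j then of_bool (k = 0 \<and> a = b)
     else c ^ k * of_bool (a = (if even k then b else flip2 i j b)))"
  using assms(4,5)
proof (induction k arbitrary: b)
  case 0
  then show ?case using xy_interaction_carrier[of n i j] by simp
next
  case (Suc k)
  let ?A = "c \<cdot>\<^sub>m xy_interaction n i j"
  have A: "?A \<in> carrier_mat (2 ^ n) (2 ^ n)" using xy_interaction_carrier by simp
  then have P: "?A ^\<^sub>m k \<in> carrier_mat (2 ^ n) (2 ^ n)" by simp
  have "(?A ^\<^sub>m Suc k) $$ (a, b) = (\<Sum>d<2 ^ n. (?A ^\<^sub>m k) $$ (a, d) * ?A $$ (d, b))"
    unfolding pow_mat.simps using mat_mult_index[OF P A] Suc.prems by blast
  also have "\<dots> = (\<Sum>d<2 ^ n. if d = flip2 i j b then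
      (if bit b i = bit b j then 0 else (?A ^\<^sub>m k) $$ (a, d) * c) else 0)"
    using xy_interaction_carrier[of n i j] Suc.prems ij
    by (intro sum.cong) (auto simp: xy_interaction_index)
  also have "\<dots> = (if bit b i = bit b j then 0 else (?A ^\<^sub>m k) $$ (a, flip2 i j b) * c)"
    using Suc.prems ij by (simp add: sum.delta)
  also have "\<dots> = (if bit b i = bit b j then of_bool (Suc k = 0 \<and> a = b)
     else c ^ Suc k * of_bool (a = (if even (Suc k) then b else flip2 i j b)))"
    using Suc.IH[of "flip2 i j b"] Suc.prems ij by (auto simp: bit_flip2)
  finally show ?case .
qed

lemma xy_gate_index:
  assumes ij: "i \<noteq> j" "i < n" "j < n" and ab: "a < 2 ^ n" "b < 2 ^ n"
  shows "xy_gate n (\<theta>, i, j) $$ (a, b) =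
    (if bit b i = bit b j then of_bool (a = b)
     else of_real (cos \<theta>) * of_bool (a = b) + \<i> * of_real (sin \<theta>) * of_bool (a = flip2 i j b))"
proof -
  let ?c = "\<i> * complex_of_real \<theta>"
  have e: "xy_gate n (\<theta>, i, j) $$ (a, b) = (\<Sum>k. ((?c \<cdot>\<^sub>m xy_interaction n i j) ^\<^sub>m k) $$ (a, b) / fact k)"
    using ab xy_interaction_carrier[of n i j] by (simp add: xy_gate_def mat_exp_def)
  \<comment> \<open>Even powers will sum to \<open>cosh ?c\<close> and odd ones to
    \<open>sinh ?c\<close>; at an imaginary argument these are the cosine and \<i> times the
    sine.\<close>
  have cosh: "cosh ?c = of_real (cos \<theta>)" and sinh: "sinh ?c = \<i> * of_real (sin \<theta>)"
    using cis_conv_exp[of \<theta>] cis_conv_exp[of "- \<theta>"]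
    by (simp_all add: cosh_def sinh_def complex_eq_iff flip: exp_minus)
  show ?thesis
  proof (cases "bit b i = bit b j")
    case True
    have "(\<lambda>k. of_bool (k = 0 \<and> a = b) / fact k :: complex) = (\<lambda>k. if k = 0 then of_bool (a = b) else 0)"
      by auto
    then have "(\<lambda>k. of_bool (k = 0 \<and> a = b) / fact k :: complex) sums of_bool (a = b)"
      using sums_single[of 0 "\<lambda>_. of_bool (a = b) :: complex"] by simp
    then show ?thesis using True e ij ab by (simp add: xy_interaction_pow_index sums_unique[symmetric])
  next
    case False
    have "(\<lambda>k. (if even k then ?c ^ k /\<^sub>R fact k else 0) * of_bool (a = b) +
        (if even k then 0 else ?c ^ k /\<^sub>R fact k) * of_bool (a = flip2 i j b))
      sums (cosh ?c * of_bool (a = b) + sinh ?c * of_bool (a = flip2 i j b))"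
      by (intro sums_add sums_mult2 cosh_converges sinh_converges)
    also have "(\<lambda>k. (if even k then ?c ^ k /\<^sub>R fact k else 0) * of_bool (a = b) +
        (if even k then 0 else ?c ^ k /\<^sub>R fact k) * of_bool (a = flip2 i j b)) =
      (\<lambda>k. ((?c \<cdot>\<^sub>m xy_interaction n i j) ^\<^sub>m k) $$ (a, b) / fact k)"
    proof
      fix k
      have "(if even k then ?c ^ k /\<^sub>R fact k else 0) * of_bool (a = b) +
        (if even k then 0 else ?c ^ k /\<^sub>R fact k) * of_bool (a = flip2 i j b) =
        ?c ^ k * of_bool (a = (if even k then b else flip2 i j b)) / fact k"
        by (simp add: scaleR_conv_of_real field_simps)
      also have "\<dots> = ((?c \<cdot>\<^sub>m xy_interaction n i j) ^\<^sub>m k) $$ (a, b) / fact k"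
        by (subst xy_interaction_pow_index) (use False ij ab in auto)
      finally show "(if even k then ?c ^ k /\<^sub>R fact k else 0) * of_bool (a = b) +
        (if even k then 0 else ?c ^ k /\<^sub>R fact k) * of_bool (a = flip2 i j b) =
        ((?c \<cdot>\<^sub>m xy_interaction n i j) ^\<^sub>m k) $$ (a, b) / fact k" .
    qed
    finally show ?thesis using False e cosh sinh by (simp add: sums_unique[symmetric])
  qed
qed

lemma xy_gate_carrier: "xy_gate n (\<theta>, i, j) \<in> carrier_mat (2 ^ n) (2 ^ n)"
  using xy_interaction_carrier[of n i j] by (simp add: xy_gate_def mat_exp_def)

lemma acts_xy_gate:
  assumes ij: "i \<noteq> j" "i < n" "j < n"
  shows "acts n (xy_gate n (\<theta>, i, j)) (rot i j \<theta>)"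
  unfolding acts_def
proof (intro conjI allI impI xy_gate_carrier)
  fix \<psi> :: "nat \<Rightarrow> complex" and a :: nat assume a: "a < 2 ^ n"
  have "mat_act n (xy_gate n (\<theta>, i, j)) \<psi> a = (\<Sum>b<2 ^ n. xy_gate n (\<theta>, i, j) $$ (a, b) * \<psi> b)"
    using a by (simp add: mat_act_def)
  also have "\<dots> = (\<Sum>b<2 ^ n. (if b = a then (if bit a i = bit a j then 1 else of_real (cos \<theta>)) * \<psi> a else 0) +
      (if b = flip2 i j a then (if bit a i = bit a j then 0 else \<i> * of_real (sin \<theta>)) * \<psi> (flip2 i j a) else 0))"
  proof (rule sum.cong)
    fix b :: nat assume "b \<in> {..<2 ^ n}"
    moreover have "a = flip2 i j b \<longleftrightarrow> b = flip2 i j a" using ij by auto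
    ultimately show "xy_gate n (\<theta>, i, j) $$ (a, b) * \<psi> b =
      (if b = a then (if bit a i = bit a j then 1 else of_real (cos \<theta>)) * \<psi> a else 0) +
      (if b = flip2 i j a then (if bit a i = bit a j then 0 else \<i> * of_real (sin \<theta>)) * \<psi> (flip2 i j a) else 0)"
      using a ij by (auto simp: xy_gate_index bit_flip2)
  qed simp
  also have "\<dots> = rot i j \<theta> \<psi> a"
    using a ij by (simp add: sum.distrib rot_def)
  finally show "mat_act n (xy_gate n (\<theta>, i, j)) \<psi> a = rot i j \<theta> \<psi> a" .
qed

section \<open>Composition of operators and of their gate counts\<close>

lemma acts_mult: "acts n A F \<Longrightarrow> acts n B G \<Longrightarrow> acts n (A * B) (\<lambda>\<psi>. F (G \<psi>))"
proof -
  assume A: "acts n A F" and B: "acts n B G"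
  have "mat_act n (A * B) \<psi> a = F (G \<psi>) a" if "a < 2 ^ n" for \<psi> a
  proof -
    have "mat_act n (A * B) \<psi> a = mat_act n A (mat_act n B \<psi>) a"
      using A B by (simp add: acts_def mat_act_mult)
    also have "mat_act n A (mat_act n B \<psi>) = mat_act n A (G \<psi>)"
      using B by (intro mat_act_cong) (auto simp: acts_def)
    also have "\<dots> a = F (G \<psi>) a" using A that by (auto simp: acts_def)
    finally show ?thesis .
  qed
  then show ?thesis using A B by (auto simp: acts_def)
qed

lemma acts_cong: "acts n A F \<Longrightarrow> (\<And>\<psi> a. a < 2 ^ n \<Longrightarrow> F \<psi> a = G \<psi> a) \<Longrightarrow> acts n A G"
  by (auto simp: acts_def)

lemma acts_unique: "acts n A F \<Longrightarrow> acts n B F \<Longrightarrow> A = B"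
  by (rule mat_eq_if_act_eq) (auto simp: acts_def)

lemma acts_one: "acts n (1\<^sub>m (2 ^ n)) (\<lambda>\<psi>. \<psi>)"
  by (simp add: acts_def mat_act_one)

lemma circuit_unitary_carrier: "circuit_unitary n gs \<in> carrier_mat (2 ^ n) (2 ^ n)"
proof (induction gs)
  case (Cons g gs)
  obtain \<theta> i j where "g = (\<theta>, i, j)" by (cases g)
  with Cons show ?case using mult_carrier_mat[OF xy_gate_carrier] by (auto simp: circuit_unitary_def)
qed (simp add: circuit_unitary_def)

lemma circuit_unitary_append:
  "circuit_unitary n (gs @ hs) = circuit_unitary n gs * circuit_unitary n hs"
proof (induction gs)
  case Nil
  show ?case using circuit_unitary_carrier[of n hs] by (simp add: circuit_unitary_def)
next
  case (Cons g gs)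
  obtain \<theta> i j where g: "g = (\<theta>, i, j)" by (cases g)
  have "circuit_unitary n ((g # gs) @ hs) = xy_gate n g * (circuit_unitary n gs * circuit_unitary n hs)"
    using Cons by (simp add: circuit_unitary_def)
  also have "\<dots> = xy_gate n g * circuit_unitary n gs * circuit_unitary n hs"
    unfolding g by (rule assoc_mult_mat[symmetric, OF xy_gate_carrier circuit_unitary_carrier circuit_unitary_carrier])
  finally show ?case by (simp add: circuit_unitary_def)
qed

lemma realizable_carrier: "realizable n k M \<Longrightarrow> M \<in> carrier_mat (2 ^ n) (2 ^ n)"
  using circuit_unitary_carrier by (auto simp: realizable_def)

lemma realizable_mono: "realizable n k M \<Longrightarrow> k \<le> l \<Longrightarrow> realizable n l M"
  by (force simp: realizable_def)

lemma realizable_one: "realizable n k (1\<^sub>m (2 ^ n))"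
  unfolding realizable_def by (rule exI[of _ "[]"]) (simp add: xy_circuit_def circuit_unitary_def)

lemma realizable_mult:
  assumes "realizable n k A" "realizable n l B"
  shows "realizable n (k + l) (A * B)"
proof -
  from assms obtain gs hs where "xy_circuit n gs" "A = circuit_unitary n gs" "length gs \<le> k"
    "xy_circuit n hs" "B = circuit_unitary n hs" "length hs \<le> l" by (auto simp: realizable_def)
  then show ?thesis
    unfolding realizable_def
    by (intro exI[of _ "gs @ hs"]) (auto simp: xy_circuit_def circuit_unitary_append)
qed

lemma realizable_op_compose: "realizable_op n k F \<Longrightarrow> realizable_op n l G \<Longrightarrow> realizable_op n (k + l) (\<lambda>\<psi>. F (G \<psi>))"
  unfolding realizable_op_def using realizable_mult acts_mult by blast

lemma realizable_op_eq: "realizable_op n k F \<Longrightarrow> (\<And>\<psi> a. a < 2 ^ n \<Longrightarrow> F \<psi> a = G \<psi> a) \<Longrightarrow> realizable_op n k G"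
  unfolding realizable_op_def using acts_cong by blast

lemma realizable_op_mono: "realizable_op n k F \<Longrightarrow> k \<le> l \<Longrightarrow> realizable_op n l F"
  unfolding realizable_op_def using realizable_mono by blast

lemma realizable_op_rot:
  assumes ij: "i \<noteq> j" "i < n" "j < n"
  shows "realizable_op n 1 (rot i j \<theta>)"
proof -
  \<comment> \<open>Gate angles are confined to the interval from - pi to pi, but \<open>rot\<close>
    depends on its angle only through sine and cosine.\<close>
  define \<theta>' where "\<theta>' = Arg (cis \<theta>)"
  have "cis \<theta>' = cis \<theta>" using cis_Arg[of "cis \<theta>"] by (simp add: \<theta>'_def)
  then have t: "cos \<theta>' = cos \<theta>" "sin \<theta>' = sin \<theta>" "- pi < \<theta>'" "\<theta>' \<le> pi"
    using Arg_bounded[of "cis \<theta>"] by (auto simp: \<theta>'_def complex_eq_iff)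
  have "xy_circuit n [(\<theta>', i, j)]" using t ij by (simp add: xy_circuit_def)
  moreover have "circuit_unitary n [(\<theta>', i, j)] = xy_gate n (\<theta>', i, j)"
    using right_mult_one_mat[OF xy_gate_carrier] by (simp add: circuit_unitary_def)
  moreover have "rot i j \<theta>' = rot i j \<theta>" using t by (simp add: rot_def fun_eq_iff)
  ultimately show ?thesis
    unfolding realizable_op_def realizable_def using acts_xy_gate[OF ij, of \<theta>']
    by (intro exI[of _ "xy_gate n (\<theta>', i, j)"] conjI exI[of _ "[(\<theta>', i, j)]"]) auto
qed

section \<open>Multiply controlled rotations\<close>

text \<open>What a flip-symmetric control can see of a string: its bits in \<open>A\<close> compared
  with those of \<open>x\<close>, up to a simultaneous complement.\<close>

definition agree :: "nat \<Rightarrow> nat set \<Rightarrow> nat \<Rightarrow> bool" where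
  "agree x A a \<longleftrightarrow> (\<forall>k\<in>A. bit a k \<longleftrightarrow> bit x k) \<or> (\<forall>k\<in>A. bit a k \<noteq> bit x k)"

text \<open>On the ordered pair of a matching string and its partner, the matrix has rows (c, - cnj
  s) and (s, c), which is in SU(2) if the squared moduli of \<open>c\<close> and \<open>s\<close>
  add up to one. The second branch is that of the partner, so exchanging the two reverses the sense
  of rotation.\<close>

definition controlled_givens :: "nat \<Rightarrow> nat \<Rightarrow> nat \<Rightarrow> nat set \<Rightarrow> real \<Rightarrow> complex \<Rightarrow> (nat \<Rightarrow> complex) \<Rightarrow> nat \<Rightarrow> complex" where
  "controlled_givens x i j A c s \<psi> a =
     (if agree x A a then of_real c * \<psi> a - cnj s * \<psi> (flip2 i j a)
      else if agree x A (flip2 i j a) then of_real c * \<psi> a + s * \<psi> (flip2 i j a)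
      else \<psi> a)"

definition phase :: "nat \<Rightarrow> nat \<Rightarrow> nat \<Rightarrow> nat set \<Rightarrow> real \<Rightarrow> (nat \<Rightarrow> complex) \<Rightarrow> nat \<Rightarrow> complex" where
  "phase x i j A \<alpha> \<psi> a =
     (if agree x A a then cis \<alpha> * \<psi> a
      else if agree x A (flip2 i j a) then cis (- \<alpha>) * \<psi> a
      else \<psi> a)"

lemma agree_iff:
  "k \<in> A \<Longrightarrow> agree x A a \<longleftrightarrow> (\<forall>l\<in>A. (bit a l \<longleftrightarrow> bit x l) \<longleftrightarrow> (bit a k \<longleftrightarrow> bit x k))"
  by (auto simp: agree_def)

lemma agree_Un: "k \<in> A \<Longrightarrow> k \<in> B \<Longrightarrow> agree x (A \<union> B) a \<longleftrightarrow> agree x A a \<and> agree x B a"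
  by (auto simp: agree_iff[of k])

text \<open>\<open>flip2\<close> changes bit \<open>i\<close> but not bit \<open>k\<close> and so
  reverses the relation between these two bits. As soon as a third control is present, a string and
  its partner never both match, and the two branches of \<open>controlled_givens\<close> exclude
  each other. With \<open>i\<close> and \<open>j\<close> as the only controls this would
  fail.\<close>

lemma agree_not_flip2:
  assumes "i \<noteq> j" "k \<noteq> i" "k \<noteq> j" "{i, k} \<subseteq> A" "{i, k} \<subseteq> B" "agree x A a"
  shows "\<not> agree x B (flip2 i j a)"
proof
  assume "agree x B (flip2 i j a)"
  then have "(bit a i \<noteq> bit x i) \<longleftrightarrow> (bit a k \<longleftrightarrow> bit x k)"
    using bspec[OF iffD1[OF agree_iff[of k B x "flip2 i j a"]], of i] assms(1-3,5) by (auto simp: bit_flip2)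
  moreover have "(bit a i \<longleftrightarrow> bit x i) \<longleftrightarrow> (bit a k \<longleftrightarrow> bit x k)"
    using bspec[OF iffD1[OF agree_iff[of k A x a]], of i] assms(4,6) by simp
  ultimately show False by blast
qed

text \<open>The rotation controlled by \<open>B\<close> is a half turn about an axis orthogonal to
  that of the rotation controlled by \<open>A\<close>, and conjugation by it reverses the latter.
  Where both control sets match, the commutator is therefore a square, which doubles the angle;
  where only one matches, a rotation meets its own inverse.\<close>

lemma controlled_givens_commutator:
  assumes "i \<noteq> j" "k \<noteq> i" "k \<noteq> j" "{i, k} \<subseteq> A" "{i, k} \<subseteq> B"
    and cs: "c\<^sup>2 + s\<^sup>2 = 1" and w: "w * cnj w = 1"
  shows "controlled_givens x i j A c (w * of_real s) (controlled_givens x i j B 0 (\<i> * w)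
      (controlled_givens x i j A c (- w * of_real s) (controlled_givens x i j B 0 (- \<i> * w) \<psi>))) a =
    controlled_givens x i j (A \<union> B) (c\<^sup>2 - s\<^sup>2) (w * of_real (2 * c * s)) \<psi> a"
proof -
  have k: "k \<in> A" "k \<in> B" using assms by auto
  have ex: "\<not> (agree x A a \<and> agree x A (flip2 i j a))" "\<not> (agree x A a \<and> agree x B (flip2 i j a))"
    "\<not> (agree x B a \<and> agree x A (flip2 i j a))" "\<not> (agree x B a \<and> agree x B (flip2 i j a))"
    using agree_not_flip2[OF assms(1-3)] assms(4,5) by blast+
  have cs': "of_real c ^ 2 + of_real s ^ 2 = (1::complex)"
    using cs by (simp flip: of_real_power of_real_add)
  define C S W I where "C = complex_of_real c" "S = complex_of_real s" "W = cnj w" "I = \<i>"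
  note d = this
  have rel: "C * C + S * S = 1" "w * W = 1" "I * I = - 1" using cs' w by (simp_all add: d power2_eq_square)
  have cn: "cnj C = C" "cnj S = S" "cnj w = W" "cnj I = - I" by (simp_all add: d)
  \<comment> \<open>With the scalars abstract, every case of the final split is a polynomial
    identity modulo the relations \<open>rel\<close>.\<close>
  have e: "C * (I * W * (w * S * (I * W * q) - C * (I * w * p))) -
      W * S * (I * w * (- (C * (I * W * q)) - W * S * (I * w * p))) = (C * C - S * S) * p - W * (2 * C * S) * q"
    "C * (I * w * (- (C * (I * W * p)) - W * S * (I * w * q))) +
      w * S * (I * W * (w * S * (I * W * p) - C * (I * w * q))) = (C * C - S * S) * p + w * (2 * C * S) * q"
    "C * (C * p + W * S * q) - W * S * (C * q - w * S * p) = p"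
    "C * (C * p - w * S * q) + w * S * (C * q + W * S * p) = p"
    "- (I * W * (I * w * p)) = p" "- (I * w * (I * W * p)) = p" for p q
  proof -
    have "C * (I * W * (w * S * (I * W * q) - C * (I * w * p))) -
        W * S * (I * w * (- (C * (I * W * q)) - W * S * (I * w * p))) =
      (I * I) * (w * W) * (2 * C * S * W * q - C * C * p + (w * W) * (S * S * p))"
      by (simp add: algebra_simps)
    also have "\<dots> = (C * C - S * S) * p - W * (2 * C * S) * q" unfolding rel(2,3) by (simp add: algebra_simps)
    finally show "C * (I * W * (w * S * (I * W * q) - C * (I * w * p))) -
      W * S * (I * w * (- (C * (I * W * q)) - W * S * (I * w * p))) = (C * C - S * S) * p - W * (2 * C * S) * q" .
    have "C * (I * w * (- (C * (I * W * p)) - W * S * (I * w * q))) +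
        w * S * (I * W * (w * S * (I * W * p) - C * (I * w * q))) =
      (I * I) * (w * W) * ((w * W) * (S * S * p) - C * C * p - 2 * C * S * w * q)"
      by (simp add: algebra_simps)
    also have "\<dots> = (C * C - S * S) * p + w * (2 * C * S) * q" unfolding rel(2,3) by (simp add: algebra_simps)
    finally show "C * (I * w * (- (C * (I * W * p)) - W * S * (I * w * q))) +
      w * S * (I * W * (w * S * (I * W * p) - C * (I * w * q))) = (C * C - S * S) * p + w * (2 * C * S) * q" .
    have "C * (C * p + W * S * q) - W * S * (C * q - w * S * p) = C * C * p + (w * W) * (S * S * p)"
      "C * (C * p - w * S * q) + w * S * (C * q + W * S * p) = C * C * p + (w * W) * (S * S * p)"
      by (simp_all add: algebra_simps)
    moreover have "C * C * p + (w * W) * (S * S * p) = (C * C + S * S) * p" unfolding rel(2) by (simp add: algebra_simps)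
    ultimately show "C * (C * p + W * S * q) - W * S * (C * q - w * S * p) = p"
      "C * (C * p - w * S * q) + w * S * (C * q + W * S * p) = p" by (simp_all add: rel)
    have "- (I * W * (I * w * p)) = - (I * I) * (w * W) * p" "- (I * w * (I * W * p)) = - (I * I) * (w * W) * p"
      by (simp_all add: algebra_simps)
    then show "- (I * W * (I * w * p)) = p" "- (I * w * (I * W * p)) = p" by (simp_all add: rel)
  qed
  show ?thesis
    using ex assms(1) unfolding power2_eq_square
    apply (cases "agree x A a"; cases "agree x A (flip2 i j a)"; cases "agree x B a"; cases "agree x B (flip2 i j a)")
                   apply (simp_all add: controlled_givens_def agree_Un[OF k] cn flip: d(1,2,4))
         apply (rule e)+
    done
qed

section \<open>Rotations of a pair of qubits steered by a third one\<close>

lemma flip2_trans: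
  assumes "i \<noteq> j" "k \<noteq> i" "k \<noteq> j"
  shows "flip2 i k (flip2 k j a) = flip2 i j a" "flip2 k j (flip2 i k a) = flip2 i j a"
  by (rule bit_eqI, use assms in \<open>auto simp: bit_flip2\<close>)+

lemma agree3:
  "agree x {i, j, k} a \<longleftrightarrow>
    ((bit a i \<longleftrightarrow> bit x i) \<longleftrightarrow> (bit a k \<longleftrightarrow> bit x k)) \<and> ((bit a j \<longleftrightarrow> bit x j) \<longleftrightarrow> (bit a k \<longleftrightarrow> bit x k))"
  by (auto simp: agree_def)

text \<open>\<open>rot i k (pi / 2)\<close> exchanges different bits at \<open>i\<close> and
  \<open>k\<close> with a factor \<i>, so the conjugation carries the rotation of
  \<open>k, j\<close> to one of \<open>i, j\<close>. The factors collected on the way turn the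
  \<open>X\<close> axis into the \<open>Y\<close> axis with a sign given by bit \<open>k\<close>.
  Every string with different bits at \<open>i\<close> and \<open>j\<close> either matches on
  \<open>{i, j, k}\<close> or has a matching partner, hence all of them are rotated and the third
  qubit selects only the sense.\<close>

lemma rot_conj:
  assumes "i \<noteq> j" "k \<noteq> i" "k \<noteq> j" "bit x i \<noteq> bit x j"
  shows "rot i k (pi / 2) (rot k j \<theta> (rot i k (- pi / 2) \<psi>)) a =
    controlled_givens x i j {i, j, k} (cos \<theta>) (of_real (if bit x i = bit x k then - sin \<theta> else sin \<theta>)) \<psi> a"
proof -
  define I where "I = \<i>"
  have I: "I * I = - 1" and II: "\<And>z. I * (I * z) = - z" by (simp_all add: I_def)
  show ?thesis
    using assms
    apply (cases "bit a i"; cases "bit a j"; cases "bit a k"; cases "bit x i"; cases "bit x k")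
    apply (simp_all add: rot_def controlled_givens_def agree3 bit_flip2 flip2_trans flip: I_def)
    apply (simp_all add: algebra_simps I II)
    done
qed

lemma realizable_op_controlled_givens3_real:
  assumes "i \<noteq> j" "k \<noteq> i" "k \<noteq> j" "i < n" "j < n" "k < n" "bit x i \<noteq> bit x j"
  shows "realizable_op n 3 (controlled_givens x i j {i, j, k} (cos \<theta>) (of_real (sin \<theta>)))"
proof -
  \<comment> \<open>The sign compensates for the one in \<open>rot_conj\<close>.\<close>
  define \<theta>' where "\<theta>' = (if bit x i = bit x k then - \<theta> else \<theta>)"
  have "realizable_op n (1 + (1 + 1)) (\<lambda>\<psi>. rot i k (pi / 2) (rot k j \<theta>' (rot i k (- pi / 2) \<psi>)))"
    by (rule realizable_op_compose[OF realizable_op_rot realizable_op_compose[OF realizable_op_rot realizable_op_rot]]) (use assms in auto)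
  then have "realizable_op n 3 (\<lambda>\<psi>. rot i k (pi / 2) (rot k j \<theta>' (rot i k (- pi / 2) \<psi>)))"
    by (simp add: numeral_3_eq_3)
  then show ?thesis
  proof (rule realizable_op_eq)
    fix \<psi> a show "rot i k (pi / 2) (rot k j \<theta>' (rot i k (- pi / 2) \<psi>)) a =
      controlled_givens x i j {i, j, k} (cos \<theta>) (of_real (sin \<theta>)) \<psi> a"
      using rot_conj[OF assms(1-3,7), of \<theta>' \<psi> a] by (simp add: \<theta>'_def)
  qed
qed

text \<open>A quarter turn about the \<open>X\<close> axis carries the \<open>Y\<close> axis to the
  \<open>Z\<close> axis. Conjugators and rotation act on the same strings, those with different bits
  at \<open>i\<close> and \<open>j\<close>, so nothing is left over elsewhere.\<close>

lemma rot_controlled_givens_phase: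
  assumes "i \<noteq> j" "k \<noteq> i" "k \<noteq> j" "bit x i \<noteq> bit x j"
  shows "rot i j (pi / 4) (controlled_givens x i j {i, j, k} (cos \<alpha>) (of_real (sin \<alpha>)) (rot i j (- pi / 4) \<psi>)) a =
    phase x i j {i, j, k} \<alpha> \<psi> a"
proof -
  define r I C S where "r = complex_of_real (sqrt 2 / 2)" "I = \<i>"
    "C = complex_of_real (cos \<alpha>)" "S = complex_of_real (sin \<alpha>)"
  note d = this
  have rel: "2 * (r * r) = 1" "I * I = - 1"
    by (simp_all add: d complex_eq_iff)
  have cn: "cnj C = C" "cnj S = S" "complex_of_real (cos (pi / 4)) = r" "complex_of_real (sin (pi / 4)) = r"
    by (simp_all add: d cos_45 sin_45)
  have ci: "cis \<alpha> = C + I * S" "cis (- \<alpha>) = C - I * S"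
    by (simp_all add: complex_eq_iff d)
  have ag: "bit a i \<noteq> bit a j \<longleftrightarrow> agree x {i, j, k} a \<or> agree x {i, j, k} (flip2 i j a)"
    using assms by (auto simp: agree3 bit_flip2)
  have ex: "\<not> (agree x {i, j, k} a \<and> agree x {i, j, k} (flip2 i j a))"
    using agree_not_flip2[OF assms(1-3), of "{i, j, k}" "{i, j, k}"] by auto
  have fl: "(bit (flip2 i j a) i \<noteq> bit (flip2 i j a) j) = (bit a i \<noteq> bit a j)"
    using assms(1) by (auto simp: bit_flip2)
  have e: "r * (C * (r * p - I * r * q) - S * (r * q - I * r * p)) +
      I * r * (C * (r * q - I * r * p) + S * (r * p - I * r * q)) = (C + I * S) * p"
    "r * (C * (r * p - I * r * q) + S * (r * q - I * r * p)) +
      I * r * (C * (r * q - I * r * p) - S * (r * p - I * r * q)) = (C - I * S) * p" for p q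
  proof -
    have "r * (C * (r * p - I * r * q) - S * (r * q - I * r * p)) +
        I * r * (C * (r * q - I * r * p) + S * (r * p - I * r * q)) =
      r * r * (C * p - I * I * C * p + 2 * I * S * p - S * q - I * I * S * q)"
      by (simp add: algebra_simps)
    also have "\<dots> = 2 * (r * r) * (C + I * S) * p" unfolding rel(2) by (simp add: algebra_simps)
    finally show "r * (C * (r * p - I * r * q) - S * (r * q - I * r * p)) +
      I * r * (C * (r * q - I * r * p) + S * (r * p - I * r * q)) = (C + I * S) * p" by (simp only: rel(1) mult_1)
    have "r * (C * (r * p - I * r * q) + S * (r * q - I * r * p)) +
        I * r * (C * (r * q - I * r * p) - S * (r * p - I * r * q)) =
      r * r * (C * p - I * I * C * p - 2 * I * S * p + S * q + I * I * S * q)"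
      by (simp add: algebra_simps)
    also have "\<dots> = 2 * (r * r) * (C - I * S) * p" unfolding rel(2) by (simp add: algebra_simps)
    finally show "r * (C * (r * p - I * r * q) + S * (r * q - I * r * p)) +
      I * r * (C * (r * q - I * r * p) - S * (r * p - I * r * q)) = (C - I * S) * p" by (simp only: rel(1) mult_1)
  qed
  show ?thesis
    using ex ag fl assms(1)
    apply (cases "agree x {i, j, k} a"; cases "agree x {i, j, k} (flip2 i j a)")
       apply (simp_all add: rot_def controlled_givens_def phase_def ci cn e flip: d)
    done
qed

lemma realizable_op_phase3:
  assumes "i \<noteq> j" "k \<noteq> i" "k \<noteq> j" "i < n" "j < n" "k < n" "bit x i \<noteq> bit x j"
  shows "realizable_op n 5 (phase x i j {i, j, k} \<alpha>)"
proof -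
  have "realizable_op n (1 + (3 + 1)) (\<lambda>\<psi>. rot i j (pi / 4) (controlled_givens x i j {i, j, k} (cos \<alpha>) (of_real (sin \<alpha>)) (rot i j (- pi / 4) \<psi>)))"
    by (rule realizable_op_compose[OF realizable_op_rot realizable_op_compose[OF realizable_op_controlled_givens3_real realizable_op_rot]]) (use assms in auto)
  then have "realizable_op n 5 (\<lambda>\<psi>. rot i j (pi / 4) (controlled_givens x i j {i, j, k} (cos \<alpha>) (of_real (sin \<alpha>)) (rot i j (- pi / 4) \<psi>)))"
    by simp
  then show ?thesis by (rule realizable_op_eq) (rule rot_controlled_givens_phase[OF assms(1-3,7)])
qed

text \<open>A rotation about \<open>Z\<close> turns the axis of another rotation within the plane of
  \<open>X\<close> and \<open>Y\<close>. A match on \<open>A\<close> implies one on the subset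
  \<open>{i, j, k}\<close>, so the phase has a definite sign along the rotated pairs even though it
  also acts on other strings.\<close>

lemma phase_conj_controlled_givens:
  assumes "i \<noteq> j" "k \<noteq> i" "k \<noteq> j" "{i, j, k} \<subseteq> A" 
  shows "phase x i j {i, j, k} \<alpha> (controlled_givens x i j A c s (phase x i j {i, j, k} (- \<alpha>) \<psi>)) a =
    controlled_givens x i j A c (s * cis (- 2 * \<alpha>)) \<psi> a"
proof -
  have sub: "agree x {i, j, k} b" if "agree x A b" for b
    using that assms(4) by (auto simp: agree_def)
  have ex: "\<not> (agree x {i, j, k} a \<and> agree x {i, j, k} (flip2 i j a))"
    using agree_not_flip2[OF assms(1-3), of "{i, j, k}" "{i, j, k}"] by auto
  define u v where "u = cis \<alpha>" "v = cis (- \<alpha>)"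
  note d = this
  have uv: "u * v = 1" and cn: "cnj u = v" "cnj v = u" and v2: "cis (- 2 * \<alpha>) = v * v"
    by (simp_all add: cis_mult cis_cnj d)
  have e: "u * (C * (v * p) - t * (u * q)) = C * p - t * (u * u) * q"
    "v * (C * (u * p) + t * (v * q)) = C * p + t * (v * v) * q" for C t p q :: complex
  proof -
    have "u * (C * (v * p) - t * (u * q)) = (u * v) * C * p - t * (u * u) * q"
      "v * (C * (u * p) + t * (v * q)) = (u * v) * C * p + t * (v * v) * q" by (simp_all add: algebra_simps)
    then show "u * (C * (v * p) - t * (u * q)) = C * p - t * (u * u) * q"
      "v * (C * (u * p) + t * (v * q)) = C * p + t * (v * v) * q" by (simp_all add: uv)
  qed
  show ?thesis
    using ex sub[of a] sub[of "flip2 i j a"] assms(1)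
    apply (cases "agree x A a"; cases "agree x A (flip2 i j a)"; cases "agree x {i, j, k} a"; cases "agree x {i, j, k} (flip2 i j a)")
                   apply (simp_all add: controlled_givens_def phase_def cn v2 e uv mult.commute[of v u] del: mult_minus_left flip: d)
    done
qed

text \<open>Both factors rotate all strings with different bits at \<open>i\<close> and
  \<open>j\<close>. The senses are equal where both or neither of the two matches holds for the
  string itself, and opposite otherwise; so the angle doubles on the union of the controls and
  cancels off it. This reaches four controls without a commutator.\<close>

lemma controlled_givens_real_product:
  assumes "i \<noteq> j" "k \<noteq> i" "k \<noteq> j" "l \<noteq> i" "l \<noteq> j" "bit x i \<noteq> bit x j"
    and cs: "c\<^sup>2 + s\<^sup>2 = 1"
  shows "controlled_givens x i j {i, j, k} c (of_real s) (controlled_givens x i j {i, j, l} c (of_real s) \<psi>) a =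
    controlled_givens x i j ({i, j, k} \<union> {i, j, l}) (c\<^sup>2 - s\<^sup>2) (of_real (2 * c * s)) \<psi> a"
proof -
  define C S where "C = complex_of_real c" "S = complex_of_real s"
  note d = this
  have rel: "C * C + S * S = 1"
    using cs by (simp add: d power2_eq_square flip: of_real_mult of_real_add)
  have cn: "cnj C = C" "cnj S = S" by (simp_all add: d)
  let ?K = "{i, j, k}" and ?L = "{i, j, l}" and ?b = "flip2 i j a"
  have un: "agree x (?K \<union> ?L) b \<longleftrightarrow> agree x ?K b \<and> agree x ?L b" for b
    by (rule agree_Un[of i]) auto
  have ag: "agree x ?K a \<or> agree x ?K ?b \<longleftrightarrow> agree x ?L a \<or> agree x ?L ?b"
    using assms(1-6) by (auto simp: agree3 bit_flip2)
  have ex: "\<not> (agree x ?K a \<and> agree x ?K ?b)" "\<not> (agree x ?L a \<and> agree x ?L ?b)"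
    using agree_not_flip2[OF assms(1-3), of ?K ?K] agree_not_flip2[OF assms(1,4,5), of ?L ?L] by auto
  have e: "C * (C * p - S * q) - S * (C * q + S * p) = (C * C - S * S) * p - 2 * C * S * q"
    "C * (C * p + S * q) + S * (C * q - S * p) = (C * C - S * S) * p + 2 * C * S * q"
    "C * (C * p + S * q) - S * (C * q - S * p) = p" "C * (C * p - S * q) + S * (C * q + S * p) = p" for p q
  proof -
    have "C * (C * p + S * q) - S * (C * q - S * p) = (C * C + S * S) * p"
      "C * (C * p - S * q) + S * (C * q + S * p) = (C * C + S * S) * p" by (simp_all add: algebra_simps)
    then show "C * (C * p + S * q) - S * (C * q - S * p) = p" "C * (C * p - S * q) + S * (C * q + S * p) = p"
      by (simp_all add: rel)
  qed (simp_all add: algebra_simps)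
  show ?thesis
    using ag ex assms(1) unfolding power2_eq_square
    apply (cases "agree x ?K a"; cases "agree x ?K ?b"; cases "agree x ?L a"; cases "agree x ?L ?b")
                   apply (simp_all only: controlled_givens_def un cn flip2_flip2 simp_thms if_True if_False of_real_numeral of_real_mult of_real_diff complex_cnj_mult complex_cnj_numeral flip: d)
       apply (rule e)+
    done
qed

section \<open>Arbitrary control sets by repeated doubling\<close>

lemma givens_polar:
  assumes "c\<^sup>2 + (cmod s)\<^sup>2 = 1"
  obtains \<phi> \<gamma> where "c = cos \<phi>" "s = cis \<gamma> * of_real (sin \<phi>)"
proof -
  obtain \<phi> where "c = cos \<phi>" "cmod s = sin \<phi>" using sincos_total_2pi[OF assms] by metis
  moreover have "s = cis (Arg s) * of_real (cmod s)"
    using rcis_cmod_Arg[of s] by (simp add: rcis_def mult.commute)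
  ultimately show thesis using that by metis
qed

lemma half_angle:
  fixes \<phi> :: real
  obtains c s where "c\<^sup>2 + s\<^sup>2 = 1" "cos \<phi> = c\<^sup>2 - s\<^sup>2" "sin \<phi> = 2 * c * s"
  using that[of "cos (\<phi> / 2)" "sin (\<phi> / 2)"] cos_double[of "\<phi> / 2"] sin_double[of "\<phi> / 2"] by simp

lemma cis_mult_cnj: "cis \<gamma> * cnj (cis \<gamma>) = 1"
  by (simp add: cis_cnj cis_mult)

lemma realizable_op_phase_conj:
  assumes "i \<noteq> j" "k \<noteq> i" "k \<noteq> j" "i < n" "j < n" "k < n" "bit x i \<noteq> bit x j" "{i, j, k} \<subseteq> A"
    and L: "realizable_op n l (controlled_givens x i j A c (of_real s))"
  shows "realizable_op n (l + 10) (controlled_givens x i j A c (cis \<gamma> * of_real s))"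
proof -
  \<comment> \<open>Conjugation multiplies \<open>s\<close> by \<open>cis (- 2 * \<alpha>)\<close>,
    whence the half and the sign.\<close>
  define \<alpha> where "\<alpha> = - \<gamma> / 2"
  have "realizable_op n (5 + (l + 5)) (\<lambda>\<psi>. phase x i j {i, j, k} \<alpha> (controlled_givens x i j A c (of_real s) (phase x i j {i, j, k} (- \<alpha>) \<psi>)))"
    by (intro realizable_op_compose realizable_op_phase3 assms)
  then have "realizable_op n (l + 10) (\<lambda>\<psi>. phase x i j {i, j, k} \<alpha> (controlled_givens x i j A c (of_real s) (phase x i j {i, j, k} (- \<alpha>) \<psi>)))"
    by (simp add: add.commute add.left_commute)
  then show ?thesis
  proof (rule realizable_op_eq)
    fix \<psi> a
    show "phase x i j {i, j, k} \<alpha> (controlled_givens x i j A c (of_real s) (phase x i j {i, j, k} (- \<alpha>) \<psi>)) a =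
      controlled_givens x i j A c (cis \<gamma> * of_real s) \<psi> a"
      using phase_conj_controlled_givens[OF assms(1-3,8), of x \<alpha> c "of_real s" \<psi> a] by (simp add: \<alpha>_def mult.commute)
  qed
qed

text \<open>Three qubits \<open>i, j, k\<close> belong to every control set, as the commutator
  requires. The others, at most \<open>2 ^ r\<close>, are halved in each step at the price of four
  smaller rotations. For up to four controls the cost 16 consists of 6 gates for real
  \<open>s\<close> and 10 for its phase.\<close>

lemma realizable_op_controlled_givens_power4:
  assumes "i \<noteq> j" "bit x i \<noteq> bit x j"
  shows "\<lbrakk>{i, j} \<subset> A; A \<subseteq> {..<n}; card A \<le> 2 ^ r + 3; c\<^sup>2 + (cmod s)\<^sup>2 = 1\<rbrakk> \<Longrightarrow>
    realizable_op n (16 * 4 ^ r) (controlled_givens x i j A c s)"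
proof (induction r arbitrary: A c s)
  case 0
  obtain k where k: "k \<in> A" "k \<noteq> i" "k \<noteq> j" using 0 by blast
  have lt: "i < n" "j < n" "k < n" using 0 k by auto
  obtain \<phi> \<gamma> where cs: "c = cos \<phi>" "s = cis \<gamma> * of_real (sin \<phi>)" using givens_polar 0 by blast
  have fin: "finite A" using 0 finite_subset by blast
  have sub: "{i, j, k} \<subseteq> A" using 0(1) k(1) by blast
  have "realizable_op n 6 (controlled_givens x i j A (cos \<phi>) (of_real (sin \<phi>)))"
  proof (cases "A = {i, j, k}")
    case True
    show ?thesis unfolding True by (rule realizable_op_mono[OF realizable_op_controlled_givens3_real[OF assms(1) k(2,3) lt assms(2)]]) simp
  next
    case False
    then obtain l where l: "l \<in> A" "l \<notin> {i, j, k}" using 0 k by blast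
    have "card {i, j, k, l} = 4" using l k assms(1) by auto
    then have A: "A = {i, j, k} \<union> {i, j, l}"
      using card_subset_eq[OF fin, of "{i, j, k, l}"] card_mono[OF fin, of "{i, j, k, l}"] 0 k l by auto
    \<comment> \<open>Each factor takes half the angle, since
      \<open>controlled_givens_real_product\<close> doubles it.\<close>
    obtain c' s' where h: "c'\<^sup>2 + s'\<^sup>2 = 1" "cos \<phi> = c'\<^sup>2 - s'\<^sup>2" "sin \<phi> = 2 * c' * s'" by (rule half_angle)
    obtain \<beta> where b: "c' = cos \<beta>" "s' = sin \<beta>" using sincos_total_2pi[OF h(1)] by metis
    have "realizable_op n (3 + 3) (\<lambda>\<psi>. controlled_givens x i j {i, j, k} (cos \<beta>) (of_real (sin \<beta>)) (controlled_givens x i j {i, j, l} (cos \<beta>) (of_real (sin \<beta>)) \<psi>))"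
      by (rule realizable_op_compose[OF realizable_op_controlled_givens3_real realizable_op_controlled_givens3_real]) (use l 0 assms k lt in auto)
    then have "realizable_op n 6 (\<lambda>\<psi>. controlled_givens x i j {i, j, k} c' (of_real s') (controlled_givens x i j {i, j, l} c' (of_real s') \<psi>))"
      by (simp add: b)
    then show ?thesis
      unfolding A h(2,3)
      by (rule realizable_op_eq) (rule controlled_givens_real_product[OF assms(1) k(2,3) _ _ assms(2) h(1)], use l in auto)
  qed
  then have "realizable_op n (6 + 10) (controlled_givens x i j A c s)"
    unfolding cs by (rule realizable_op_phase_conj[OF assms(1) k(2,3) lt assms(2) sub])
  then show ?case by simp
next
  case (Suc r)
  obtain k where k: "k \<in> A" "k \<noteq> i" "k \<noteq> j" using Suc.prems by blast
  obtain \<phi> \<gamma> where cs: "c = cos \<phi>" "s = cis \<gamma> * of_real (sin \<phi>)" using givens_polar Suc.prems by blast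
  obtain c' s' where h: "c'\<^sup>2 + s'\<^sup>2 = 1" "cos \<phi> = c'\<^sup>2 - s'\<^sup>2" "sin \<phi> = 2 * c' * s'" by (rule half_angle)
  let ?T = "{i, j, k}" and ?w = "cis \<gamma>"
  have fin: "finite A" using Suc.prems finite_subset by blast
  have T: "?T \<subseteq> A" "card ?T = 3" using Suc.prems k assms(1) by auto
  then have "card (A - ?T) = card A - 3" by (simp add: card_Diff_subset)
  then have c: "card (A - ?T) \<le> 2 ^ r + 2 ^ r" using Suc.prems by simp
  \<comment> \<open>If at most \<open>2 ^ r\<close> controls remain besides \<open>?T\<close>, all
    of them go to \<open>C\<close> and \<open>D\<close> is empty; \<open>?T \<union> D\<close> is
    then \<open>?T\<close>, which still has a third control.\<close>
  obtain C where C: "C \<subseteq> A - ?T" "card C = min (card (A - ?T)) (2 ^ r)"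
    by (metis min.cobounded1 obtain_subset_with_card_n)
  define D where "D = A - ?T - C"
  have finC: "finite C" "finite D" using C fin finite_subset by (auto simp: D_def)
  have "card D = card (A - ?T) - card C" unfolding D_def using C finC by (intro card_Diff_subset) auto
  then have D: "card D \<le> 2 ^ r" using C c by auto
  have un: "A = (?T \<union> C) \<union> (?T \<union> D)" using C T by (auto simp: D_def)
  have sz: "card (?T \<union> C) \<le> 2 ^ r + 3" "card (?T \<union> D) \<le> 2 ^ r + 3"
    using card_Un_le[of ?T C] card_Un_le[of ?T D] C D T by auto
  have ps: "{i, j} \<subset> ?T \<union> C" "{i, j} \<subset> ?T \<union> D" "?T \<union> C \<subseteq> {..<n}" "?T \<union> D \<subseteq> {..<n}"
    using k C T Suc.prems by (auto simp: D_def)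
  have g: "c'\<^sup>2 + (cmod (?w * of_real s'))\<^sup>2 = 1" "c'\<^sup>2 + (cmod (- ?w * of_real s'))\<^sup>2 = 1"
    "0\<^sup>2 + (cmod (\<i> * ?w))\<^sup>2 = 1" "0\<^sup>2 + (cmod (- \<i> * ?w))\<^sup>2 = 1"
    using h(1) by (simp_all add: norm_mult)
  let ?q = "16 * 4 ^ r"
  have "realizable_op n (?q + (?q + (?q + ?q))) (\<lambda>\<psi>. controlled_givens x i j (?T \<union> C) c' (?w * of_real s') (controlled_givens x i j (?T \<union> D) 0 (\<i> * ?w)
      (controlled_givens x i j (?T \<union> C) c' (- ?w * of_real s') (controlled_givens x i j (?T \<union> D) 0 (- \<i> * ?w) \<psi>))))"
    by (rule realizable_op_compose[OF Suc.IH[OF ps(1,3) sz(1) g(1)] realizable_op_compose[OF Suc.IH[OF ps(2,4) sz(2) g(3)]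
      realizable_op_compose[OF Suc.IH[OF ps(1,3) sz(1) g(2)] Suc.IH[OF ps(2,4) sz(2) g(4)]]]])
  then have s: "realizable_op n (16 * 4 ^ Suc r) (\<lambda>\<psi>. controlled_givens x i j (?T \<union> C) c' (?w * of_real s') (controlled_givens x i j (?T \<union> D) 0 (\<i> * ?w)
      (controlled_givens x i j (?T \<union> C) c' (- ?w * of_real s') (controlled_givens x i j (?T \<union> D) 0 (- \<i> * ?w) \<psi>))))"
    by simp
  show ?case
    unfolding cs h(2,3) by (subst un, rule realizable_op_eq[OF s], rule controlled_givens_commutator[OF assms(1) k(2,3) _ _ h(1) cis_mult_cnj]) auto
qed

section \<open>Two-level rotations\<close>

text \<open>The complements are rotated along because of the flip symmetry. The order of the
  branches is immaterial when the four strings are distinct, the case of interest.\<close>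

definition two_level :: "nat \<Rightarrow> nat \<Rightarrow> nat \<Rightarrow> real \<Rightarrow> complex \<Rightarrow> (nat \<Rightarrow> complex) \<Rightarrow> nat \<Rightarrow> complex" where
  "two_level n x y c s \<psi> a =
     (if a = x then of_real c * \<psi> x - cnj s * \<psi> y
      else if a = flip_all n x then of_real c * \<psi> (flip_all n x) - cnj s * \<psi> (flip_all n y)
      else if a = y then of_real c * \<psi> y + s * \<psi> x
      else if a = flip_all n y then of_real c * \<psi> (flip_all n y) + s * \<psi> (flip_all n x)
      else \<psi> a)"

lemma agree_all: "a < 2 ^ n \<Longrightarrow> x < 2 ^ n \<Longrightarrow> agree x {..<n} a \<longleftrightarrow> a = x \<or> a = flip_all n x"
  using eq_if_low_bits[of a n x] eq_if_low_bits[of a n "flip_all n x"] by (auto simp: agree_def bit_flip_all)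

text \<open>The source of the third control qubit, for which \<open>3 \<le> n\<close> is
  assumed.\<close>

lemma exists_third:
  assumes "3 \<le> (n::nat)"
  obtains k where "k < n" "k \<noteq> i" "k \<noteq> j"
proof -
  have "card {i, j} \<le> 2" by (auto simp: card_insert_if)
  then have "\<not> {..<n} \<subseteq> {i, j}" using card_mono[of "{i, j}" "{..<n}"] assms by auto
  then show thesis using that by auto
qed

lemma flip2_neq_flip_all: "3 \<le> n \<Longrightarrow> i \<noteq> j \<Longrightarrow> flip2 i j x \<noteq> flip_all n x"
  using exists_third[of n i j] by (metis bit_flip_all bit_flip2)

text \<open>With all qubits as controls, only \<open>x\<close> and its complement match.\<close>

lemma controlled_givens_all_eq_two_level:
  assumes "3 \<le> n" "i \<noteq> j" "i < n" "j < n" "x < 2 ^ n" "a < 2 ^ n"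
  shows "controlled_givens x i j {..<n} c s \<psi> a = two_level n x (flip2 i j x) c s \<psi> a"
proof -
  have "flip2 i j a = x \<longleftrightarrow> a = flip2 i j x" "flip2 i j a = flip_all n x \<longleftrightarrow> a = flip_all n (flip2 i j x)"
    using assms(2) by (metis flip2_flip2 flip_all_flip2)+
  then show ?thesis
    using assms flip2_neq_flip_all[OF assms(1,2), of x] flip2_neq_flip_all[OF assms(1,2), of "flip_all n x"]
    by (auto simp: controlled_givens_def two_level_def agree_all flip_all_flip2 flip_all_eq_iff)
qed

text \<open>The smallest power of two that is at least \<open>n\<close> is at most
  \<open>2 * n\<close>, and \<open>16 * 4 ^ r\<close> is 16 times the square of
  \<open>2 ^ r\<close>.\<close>

definition gate_bound :: "nat \<Rightarrow> nat" where
  "gate_bound n = 64 * n\<^sup>2"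

lemma realizable_op_two_level_flip2:
  assumes "3 \<le> n" "i \<noteq> j" "i < n" "j < n" "x < 2 ^ n" "bit x i \<noteq> bit x j" "c\<^sup>2 + (cmod s)\<^sup>2 = 1"
  shows "realizable_op n (gate_bound n) (two_level n x (flip2 i j x) c s)"
proof -
  define r where "r = (LEAST r. n \<le> 2 ^ r)"
  have r: "n \<le> 2 ^ r" unfolding r_def by (rule LeastI[of _ n]) (simp add: less_imp_le)
  have "r \<noteq> 0" using r assms(1) by (auto intro: ccontr)
  then have "\<not> n \<le> 2 ^ (r - 1)" using not_less_Least[of "r - 1" "\<lambda>r. n \<le> 2 ^ r"] by (simp add: r_def)
  then have r2: "2 ^ r \<le> 2 * n" using \<open>r \<noteq> 0\<close> by (cases r) auto
  obtain k where k: "k < n" "k \<noteq> i" "k \<noteq> j" using exists_third[OF assms(1)] by blast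
  have "realizable_op n (16 * 4 ^ r) (controlled_givens x i j {..<n} c s)"
    using assms r k by (intro realizable_op_controlled_givens_power4) auto
  moreover have "16 * (4::nat) ^ r \<le> gate_bound n"
  proof -
    have "(4::nat) ^ r = (2 ^ r)\<^sup>2" by (simp flip: power_mult power_mult_distrib) (simp add: power_mult mult.commute[of r 2])
    also have "\<dots> \<le> (2 * n)\<^sup>2" using r2 by (intro power_mono) auto
    finally show ?thesis by (simp add: gate_bound_def power2_eq_square)
  qed
  ultimately have "realizable_op n (gate_bound n) (controlled_givens x i j {..<n} c s)" by (rule realizable_op_mono)
  then show ?thesis by (rule realizable_op_eq) (rule controlled_givens_all_eq_two_level[OF assms(1-5)])
qed

text \<open>The outer factors exchange \<open>y\<close> and \<open>z\<close> up to sign and are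
  inverse to each other.\<close>

lemma two_level_conj:
  assumes "distinct [x, y, z, flip_all n x, flip_all n y, flip_all n z]"
  shows "two_level n y z 0 1 (two_level n x y c s (two_level n y z 0 (- 1) \<psi>)) a = two_level n x z c s \<psi> a"
  using assms by (auto simp: two_level_def)

section \<open>Rotations of basis vectors at larger distance\<close>

lemma distance_step:
  assumes "x < 2 ^ n" "z < 2 ^ n" "x \<noteq> z" "hamming_weight n x = hamming_weight n z"
  obtains i j where "i < n" "j < n" "i \<noteq> j" "bit z i" "\<not> bit x i" "bit x j" "\<not> bit z j"
proof -
  let ?X = "{k. k < n \<and> bit x k}" and ?Z = "{k. k < n \<and> bit z k}"
  have "?X \<noteq> ?Z" using assms eq_if_low_bits[of x n z] by auto
  moreover have "card ?X = card ?Z" using assms by (simp add: hamming_weight_def)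
  ultimately have "\<not> ?X \<subseteq> ?Z" "\<not> ?Z \<subseteq> ?X"
    using card_subset_eq[of ?Z ?X] card_subset_eq[of ?X ?Z] by auto
  then show thesis using that by blast
qed

definition distance :: "nat \<Rightarrow> nat \<Rightarrow> nat \<Rightarrow> nat" where
  "distance n x z = card {k. k < n \<and> bit x k \<noteq> bit z k}"

lemma distance_flip2:
  assumes "i < n" "j < n" "i \<noteq> j" "bit x i \<noteq> bit z i" "bit x j \<noteq> bit z j"
  shows "distance n x (flip2 i j z) + 2 = distance n x z"
proof -
  let ?D = "{k. k < n \<and> bit x k \<noteq> bit z k}"
  have "{k. k < n \<and> bit x k \<noteq> bit (flip2 i j z) k} = ?D - {i, j}"
    using assms by (auto simp: bit_flip2)
  moreover have "card (?D - {i, j}) = card ?D - card {i, j}"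
    using assms by (intro card_Diff_subset) auto
  moreover have "card {i, j} \<le> card ?D" using assms by (intro card_mono) auto
  ultimately show ?thesis using assms by (simp add: distance_def)
qed

lemma distance_le: "distance n x z \<le> n"
  unfolding distance_def using card_mono[of "{..<n}" "{k. k < n \<and> bit x k \<noteq> bit z k}"] by auto

lemma distance_flip_all: "distance n x (flip_all n x) = n"
  by (simp add: distance_def bit_flip_all cong: conj_cong)

text \<open>Two bits of \<open>z\<close> are moved towards \<open>x\<close>, and exchanging
  \<open>z\<close> with the string obtained conjugates the rotation for the shorter path into the
  desired one. The two exchanges are paid for by the decrease of the distance by two.\<close>

lemma realizable_op_two_level_path:
  assumes n: "3 \<le> n" and "x < 2 ^ n" and cs: "c\<^sup>2 + (cmod s)\<^sup>2 = 1"
  shows "\<lbrakk>z < 2 ^ n; z \<noteq> x; z \<noteq> flip_all n x; hamming_weight n x = hamming_weight n z\<rbrakk> \<Longrightarrow>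
    realizable_op n (distance n x z * gate_bound n) (two_level n x z c s)"
proof (induction "distance n x z" arbitrary: z rule: less_induct)
  case less
  let ?K = "gate_bound n"
  obtain i j where ij: "i < n" "j < n" "i \<noteq> j" "bit z i" "\<not> bit x i" "bit x j" "\<not> bit z j"
    using distance_step assms(2) less.prems by metis
  let ?y = "flip2 i j z"
  have d: "distance n x ?y + 2 = distance n x z" using ij by (intro distance_flip2) auto
  have y: "?y < 2 ^ n" "hamming_weight n x = hamming_weight n ?y" "bit ?y i \<noteq> bit ?y j"
    using less.prems ij by (auto simp: hamming_weight_flip2 bit_flip2)
  \<comment> \<open>The complement of \<open>x\<close> has the largest possible distance
    \<open>n\<close>, whereas \<open>?y\<close> is strictly nearer to \<open>x\<close> than
    \<open>z\<close> is.\<close>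
  have yc: "?y \<noteq> flip_all n x" using d distance_le[of n x z] by (auto simp: distance_flip_all)
  have yz: "?y \<noteq> flip_all n z" using n ij by (intro flip2_neq_flip_all)
  then have yz': "z \<noteq> flip_all n ?y" by (metis flip_all_flip_all)
  show ?case
  proof (cases "?y = x")
    case True
    then have "z = flip2 i j x" using ij by (metis flip2_flip2)
    then have "realizable_op n ?K (two_level n x z c s)"
      using realizable_op_two_level_flip2[OF n ij(3,1,2) assms(2) _ cs] ij by simp
    then show ?thesis by (rule realizable_op_mono) (use d in simp)
  next
    case False
    have IH: "realizable_op n (distance n x ?y * ?K) (two_level n x ?y c s)"
      using d by (intro less.hyps y False yc) auto
    have s1: "realizable_op n ?K (two_level n ?y z 0 w)" if "cmod w = 1" for w
      using realizable_op_two_level_flip2[OF n ij(3,1,2) y(1,3), of 0 w] that ij(3) by simp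
    have dist: "distinct [x, ?y, z, flip_all n x, flip_all n ?y, flip_all n z]"
      using False yc yz yz' less.prems n ij(3) by (auto simp: flip_all_eq_iff flip_all_neq flip_all_neq[symmetric])
    have "realizable_op n (?K + (distance n x ?y * ?K + ?K))
        (\<lambda>\<psi>. two_level n ?y z 0 1 (two_level n x ?y c s (two_level n ?y z 0 (- 1) \<psi>)))"
      by (rule realizable_op_compose[OF s1 realizable_op_compose[OF IH s1]]) auto
    then have "realizable_op n (?K + (distance n x ?y * ?K + ?K)) (two_level n x z c s)"
      by (rule realizable_op_eq) (rule two_level_conj[OF dist])
    then show ?thesis by (rule realizable_op_mono) (simp add: d[symmetric])
  qed
qed

section \<open>Unitarity of circuits\<close>

lemma rot_inverse: "i \<noteq> j \<Longrightarrow> rot i j (- \<theta>) (rot i j \<theta> \<psi>) a = \<psi> a"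
proof -
  assume ij: "i \<noteq> j"
  define C S where "C = complex_of_real (cos \<theta>)" "S = complex_of_real (sin \<theta>)"
  have cs: "C * C + S * S = 1"
    by (simp only: C_S_def of_real_mult[symmetric] of_real_add[symmetric] sin_cos_squared_add3 of_real_1)
  have "C * (C * p + \<i> * S * q) - \<i> * S * (C * q + \<i> * S * p) = (C * C + S * S) * p" for p q
    by (simp add: algebra_simps)
  then show ?thesis using ij cs by (auto simp: rot_def bit_flip2 simp flip: C_S_def)
qed

text \<open>Reversing the order of the gates and the signs of the angles does not change their
  number.\<close>

lemma realizable_inverse:
  assumes "realizable n k M"
  obtains M' where "realizable n k M'" "M' * M = 1\<^sub>m (2 ^ n)"
proof -
  have "\<exists>M'. realizable n (length gs) M' \<and> M' * circuit_unitary n gs = 1\<^sub>m (2 ^ n)" if "xy_circuit n gs" for gs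
    using that
  proof (induction gs)
    case Nil
    show ?case by (rule exI[of _ "1\<^sub>m (2 ^ n)"]) (simp add: realizable_one circuit_unitary_def)
  next
    case (Cons g gs)
    obtain \<theta> i j where g: "g = (\<theta>, i, j)" by (cases g)
    have ij: "i \<noteq> j" "i < n" "j < n" and "xy_circuit n gs" using Cons.prems by (auto simp: xy_circuit_def g)
    then obtain M' where M': "realizable n (length gs) M'" "M' * circuit_unitary n gs = 1\<^sub>m (2 ^ n)" using Cons.IH by blast
    obtain G where G: "realizable n 1 G" "acts n G (rot i j (- \<theta>))" using realizable_op_rot[OF ij] by (auto simp: realizable_op_def)
    have "acts n (G * xy_gate n g) (\<lambda>\<psi>. rot i j (- \<theta>) (rot i j \<theta> \<psi>))"
      unfolding g by (rule acts_mult[OF G(2) acts_xy_gate[OF ij]])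
    then have "acts n (G * xy_gate n g) (\<lambda>\<psi>. \<psi>)"
      using rot_inverse[OF ij(1)] by (auto intro: acts_cong)
    then have inv: "G * xy_gate n g = 1\<^sub>m (2 ^ n)" using acts_unique acts_one by blast
    have car: "G \<in> carrier_mat (2 ^ n) (2 ^ n)" "M' \<in> carrier_mat (2 ^ n) (2 ^ n)"
      "xy_gate n g \<in> carrier_mat (2 ^ n) (2 ^ n)" "circuit_unitary n gs \<in> carrier_mat (2 ^ n) (2 ^ n)"
      using realizable_carrier G M' xy_gate_carrier circuit_unitary_carrier by (auto simp: g)
    have "(M' * G) * circuit_unitary n (g # gs) = M' * G * (xy_gate n g * circuit_unitary n gs)"
      by (simp add: circuit_unitary_def)
    also have "\<dots> = M' * (G * (xy_gate n g * circuit_unitary n gs))"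
      by (rule assoc_mult_mat[OF car(2,1) mult_carrier_mat[OF car(3,4)]])
    also have "G * (xy_gate n g * circuit_unitary n gs) = (G * xy_gate n g) * circuit_unitary n gs"
      by (rule assoc_mult_mat[OF car(1,3,4), symmetric])
    also have "\<dots> = circuit_unitary n gs" using car(4) by (simp add: inv)
    finally have "(M' * G) * circuit_unitary n (g # gs) = 1\<^sub>m (2 ^ n)" by (simp add: M')
    moreover have "realizable n (length (g # gs)) (M' * G)" using realizable_mult[OF M'(1) G(1)] by simp
    ultimately show ?case by blast
  qed
  then show thesis using assms that realizable_mono unfolding realizable_def[of n k M] by metis
qed

section \<open>Inner products and isometries\<close>

definition inner :: "nat \<Rightarrow> (nat \<Rightarrow> complex) \<Rightarrow> (nat \<Rightarrow> complex) \<Rightarrow> complex" where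
  "inner n \<psi> \<phi> = (\<Sum>a<2 ^ n. cnj (\<psi> a) * \<phi> a)"

definition isometric :: "nat \<Rightarrow> complex mat \<Rightarrow> bool" where
  "isometric n M \<longleftrightarrow> M \<in> carrier_mat (2 ^ n) (2 ^ n) \<and>
     (\<forall>\<psi> \<phi>. inner n (mat_act n M \<psi>) (mat_act n M \<phi>) = inner n \<psi> \<phi>)"

lemma isometric_carrier: "isometric n M \<Longrightarrow> M \<in> carrier_mat (2 ^ n) (2 ^ n)"
  by (simp add: isometric_def)

lemma inner_cong: "(\<And>a. a < 2 ^ n \<Longrightarrow> \<psi> a = \<psi>' a) \<Longrightarrow> (\<And>a. a < 2 ^ n \<Longrightarrow> \<phi> a = \<phi>' a) \<Longrightarrow> inner n \<psi> \<phi> = inner n \<psi>' \<phi>'"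
  by (auto simp: inner_def)

lemma inner_rot:
  assumes ij: "i \<noteq> j" "i < n" "j < n"
  shows "inner n (rot i j \<theta> \<psi>) (rot i j \<theta> \<phi>) = inner n \<psi> \<phi>"
proof -
  define C S where "C = complex_of_real (cos \<theta>)" "S = complex_of_real (sin \<theta>)"
  note d = this
  have cs: "C * C + S * S = 1"
    by (simp only: d of_real_mult[symmetric] of_real_add[symmetric] sin_cos_squared_add3 of_real_1)
  have cn: "cnj C = C" "cnj S = S" by (simp_all add: d)
  let ?g = "\<lambda>a. cnj (rot i j \<theta> \<psi> a) * rot i j \<theta> \<phi> a" and ?h = "\<lambda>a. cnj (\<psi> a) * \<phi> a"
  have re: "(\<Sum>a<2 ^ n. F (flip2 i j a)) = (\<Sum>a<2 ^ n. F a)" for F :: "nat \<Rightarrow> complex"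
    by (rule sum.reindex_bij_betw[OF bij_flip2[OF ij]])
  have e: "(C * p - \<i> * S * q) * (C * u + \<i> * S * v) + (C * q - \<i> * S * p) * (C * v + \<i> * S * u) =
      (C * C + S * S) * (p * u + q * v)" for p q u v
    by (simp add: algebra_simps)
  \<comment> \<open>On each pair of partners the rotation is a unitary matrix of size two. Summing
    over all indices then counts every pair twice on both sides.\<close>
  have "?g a + ?g (flip2 i j a) = ?h a + ?h (flip2 i j a)" for a
    using ij(1) by (auto simp: rot_def bit_flip2 cn e cs simp flip: d)
  then have "(\<Sum>a<2 ^ n. ?g a + ?g (flip2 i j a)) = (\<Sum>a<2 ^ n. ?h a + ?h (flip2 i j a))" by simp
  then have "2 * (\<Sum>a<2 ^ n. ?g a) = 2 * (\<Sum>a<2 ^ n. ?h a)"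
    unfolding sum.distrib re[of ?g] re[of ?h] by simp
  then show ?thesis by (simp add: inner_def)
qed

lemma isometric_mult: "isometric n A \<Longrightarrow> isometric n B \<Longrightarrow> isometric n (A * B)"
  by (auto simp: isometric_def mat_act_mult)

lemma isometric_one: "isometric n (1\<^sub>m (2 ^ n))"
  by (auto simp: isometric_def mat_act_one intro!: inner_cong)

lemma isometric_realizable:
  assumes "realizable n k M"
  shows "isometric n M"
proof -
  have "isometric n (circuit_unitary n gs)" if "xy_circuit n gs" for gs
    using that
  proof (induction gs)
    case (Cons g gs)
    obtain \<theta> i j where g: "g = (\<theta>, i, j)" by (cases g)
    have ij: "i \<noteq> j" "i < n" "j < n" and gs: "xy_circuit n gs" using Cons.prems by (auto simp: xy_circuit_def g)
    have a: "mat_act n (xy_gate n g) \<psi> a = rot i j \<theta> \<psi> a" if "a < 2 ^ n" for \<psi> a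
      using acts_xy_gate[OF ij, of \<theta>] that by (auto simp: acts_def g)
    have "isometric n (xy_gate n g)"
      unfolding isometric_def using xy_gate_carrier[of n \<theta> i j] inner_rot[OF ij, of \<theta>]
      by (auto simp: g[symmetric] inner_cong[OF a a])
    then have "isometric n (xy_gate n g * circuit_unitary n gs)" using Cons.IH[OF gs] by (rule isometric_mult)
    then show ?case by (simp add: circuit_unitary_def)
  qed (simp add: circuit_unitary_def isometric_one)
  then show ?thesis using assms by (auto simp: realizable_def)
qed

lemma isometric_unitary:
  assumes "unitary (2 ^ n) V"
  shows "isometric n V"
proof -
  let ?N = "2 ^ n"
  have V: "V \<in> carrier_mat ?N ?N" and VV: "mat_adjoint V * V = 1\<^sub>m ?N" using assms by (auto simp: unitary_def)
  have adj: "mat_adjoint V \<in> carrier_mat ?N ?N" using V by (auto simp: mat_adjoint_def mat_of_rows_def)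
  have ad: "mat_adjoint V $$ (b, a) = cnj (V $$ (a, b))" if "a < ?N" "b < ?N" for a b
    using that V by (simp add: mat_adjoint_def mat_of_rows_def)
  have orth: "(\<Sum>a<?N. cnj (V $$ (a, b)) * V $$ (a, c)) = of_bool (b = c)" if "b < ?N" "c < ?N" for b c
  proof -
    have "(mat_adjoint V * V) $$ (b, c) = (\<Sum>a<?N. cnj (V $$ (a, b)) * V $$ (a, c))"
      using mat_mult_index[OF adj V that] that by (simp add: ad)
    then show ?thesis using that by (cases "b = c") (auto simp: VV)
  qed
  have "inner n (mat_act n V \<psi>) (mat_act n V \<phi>) = inner n \<psi> \<phi>" for \<psi> \<phi>
  proof -
    have "inner n (mat_act n V \<psi>) (mat_act n V \<phi>) =
        (\<Sum>a<?N. \<Sum>b<?N. \<Sum>c<?N. cnj (\<psi> b) * \<phi> c * (cnj (V $$ (a, b)) * V $$ (a, c)))"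
      unfolding inner_def
      by (intro sum.cong refl) (simp add: mat_act_def sum_product, simp add: ac_simps)
    also have "\<dots> = (\<Sum>b<?N. \<Sum>a<?N. \<Sum>c<?N. cnj (\<psi> b) * \<phi> c * (cnj (V $$ (a, b)) * V $$ (a, c)))"
      by (rule sum.swap)
    also have "\<dots> = (\<Sum>b<?N. \<Sum>c<?N. \<Sum>a<?N. cnj (\<psi> b) * \<phi> c * (cnj (V $$ (a, b)) * V $$ (a, c)))"
      by (intro sum.cong refl sum.swap)
    also have "\<dots> = (\<Sum>b<?N. \<Sum>c<?N. if c = b then cnj (\<psi> b) * \<phi> b else 0)"
      by (intro sum.cong refl) (auto simp: orth simp flip: sum_distrib_left)
    also have "\<dots> = inner n \<psi> \<phi>" by (simp add: inner_def)
    finally show ?thesis .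
  qed
  then show ?thesis using V by (simp add: isometric_def)
qed

section \<open>Elimination along a tree\<close>

text \<open>A connected vertex set together with the possibility of building it up leaf by leaf;
  elimination removes the leaves in the reverse order.\<close>

inductive tree :: "('a \<Rightarrow> 'a \<Rightarrow> bool) \<Rightarrow> 'a set \<Rightarrow> bool" for adj where
  tree_single: "tree adj {x}"
| tree_insert: "tree adj P \<Longrightarrow> y \<notin> P \<Longrightarrow> p \<in> P \<Longrightarrow> adj p y \<Longrightarrow> tree adj (insert y P)"

lemma tree_finite: "tree adj P \<Longrightarrow> finite P \<and> P \<noteq> {}"
  by (induction rule: tree.induct) auto

text \<open>The pair (c, s) is proportional to (\<alpha>, - \<beta>), normalized and with its phase
  chosen so that \<open>c\<close> is real.\<close>

lemma givens_zero_second: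
  obtains c :: real and s :: complex where "c\<^sup>2 + (cmod s)\<^sup>2 = 1" "of_real c * \<beta> + s * \<alpha> = 0"
proof (cases "\<alpha> = 0")
  case True
  then show thesis using that[of 0 1] by simp
next
  case False
  define r where "r = sqrt ((cmod \<alpha>)\<^sup>2 + (cmod \<beta>)\<^sup>2)"
  have r: "r \<noteq> 0" "r\<^sup>2 = (cmod \<alpha>)\<^sup>2 + (cmod \<beta>)\<^sup>2"
    using False by (simp_all add: r_def sum_power2_eq_zero_iff)
  have "(cmod \<alpha> / r)\<^sup>2 + (cmod (- of_real (cmod \<alpha> / r) * \<beta> / \<alpha>))\<^sup>2 = ((cmod \<alpha>)\<^sup>2 + (cmod \<beta>)\<^sup>2) / r\<^sup>2"
    using False by (simp add: norm_mult norm_divide power_divide power_mult_distrib add_divide_distrib)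
  then have "(cmod \<alpha> / r)\<^sup>2 + (cmod (- of_real (cmod \<alpha> / r) * \<beta> / \<alpha>))\<^sup>2 = 1"
    using r False by simp
  moreover have "of_real (cmod \<alpha> / r) * \<beta> + (- of_real (cmod \<alpha> / r) * \<beta> / \<alpha>) * \<alpha> = 0" using False by simp
  ultimately show thesis by (rule that)
qed

lemma givens_zero_first:
  obtains c :: real and s :: complex where "c\<^sup>2 + (cmod s)\<^sup>2 = 1" "of_real c * \<alpha> - cnj s * \<beta> = 0"
proof -
  obtain c s where "c\<^sup>2 + (cmod s)\<^sup>2 = 1" "of_real c * \<alpha> + s * \<beta> = 0"
    by (rule givens_zero_second)
  then show thesis using that[of c "- cnj s"] by simp
qed

text \<open>The common form of all sectors. \<open>H\<close> is the sector, its vectors are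
  determined by their values on \<open>B\<close>, and the \<open>f x\<close> are orthogonal of
  squared norm \<kappa>. \<open>Out\<close> collects the vectors outside the sector that must not be
  disturbed. A cheap \<open>rotation\<close> may act on \<open>Out\<close> in any way that maps it
  to itself; an \<open>isolated_rotation\<close> fixes it and costs \<open>L\<close> instead of
  \<open>K\<close>.\<close>

locale elimination =
  fixes n :: nat and B :: "nat set" and f :: "nat \<Rightarrow> nat \<Rightarrow> complex" and H Out :: "(nat \<Rightarrow> complex) set"
    and \<kappa> :: complex and adj :: "nat \<Rightarrow> nat \<Rightarrow> bool" and K L :: nat
  assumes f_in: "x \<in> B \<Longrightarrow> f x \<in> H"
    and f_delta: "x \<in> B \<Longrightarrow> y \<in> B \<Longrightarrow> f x y = of_bool (y = x)"
    and H_ext: "\<phi> \<in> H \<Longrightarrow> \<psi> \<in> H \<Longrightarrow> (\<And>x. x \<in> B \<Longrightarrow> \<phi> x = \<psi> x) \<Longrightarrow> \<phi> = \<psi>"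
    and H_scale: "\<phi> \<in> H \<Longrightarrow> (\<lambda>a. \<mu> * \<phi> a) \<in> H"
    and H_support: "\<phi> \<in> H \<Longrightarrow> \<not> a < 2 ^ n \<Longrightarrow> \<phi> a = 0"
    and Out_support: "\<phi> \<in> Out \<Longrightarrow> \<not> a < 2 ^ n \<Longrightarrow> \<phi> a = 0"
    and H_realizable: "realizable n k M \<Longrightarrow> \<phi> \<in> H \<Longrightarrow> mat_act n M \<phi> \<in> H"
    and Out_realizable: "realizable n k M \<Longrightarrow> \<phi> \<in> Out \<Longrightarrow> mat_act n M \<phi> \<in> Out"
    and inner_f: "x \<in> B \<Longrightarrow> \<phi> \<in> H \<Longrightarrow> inner n (f x) \<phi> = \<kappa> * \<phi> x" and \<kappa>: "\<kappa> \<noteq> 0"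
    and rotation: "x \<in> B \<Longrightarrow> y \<in> B \<Longrightarrow> adj x y \<Longrightarrow> c\<^sup>2 + (cmod s)\<^sup>2 = 1 \<Longrightarrow>
      \<exists>M. realizable n K M \<and> (\<forall>\<phi>\<in>H. mat_act n M \<phi> x = of_real c * \<phi> x - cnj s * \<phi> y \<and>
        mat_act n M \<phi> y = of_real c * \<phi> y + s * \<phi> x \<and> (\<forall>z\<in>B - {x, y}. mat_act n M \<phi> z = \<phi> z))"
    and isolated_rotation: "x \<in> B \<Longrightarrow> y \<in> B \<Longrightarrow> adj x y \<Longrightarrow> c\<^sup>2 + (cmod s)\<^sup>2 = 1 \<Longrightarrow>
      \<exists>M. realizable n L M \<and> (\<forall>\<phi>\<in>H. mat_act n M \<phi> x = of_real c * \<phi> x - cnj s * \<phi> y \<and>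
        mat_act n M \<phi> y = of_real c * \<phi> y + s * \<phi> x \<and> (\<forall>z\<in>B - {x, y}. mat_act n M \<phi> z = \<phi> z)) \<and>
        (\<forall>\<psi>\<in>Out. mat_act n M \<psi> = \<psi>)"
begin

definition fixes_off :: "nat set \<Rightarrow> complex mat \<Rightarrow> bool" where
  "fixes_off P M \<longleftrightarrow> (\<forall>z\<in>B - P. mat_act n M (f z) = f z)"

lemma act_one: "\<phi> \<in> H \<union> Out \<Longrightarrow> mat_act n (1\<^sub>m (2 ^ n)) \<phi> = \<phi>"
proof
  fix a assume "\<phi> \<in> H \<union> Out"
  then show "mat_act n (1\<^sub>m (2 ^ n)) \<phi> a = \<phi> a"
    using H_support Out_support by (cases "a < 2 ^ n") (auto simp: mat_act_one)
qed

lemma fixes_off_mult: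
  "isometric n A \<Longrightarrow> isometric n M \<Longrightarrow> fixes_off P A \<Longrightarrow> fixes_off Q M \<Longrightarrow> P \<union> Q \<subseteq> R \<Longrightarrow> fixes_off R (A * M)"
  unfolding fixes_off_def
proof
  assume A: "isometric n A" and M: "isometric n M" and fA: "\<forall>z\<in>B - P. mat_act n A (f z) = f z"
    and fM: "\<forall>z\<in>B - Q. mat_act n M (f z) = f z" and "P \<union> Q \<subseteq> R"
  fix z assume "z \<in> B - R"
  then have "z \<in> B - P" "z \<in> B - Q" using \<open>P \<union> Q \<subseteq> R\<close> by auto
  then show "mat_act n (A * M) (f z) = f z"
    using fA fM by (simp add: mat_act_mult[OF isometric_carrier[OF A] isometric_carrier[OF M]])
qed

text \<open>An isometry that fixes \<open>f z\<close> preserves the inner product with it, which is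
  \<kappa> times the value at \<open>z\<close>. A trivial column thus makes its row trivial as
  well.\<close>

lemma coordinate_fixed:
  assumes "isometric n M" "\<And>\<phi>. \<phi> \<in> H \<Longrightarrow> mat_act n M \<phi> \<in> H" "z \<in> B" "mat_act n M (f z) = f z" "\<phi> \<in> H"
  shows "mat_act n M \<phi> z = \<phi> z"
proof -
  have "\<kappa> * mat_act n M \<phi> z = inner n (mat_act n M (f z)) (mat_act n M \<phi>)"
    using inner_f[OF assms(3) assms(2)[OF assms(5)]] by (simp only: assms(4))
  also have "\<dots> = inner n (f z) \<phi>" using assms(1) unfolding isometric_def by blast
  also have "\<dots> = \<kappa> * \<phi> z" by (rule inner_f[OF assms(3,5)])
  finally show ?thesis using \<kappa> by simp
qed

lemma fixes_off_coordinate: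
  "realizable n k M \<Longrightarrow> fixes_off P M \<Longrightarrow> z \<in> B - P \<Longrightarrow> \<phi> \<in> H \<Longrightarrow> mat_act n M \<phi> z = \<phi> z"
  using coordinate_fixed[OF isometric_realizable H_realizable] by (auto simp: fixes_off_def)

lemma rotation_fixes_off:
  assumes "realizable n k M" "x \<in> B" "y \<in> B" "x \<noteq> y"
    and M: "\<forall>\<phi>\<in>H. mat_act n M \<phi> x = of_real c * \<phi> x - cnj s * \<phi> y \<and>
        mat_act n M \<phi> y = of_real c * \<phi> y + s * \<phi> x \<and> (\<forall>z\<in>B - {x, y}. mat_act n M \<phi> z = \<phi> z)"
  shows "fixes_off {x, y} M"
  unfolding fixes_off_def
proof (intro ballI H_ext)
  fix z w assume z: "z \<in> B - {x, y}" and w: "w \<in> B"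
  have "mat_act n M (f z) x = 0" "mat_act n M (f z) y = 0" "f z x = 0" "f z y = 0"
    using M z f_in assms(2,3) by (auto simp: f_delta)
  moreover have "w \<notin> {x, y} \<Longrightarrow> mat_act n M (f z) w = f z w" using M z f_in w by auto
  ultimately show "mat_act n M (f z) w = f z w" by (cases "w = x"; cases "w = y") auto
qed (use assms H_realizable f_in in auto)

text \<open>Let the leaf \<open>y\<close> hang at \<open>p\<close>. If \<open>y\<close> is the
  target, the amplitude of \<open>P\<close> is collected at \<open>p\<close> and then moved over the
  last edge. Otherwise the amplitude at \<open>y\<close> is moved to \<open>p\<close> before the
  rest is collected within \<open>P\<close>. Either way the edge is used once.\<close>

lemma concentrate:
  "tree adj P \<Longrightarrow> P \<subseteq> B \<Longrightarrow> r \<in> P \<Longrightarrow> \<phi> \<in> H \<Longrightarrow>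
    \<exists>M. realizable n (card P * K) M \<and> fixes_off P M \<and> (\<forall>z\<in>P - {r}. mat_act n M \<phi> z = 0)"
proof (induction arbitrary: r \<phi> rule: tree.induct)
  case (tree_single x)
  show ?case
    using tree_single act_one f_in
    by (intro exI[of _ "1\<^sub>m (2 ^ n)"]) (auto simp: realizable_one fixes_off_def)
next
  case (tree_insert P y p)
  have pP: "P \<subseteq> B" "p \<in> B" "y \<in> B" "p \<noteq> y" using tree_insert by auto
  have card: "card (insert y P) * K = card P * K + K" "card (insert y P) * K = K + card P * K"
    using tree_finite[OF tree_insert.hyps(1)] tree_insert by auto
  show ?case
  proof (cases "r = y")
    case True
    obtain A where A: "realizable n (card P * K) A" "fixes_off P A" "\<forall>z\<in>P - {p}. mat_act n A \<phi> z = 0"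
      using tree_insert.IH[OF pP(1) tree_insert.hyps(3) tree_insert.prems(3)] by blast
    let ?\<phi> = "mat_act n A \<phi>"
    obtain c s where cs: "c\<^sup>2 + (cmod s)\<^sup>2 = 1" "of_real c * ?\<phi> p - cnj s * ?\<phi> y = 0" by (rule givens_zero_first)
    obtain M where M: "realizable n K M" "\<forall>\<phi>\<in>H. mat_act n M \<phi> p = of_real c * \<phi> p - cnj s * \<phi> y \<and>
        mat_act n M \<phi> y = of_real c * \<phi> y + s * \<phi> p \<and> (\<forall>z\<in>B - {p, y}. mat_act n M \<phi> z = \<phi> z)"
      using rotation[OF pP(2,3) tree_insert.hyps(4) cs(1)] by blast
    have MA: "mat_act n (M * A) \<phi> = mat_act n M ?\<phi>" using realizable_carrier[OF M(1)] realizable_carrier[OF A(1)] by (rule mat_act_mult)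
    have "\<forall>z\<in>insert y P - {r}. mat_act n (M * A) \<phi> z = 0"
    proof
      fix z assume "z \<in> insert y P - {r}"
      then have z: "z \<in> P" "z \<in> B" "z \<noteq> y" using True pP by auto
      then show "mat_act n (M * A) \<phi> z = 0"
        unfolding MA using M(2) H_realizable[OF A(1) tree_insert.prems(3)] A(3) cs(2) by (cases "z = p") auto
    qed
    moreover have "realizable n (card (insert y P) * K) (M * A)" unfolding card(2) by (rule realizable_mult[OF M(1) A(1)])
    moreover have "fixes_off (insert y P) (M * A)"
      using rotation_fixes_off[OF M(1) pP(2-4) M(2)] A tree_insert.hyps(3)
      by (intro fixes_off_mult[of M A "{p, y}" P] isometric_realizable[OF M(1)] isometric_realizable[OF A(1)]) auto
    ultimately show ?thesis by blast
  next
    case False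
    then have r: "r \<in> P" using tree_insert by auto
    obtain c s where cs: "c\<^sup>2 + (cmod s)\<^sup>2 = 1" "of_real c * \<phi> y + s * \<phi> p = 0" by (rule givens_zero_second)
    obtain M where M: "realizable n K M" "\<forall>\<phi>\<in>H. mat_act n M \<phi> p = of_real c * \<phi> p - cnj s * \<phi> y \<and>
        mat_act n M \<phi> y = of_real c * \<phi> y + s * \<phi> p \<and> (\<forall>z\<in>B - {p, y}. mat_act n M \<phi> z = \<phi> z)"
      using rotation[OF pP(2,3) tree_insert.hyps(4) cs(1)] by blast
    let ?\<phi> = "mat_act n M \<phi>"
    have \<phi>: "?\<phi> \<in> H" using H_realizable[OF M(1) tree_insert.prems(3)] .
    obtain A where A: "realizable n (card P * K) A" "fixes_off P A" "\<forall>z\<in>P - {r}. mat_act n A ?\<phi> z = 0"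
      using tree_insert.IH[OF pP(1) r \<phi>] by blast
    have AM: "mat_act n (A * M) \<phi> = mat_act n A ?\<phi>" using realizable_carrier[OF A(1)] realizable_carrier[OF M(1)] by (rule mat_act_mult)
    have "mat_act n A ?\<phi> y = ?\<phi> y" using fixes_off_coordinate[OF A(1,2) _ \<phi>] pP tree_insert.hyps by blast
    also have "\<dots> = 0" using M(2) tree_insert.prems cs by simp
    finally have "\<forall>z\<in>insert y P - {r}. mat_act n (A * M) \<phi> z = 0" unfolding AM using A(3) by auto
    moreover have "realizable n (card (insert y P) * K) (A * M)" unfolding card(1) by (rule realizable_mult[OF A(1) M(1)])
    moreover have "fixes_off (insert y P) (A * M)"
      using rotation_fixes_off[OF M(1) pP(2-4) M(2)] A tree_insert.hyps(3)
      by (intro fixes_off_mult[of A M P "{p, y}"] isometric_realizable[OF M(1)] isometric_realizable[OF A(1)]) auto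
    ultimately show ?thesis by blast
  qed
qed

text \<open>
  Conjugating two isolated rotations by a circuit that is cheap but not trivial on \<open>Out\<close>
  keeps the number of expensive isolated rotations per column constant.
\<close>

lemma eliminate_column:
  assumes P: "tree adj P" "insert y P \<subseteq> B" "y \<notin> P" "p \<in> P" "adj p y"
    and \<phi>: "\<phi> \<in> H" "\<And>z. z \<in> B - insert y P \<Longrightarrow> \<phi> z = 0" "inner n \<phi> \<phi> = \<kappa>"
  shows "\<exists>W. realizable n (2 * card P * K + 2 * L) W \<and> fixes_off (insert y P) W \<and> mat_act n W \<phi> = f y \<and>
    (\<forall>\<psi>\<in>Out. mat_act n W \<psi> = \<psi>)"
proof -
  have B: "P \<subseteq> B" "p \<in> B" "y \<in> B" "p \<noteq> y" using P by auto
  obtain A where A: "realizable n (card P * K) A" "fixes_off P A" "\<forall>z\<in>P - {p}. mat_act n A \<phi> z = 0"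
    using concentrate[OF P(1) B(1) P(4) \<phi>(1)] by blast
  obtain A' where A': "realizable n (card P * K) A'" "A' * A = 1\<^sub>m (2 ^ n)" using realizable_inverse[OF A(1)] .
  let ?\<phi>1 = "mat_act n A \<phi>"
  have \<phi>1: "?\<phi>1 \<in> H" using H_realizable[OF A(1) \<phi>(1)] .
  \<comment> \<open>\<open>E\<close> moves the amplitude at \<open>y\<close> to \<open>p\<close> as
    well, so that a multiple of \<open>f p\<close> is all that remains.\<close>
  obtain c s where cs: "c\<^sup>2 + (cmod s)\<^sup>2 = 1" "of_real c * ?\<phi>1 y + s * ?\<phi>1 p = 0" by (rule givens_zero_second)
  obtain E where E: "realizable n L E" "\<forall>\<phi>\<in>H. mat_act n E \<phi> p = of_real c * \<phi> p - cnj s * \<phi> y \<and>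
        mat_act n E \<phi> y = of_real c * \<phi> y + s * \<phi> p \<and> (\<forall>z\<in>B - {p, y}. mat_act n E \<phi> z = \<phi> z)"
      "\<forall>\<psi>\<in>Out. mat_act n E \<psi> = \<psi>"
    using isolated_rotation[OF B(2,3) P(5) cs(1)] by blast
  let ?\<phi>2 = "mat_act n E ?\<phi>1"
  define \<mu> where "\<mu> = ?\<phi>2 p"
  have \<phi>2: "?\<phi>2 \<in> H" using H_realizable[OF E(1) \<phi>1] .
  have "?\<phi>2 = (\<lambda>a. \<mu> * f p a)"
  proof (rule H_ext[OF \<phi>2 H_scale[OF f_in[OF B(2)]]])
    fix z assume z: "z \<in> B"
    have "?\<phi>2 z = 0" if "z \<noteq> p"
    proof (cases "z \<in> insert y P")
      case True
      then show ?thesis using E(2) \<phi>1 cs A(3) z that by (cases "z = y") auto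
    next
      case False
      then have "?\<phi>2 z = ?\<phi>1 z" using E(2) \<phi>1 z that by auto
      also have "\<dots> = \<phi> z" using fixes_off_coordinate[OF A(1,2) _ \<phi>(1)] False z by auto
      finally show ?thesis using \<phi>(2) False z by auto
    qed
    then show "?\<phi>2 z = \<mu> * f p z" using z B by (auto simp: \<mu>_def f_delta)
  qed
  then have \<phi>2_eq: "?\<phi>2 = (\<lambda>a. \<mu> * f p a)" .
  have "inner n ?\<phi>2 ?\<phi>2 = \<kappa>"
    using isometric_realizable[OF A(1)] isometric_realizable[OF E(1)] \<phi>(3) by (simp add: isometric_def)
  moreover have "inner n ?\<phi>2 ?\<phi>2 = cnj \<mu> * inner n (f p) ?\<phi>2"
    by (subst (1) \<phi>2_eq) (simp add: inner_def sum_distrib_left mult.assoc)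
  moreover have "inner n (f p) ?\<phi>2 = \<kappa> * \<mu>" using inner_f[OF B(2) \<phi>2] by (simp add: \<mu>_def)
  ultimately have \<mu>: "cnj \<mu> * \<mu> = 1" using \<kappa> by auto
  then have "(cmod \<mu>)\<^sup>2 = 1" by (metis complex_norm_square mult.commute of_real_1 of_real_eq_iff)
  \<comment> \<open>Cosine zero transfers everything from \<open>p\<close> to \<open>y\<close>. The
    scalar \<mu> left at \<open>p\<close> has modulus one by isometry, and \<open>cnj \<mu>\<close>
    in place of the sine cancels it.\<close>
  then have cs2: "0\<^sup>2 + (cmod (cnj \<mu>))\<^sup>2 = 1" by simp
  obtain D where D: "realizable n L D" "\<forall>\<phi>\<in>H. mat_act n D \<phi> p = of_real 0 * \<phi> p - cnj (cnj \<mu>) * \<phi> y \<and>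
        mat_act n D \<phi> y = of_real 0 * \<phi> y + cnj \<mu> * \<phi> p \<and> (\<forall>z\<in>B - {p, y}. mat_act n D \<phi> z = \<phi> z)"
      "\<forall>\<psi>\<in>Out. mat_act n D \<psi> = \<psi>"
    using isolated_rotation[OF B(2,3) P(5) cs2] by blast
  \<comment> \<open>As \<open>y\<close> is not in \<open>P\<close>, undoing \<open>A\<close> leaves
    the column just made intact.\<close>
  have Af: "mat_act n A (f y) = f y" using A(2) B(3) P(3) by (auto simp: fixes_off_def)
  have \<phi>3: "mat_act n D ?\<phi>2 = f y"
  proof (rule H_ext[OF H_realizable[OF D(1) \<phi>2] f_in[OF B(3)]])
    fix z assume z: "z \<in> B"
    have q: "?\<phi>2 y = 0" "?\<phi>2 p = \<mu>" "\<And>z. z \<in> B \<Longrightarrow> z \<noteq> p \<Longrightarrow> ?\<phi>2 z = 0"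
      unfolding \<phi>2_eq using B by (auto simp: f_delta)
    show "mat_act n D ?\<phi>2 z = f y z"
      using D(2) \<phi>2 q \<mu> z B by (cases "z = p"; cases "z = y") (auto simp: f_delta)
  qed
  note car = realizable_carrier[OF A(1)] realizable_carrier[OF A'(1)] realizable_carrier[OF D(1)] realizable_carrier[OF E(1)]
  have inv: "mat_act n A' (mat_act n A \<psi>) = \<psi>" if "\<psi> \<in> H \<union> Out" for \<psi>
    using mat_act_mult[OF car(2,1), of \<psi>] act_one[OF that] by (simp add: A'(2))
  define W where "W = A' * (D * (E * A))"
  have cW: "mat_act n W \<psi> = mat_act n A' (mat_act n D (mat_act n E (mat_act n A \<psi>)))" for \<psi>
  proof -
    have "E * A \<in> carrier_mat (2 ^ n) (2 ^ n)" "D * (E * A) \<in> carrier_mat (2 ^ n) (2 ^ n)"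
      using car by (auto intro: mult_carrier_mat)
    then show ?thesis using car by (simp add: W_def mat_act_mult)
  qed
  have "realizable n (card P * K + (L + (L + card P * K))) W"
    unfolding W_def by (intro realizable_mult A A' D E)
  then have "realizable n (2 * card P * K + 2 * L) W" by (rule realizable_mono) simp
  moreover have "mat_act n W \<phi> = f y" unfolding cW \<phi>3 using inv[of "f y"] f_in[OF B(3)] Af by simp
  moreover have "fixes_off (insert y P) W"
    unfolding fixes_off_def
  proof
    fix z assume z: "z \<in> B - insert y P"
    then have "mat_act n A (f z) = f z" using A(2) by (auto simp: fixes_off_def)
    moreover have "mat_act n E (f z) = f z" "mat_act n D (f z) = f z"
      using rotation_fixes_off[OF E(1) B(2-4) E(2)] rotation_fixes_off[OF D(1) B(2-4) D(2)] z P(4)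
      by (auto simp: fixes_off_def)
    ultimately show "mat_act n W (f z) = f z" using inv[of "f z"] f_in z by (simp add: cW)
  qed
  moreover have "\<forall>\<psi>\<in>Out. mat_act n W \<psi> = \<psi>"
    using E(3) D(3) Out_realizable[OF A(1)] inv by (simp add: cW)
  ultimately show ?thesis by blast
qed

text \<open>Each leaf removed has its column reduced to \<open>f y\<close>, and the trivial row that
  comes with it confines the problem to the rest of the tree. On the last vertex there is only a
  scalar \<open>l\<close> left, about which elimination says nothing; the determinant will show it
  to be one.\<close>

lemma eliminate_tree:
  "tree adj P \<Longrightarrow> P \<subseteq> B \<Longrightarrow> isometric n V \<Longrightarrow> (\<And>\<phi>. \<phi> \<in> H \<Longrightarrow> mat_act n V \<phi> \<in> H) \<Longrightarrow> fixes_off P V \<Longrightarrow>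
    \<exists>W r l. r \<in> P \<and> realizable n (card P * (2 * card P * K + 2 * L)) W \<and> fixes_off {r} (W * V) \<and>
      mat_act n (W * V) (f r) = (\<lambda>a. l * f r a) \<and> (\<forall>\<psi>\<in>Out. mat_act n W \<psi> = \<psi>)"
proof (induction arbitrary: V rule: tree.induct)
  case (tree_single x)
  have x: "x \<in> B" using tree_single by simp
  have V: "1\<^sub>m (2 ^ n) * V = V" using isometric_carrier[OF tree_single.prems(2)] by simp
  have "mat_act n V (f x) = (\<lambda>a. mat_act n V (f x) x * f x a)"
  proof (rule H_ext[OF tree_single.prems(3)[OF f_in[OF x]] H_scale[OF f_in[OF x]]])
    fix z assume z: "z \<in> B"
    have "mat_act n V (f x) z = 0" if "z \<noteq> x"
      using coordinate_fixed[OF tree_single.prems(2,3) z _ f_in[OF x]] tree_single.prems(4) z that x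
      by (auto simp: fixes_off_def f_delta)
    then show "mat_act n V (f x) z = mat_act n V (f x) x * f x z" using z x by (auto simp: f_delta)
  qed
  then show ?case
    using tree_single.prems act_one
    by (intro exI[of _ "1\<^sub>m (2 ^ n)"] exI[of _ x] exI[of _ "mat_act n V (f x) x"]) (auto simp: V realizable_one)
next
  case (tree_insert P y p)
  have B: "P \<subseteq> B" "y \<in> B" using tree_insert.prems by auto
  note iso = tree_insert.prems(2) and VH = tree_insert.prems(3)
  let ?\<phi> = "mat_act n V (f y)"
  have "?\<phi> z = 0" if "z \<in> B - insert y P" for z
    using coordinate_fixed[OF iso VH _ _ f_in[OF B(2)], of z] tree_insert.prems(4) that B
    by (auto simp: fixes_off_def f_delta)
  moreover have "inner n ?\<phi> ?\<phi> = \<kappa>"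
    using iso inner_f[OF B(2) f_in[OF B(2)]] B by (simp add: isometric_def f_delta)
  ultimately obtain W where W: "realizable n (2 * card P * K + 2 * L) W" "fixes_off (insert y P) W"
      "mat_act n W ?\<phi> = f y" "\<forall>\<psi>\<in>Out. mat_act n W \<psi> = \<psi>"
    using eliminate_column[OF tree_insert.hyps(1) tree_insert.prems(1) tree_insert.hyps(2-4) VH[OF f_in[OF B(2)]]] by blast
  have carV: "V \<in> carrier_mat (2 ^ n) (2 ^ n)" using iso by (simp add: isometric_def)
  note carW = realizable_carrier[OF W(1)]
  note WV = mat_act_mult[OF carW carV]
  have "isometric n (W * V)" using isometric_realizable[OF W(1)] iso by (rule isometric_mult)
  moreover have "mat_act n (W * V) \<phi> \<in> H" if "\<phi> \<in> H" for \<phi> using that WV VH H_realizable[OF W(1)] by simp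
  moreover have "fixes_off P (W * V)"
    unfolding fixes_off_def
  proof
    fix z assume "z \<in> B - P"
    then show "mat_act n (W * V) (f z) = f z"
      using W(2,3) tree_insert.prems(4) by (cases "z = y") (auto simp: fixes_off_def WV)
  qed
  ultimately obtain U r l where U: "r \<in> P" "realizable n (card P * (2 * card P * K + 2 * L)) U"
      "fixes_off {r} (U * (W * V))" "mat_act n (U * (W * V)) (f r) = (\<lambda>a. l * f r a)" "\<forall>\<psi>\<in>Out. mat_act n U \<psi> = \<psi>"
    using tree_insert.IH[OF B(1), of "W * V"] by blast
  note carU = realizable_carrier[OF U(2)]
  have "realizable n (card P * (2 * card P * K + 2 * L) + (2 * card P * K + 2 * L)) (U * W)"
    by (rule realizable_mult[OF U(2) W(1)])
  then have "realizable n (card (insert y P) * (2 * card (insert y P) * K + 2 * L)) (U * W)"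
    using tree_finite[OF tree_insert.hyps(1)] tree_insert.hyps(2)
    by (elim realizable_mono) (simp add: algebra_simps)
  moreover have "\<forall>\<psi>\<in>Out. mat_act n (U * W) \<psi> = \<psi>" using U(5) W(4) by (simp add: mat_act_mult[OF carU carW])
  moreover have "U * W * V = U * (W * V)" by (rule assoc_mult_mat[OF carU carW carV])
  ultimately show ?case using U(1,3,4) by (intro exI[of _ "U * W"] exI[of _ r] exI[of _ l]) auto
qed

end

section \<open>Symmetric matrices\<close>

text \<open>Energy conservation and flip symmetry in terms of matrix entries, see
  \<open>symmetric_iff\<close>.\<close>

definition symmetric :: "nat \<Rightarrow> complex mat \<Rightarrow> bool" where
  "symmetric n M \<longleftrightarrow> M \<in> carrier_mat (2 ^ n) (2 ^ n) \<and>
     (\<forall>a<2 ^ n. \<forall>b<2 ^ n. hamming_weight n a \<noteq> hamming_weight n b \<longrightarrow> M $$ (a, b) = 0) \<and>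
     (\<forall>a<2 ^ n. \<forall>b<2 ^ n. M $$ (flip_all n a, flip_all n b) = M $$ (a, b))"

lemma on_qubits_single_Z:
  assumes "j < n" "a < 2 ^ n" "b < 2 ^ n"
  shows "on_qubits n {j} pauli_Z $$ (a, b) = of_bool (a = b) * (1 - 2 * of_bool (bit a j))"
proof -
  let ?F = "\<lambda>k. (if k \<in> {j} then pauli_Z else 1\<^sub>m 2) $$ (of_bool (bit a k), of_bool (bit b k))"
  have e: "on_qubits n {j} pauli_Z $$ (a, b) = prod ?F {..<n}"
    using assms by (simp add: on_qubits_def qubit_tensor_def)
  show ?thesis
  proof (cases "a = b")
    case True
    have "prod ?F {..<n} = ?F j * prod ?F ({..<n} - {j})" using assms by (intro prod.remove) auto
    also have "prod ?F ({..<n} - {j}) = 1" using True by (intro prod.neutral) (auto simp: one_mat_of_bool)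
    finally have "prod ?F {..<n} = 1 - 2 * of_bool (bit a j)" using True by (simp add: pauli_Z_of_bool)
    then show ?thesis unfolding e using True by simp
  next
    case False
    then obtain k where "k < n" "bit a k \<noteq> bit b k" using eq_if_low_bits assms by blast
    then have "prod ?F {..<n} = 0"
      by (intro prod_zero) (auto intro!: bexI[of _ k] simp: one_mat_of_bool pauli_Z_of_bool)
    then show ?thesis using False e by simp
  qed
qed

lemma total_Z_index:
  assumes "a < 2 ^ n" "b < 2 ^ n"
  shows "total_Z n $$ (a, b) = of_bool (a = b) * (of_nat n - 2 * of_nat (hamming_weight n a))"
proof -
  have "{..<n} \<inter> {j. bit a j} = {j. j < n \<and> bit a j}" by auto
  then have "(\<Sum>j<n. 1 - 2 * of_bool (bit a j)) = of_nat n - (2 * of_nat (hamming_weight n a) :: complex)"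
    by (simp add: sum_subtractf sum_distrib_left[symmetric] sum_of_bool_eq hamming_weight_def)
  then show ?thesis
    using assms by (simp add: total_Z_def on_qubits_single_Z sum_distrib_left[symmetric])
qed

lemma all_X_index:
  assumes "a < 2 ^ n" "b < 2 ^ n"
  shows "all_X n $$ (a, b) = of_bool (a = flip_all n b)"
proof -
  have "all_X n $$ (a, b) = (\<Prod>j<n. of_bool (bit a j \<noteq> bit b j))"
    using assms by (simp add: all_X_def qubit_tensor_def pauli_X_of_bool)
  also have "\<dots> = of_bool (\<forall>j\<in>{..<n}. bit a j \<noteq> bit b j)" by (rule prod_of_bool) simp
  also have "(\<forall>j\<in>{..<n}. bit a j \<noteq> bit b j) \<longleftrightarrow> a = flip_all n b"
    using assms eq_if_low_bits[of a n "flip_all n b"] by (auto simp: bit_flip_all)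
  finally show ?thesis .
qed

lemma total_Z_carrier: "total_Z n \<in> carrier_mat (2 ^ n) (2 ^ n)"
  by (simp add: total_Z_def)

lemma all_X_carrier: "all_X n \<in> carrier_mat (2 ^ n) (2 ^ n)"
  by (simp add: all_X_def qubit_tensor_def)

lemma energy_conserving_iff:
  assumes V: "V \<in> carrier_mat (2 ^ n) (2 ^ n)"
  shows "energy_conserving n V \<longleftrightarrow>
    (\<forall>a<2 ^ n. \<forall>b<2 ^ n. hamming_weight n a \<noteq> hamming_weight n b \<longrightarrow> V $$ (a, b) = 0)"
proof -
  let ?h = "\<lambda>a. of_nat n - 2 * of_nat (hamming_weight n a) :: complex"
  have e: "(V * total_Z n - total_Z n * V) $$ (a, b) = V $$ (a, b) * (?h b - ?h a)" if ab: "a < 2 ^ n" "b < 2 ^ n" for a b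
  proof -
    have "(V * total_Z n) $$ (a, b) = V $$ (a, b) * ?h b"
      using ab by (subst mat_mult_index[OF V total_Z_carrier ab])
        (simp add: total_Z_index of_bool_def if_distrib[of "\<lambda>x. x * _"] if_distrib[of "(*) _"] cong: if_cong)
    moreover have "(total_Z n * V) $$ (a, b) = ?h a * V $$ (a, b)"
      using ab by (subst mat_mult_index[OF total_Z_carrier V ab])
        (simp add: total_Z_index of_bool_def if_distrib[of "\<lambda>x. x * _"] if_distrib[of "(*) _"] cong: if_cong)
    ultimately show ?thesis using ab V total_Z_carrier[of n] by (simp add: algebra_simps)
  qed
  have h: "?h b - ?h a = 0 \<longleftrightarrow> hamming_weight n a = hamming_weight n b" for a b by auto
  have "energy_conserving n V \<longleftrightarrow> (\<forall>a<2 ^ n. \<forall>b<2 ^ n. V $$ (a, b) * (?h b - ?h a) = 0)"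
  proof
    assume "energy_conserving n V"
    then show "\<forall>a<2 ^ n. \<forall>b<2 ^ n. V $$ (a, b) * (?h b - ?h a) = 0"
      using e by (metis energy_conserving_def index_zero_mat(1))
  next
    assume "\<forall>a<2 ^ n. \<forall>b<2 ^ n. V $$ (a, b) * (?h b - ?h a) = 0"
    then show "energy_conserving n V"
      unfolding energy_conserving_def using e V total_Z_carrier[of n] by (intro eq_matI) auto
  qed
  then show ?thesis using h by (auto simp del: right_minus_eq)
qed

lemma all_X_conj_iff:
  assumes V: "V \<in> carrier_mat (2 ^ n) (2 ^ n)"
  shows "all_X n * V * all_X n = V \<longleftrightarrow> (\<forall>a<2 ^ n. \<forall>b<2 ^ n. V $$ (flip_all n a, flip_all n b) = V $$ (a, b))"
proof -
  have XV: "all_X n * V \<in> carrier_mat (2 ^ n) (2 ^ n)" using all_X_carrier V by (rule mult_carrier_mat)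
  have e: "(all_X n * V * all_X n) $$ (a, b) = V $$ (flip_all n a, flip_all n b)" if ab: "a < 2 ^ n" "b < 2 ^ n" for a b
  proof -
    have 1: "(all_X n * V) $$ (a, c) = V $$ (flip_all n a, c)" if "c < 2 ^ n" for c
      using ab that flip_all_eq_iff[of n]
      by (subst mat_mult_index[OF all_X_carrier V ab(1) that])
        (simp add: all_X_index of_bool_def if_distrib[of "\<lambda>x. x * _"] eq_commute[of a] cong: if_cong)
    have "(all_X n * V * all_X n) $$ (a, b) = (\<Sum>c<2 ^ n. (all_X n * V) $$ (a, c) * all_X n $$ (c, b))"
      by (rule mat_mult_index[OF XV all_X_carrier ab])
    also have "\<dots> = (\<Sum>c<2 ^ n. if c = flip_all n b then (all_X n * V) $$ (a, flip_all n b) else 0)"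
      using ab by (intro sum.cong refl) (auto simp: all_X_index)
    finally show ?thesis using ab 1 by simp
  qed
  show ?thesis
  proof
    assume "all_X n * V * all_X n = V"
    then show "\<forall>a<2 ^ n. \<forall>b<2 ^ n. V $$ (flip_all n a, flip_all n b) = V $$ (a, b)" using e by metis
  next
    assume "\<forall>a<2 ^ n. \<forall>b<2 ^ n. V $$ (flip_all n a, flip_all n b) = V $$ (a, b)"
    then show "all_X n * V * all_X n = V" using e V XV all_X_carrier[of n] by (intro eq_matI) auto
  qed
qed

lemma symmetric_iff:
  "V \<in> carrier_mat (2 ^ n) (2 ^ n) \<Longrightarrow> symmetric n V \<longleftrightarrow> energy_conserving n V \<and> all_X n * V * all_X n = V"
  by (simp add: symmetric_def energy_conserving_iff all_X_conj_iff)

lemma symmetric_one: "symmetric n (1\<^sub>m (2 ^ n))"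
  by (auto simp: symmetric_def)

lemma symmetric_mult:
  assumes A: "symmetric n A" and B: "symmetric n B"
  shows "symmetric n (A * B)"
proof -
  have c: "A \<in> carrier_mat (2 ^ n) (2 ^ n)" "B \<in> carrier_mat (2 ^ n) (2 ^ n)"
    using A B by (auto simp: symmetric_def)
  have "(A * B) $$ (a, b) = 0" if "a < 2 ^ n" "b < 2 ^ n" "hamming_weight n a \<noteq> hamming_weight n b" for a b
  proof -
    have "A $$ (a, c) * B $$ (c, b) = 0" if "c < 2 ^ n" for c
      using that \<open>a < 2 ^ n\<close> \<open>b < 2 ^ n\<close> \<open>hamming_weight n a \<noteq> _\<close> A B
      by (cases "hamming_weight n a = hamming_weight n c") (auto simp: symmetric_def)
    then have "(\<Sum>c<2 ^ n. A $$ (a, c) * B $$ (c, b)) = 0" by (intro sum.neutral) auto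
    then show ?thesis using that by (subst mat_mult_index[OF c]) auto
  qed
  moreover have "(A * B) $$ (flip_all n a, flip_all n b) = (A * B) $$ (a, b)" if ab: "a < 2 ^ n" "b < 2 ^ n" for a b
  proof -
    have "(A * B) $$ (flip_all n a, flip_all n b) = (\<Sum>d<2 ^ n. A $$ (flip_all n a, d) * B $$ (d, flip_all n b))"
      using ab by (intro mat_mult_index[OF c]) auto
    also have "\<dots> = (\<Sum>d<2 ^ n. A $$ (flip_all n a, flip_all n d) * B $$ (flip_all n d, flip_all n b))"
      by (rule sum.reindex_bij_betw[OF bij_flip_all, symmetric])
    also have "\<dots> = (\<Sum>d<2 ^ n. A $$ (a, d) * B $$ (d, b))"
      using A B ab by (intro sum.cong refl) (auto simp: symmetric_def)
    also have "\<dots> = (A * B) $$ (a, b)" by (rule mat_mult_index[OF c ab, symmetric])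
    finally show ?thesis .
  qed
  ultimately show ?thesis using c by (auto simp: symmetric_def)
qed

lemma symmetric_xy_gate:
  assumes ij: "i \<noteq> j" "i < n" "j < n"
  shows "symmetric n (xy_gate n (\<theta>, i, j))"
proof -
  have "flip_all n a = flip2 i j (flip_all n b) \<longleftrightarrow> a = flip2 i j b" for a b
    using flip_all_flip2[OF ij(1), of n b] by (metis flip_all_flip_all)
  then show ?thesis
    unfolding symmetric_def using xy_gate_carrier[of n \<theta> i j] ij
    by (auto simp: xy_gate_index bit_flip_all hamming_weight_flip2)
qed

lemma symmetric_realizable:
  assumes "realizable n k M"
  shows "symmetric n M"
proof -
  have "symmetric n (circuit_unitary n gs)" if "xy_circuit n gs" for gs
    using that
  proof (induction gs)
    case (Cons g gs)
    obtain \<theta> i j where g: "g = (\<theta>, i, j)" by (cases g)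
    have "i \<noteq> j" "i < n" "j < n" and gs: "xy_circuit n gs" using Cons.prems by (auto simp: xy_circuit_def g)
    then have "symmetric n (xy_gate n g * circuit_unitary n gs)"
      unfolding g by (intro symmetric_mult symmetric_xy_gate Cons.IH) 
    then show ?case by (simp add: circuit_unitary_def)
  qed (simp add: circuit_unitary_def symmetric_one)
  then show ?thesis using assms by (auto simp: realizable_def)
qed

lemma symmetric_act_weight:
  assumes M: "symmetric n M" and \<psi>: "\<And>b. b < 2 ^ n \<Longrightarrow> hamming_weight n b = hamming_weight n a \<Longrightarrow> \<psi> b = 0"
  shows "mat_act n M \<psi> a = 0"
proof (cases "a < 2 ^ n")
  case True
  then have "M $$ (a, b) * \<psi> b = 0" if "b < 2 ^ n" for b
    using that M \<psi>[of b] by (cases "hamming_weight n b = hamming_weight n a") (auto simp: symmetric_def)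
  then have "(\<Sum>b<2 ^ n. M $$ (a, b) * \<psi> b) = 0" by (intro sum.neutral) auto
  then show ?thesis by (simp add: mat_act_def)
qed simp

lemma symmetric_act_flip_all:
  assumes M: "symmetric n M" and a: "a < 2 ^ n"
  shows "mat_act n M \<psi> (flip_all n a) = mat_act n M (\<lambda>b. \<psi> (flip_all n b)) a"
proof -
  have "mat_act n M \<psi> (flip_all n a) = (\<Sum>b<2 ^ n. M $$ (flip_all n a, b) * \<psi> b)" using a by (simp add: mat_act_def)
  also have "\<dots> = (\<Sum>b<2 ^ n. M $$ (flip_all n a, flip_all n b) * \<psi> (flip_all n b))"
    by (rule sum.reindex_bij_betw[OF bij_flip_all, symmetric])
  also have "\<dots> = mat_act n M (\<lambda>b. \<psi> (flip_all n b)) a"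
    unfolding mat_act_def using M a by (auto simp: symmetric_def intro!: sum.cong)
  finally show ?thesis .
qed

text \<open>Parity is assumed only within the weight class of \<open>a\<close>, since no other
  amplitudes enter; \<open>off_parity_space\<close> needs this, as its vectors are arbitrary at
  other weights.\<close>

lemma symmetric_act_parity:
  assumes M: "symmetric n M" and a: "a < 2 ^ n"
    and \<psi>: "\<And>b. b < 2 ^ n \<Longrightarrow> hamming_weight n b = hamming_weight n a \<Longrightarrow> \<psi> (flip_all n b) = \<epsilon> * \<psi> b"
  shows "mat_act n M \<psi> (flip_all n a) = \<epsilon> * mat_act n M \<psi> a"
proof -
  have "mat_act n M (\<lambda>b. \<psi> (flip_all n b)) a = mat_act n M (\<lambda>b. \<epsilon> * \<psi> b) a"
    unfolding mat_act_def using a M \<psi> 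
    by (auto intro!: sum.cong) (metis (no_types, lifting) mult_eq_0_iff symmetric_def)
  then show ?thesis using symmetric_act_flip_all[OF M a] by (simp add: mat_act_scale)
qed

section \<open>Spanning trees of weight classes\<close>

definition weight_class :: "nat \<Rightarrow> nat \<Rightarrow> nat set" where
  "weight_class n m = {b. b < 2 ^ n \<and> hamming_weight n b = m}"

definition adjacent :: "nat \<Rightarrow> nat \<Rightarrow> nat \<Rightarrow> bool" where
  "adjacent n x y \<longleftrightarrow> (\<exists>i j. i < n \<and> j < n \<and> i \<noteq> j \<and> bit x i \<noteq> bit x j \<and> y = flip2 i j x)"

text \<open>A largest tree without complementary pairs has the required property: a string
  \<open>z\<close> missed together with its complement has a neighbour nearer to a vertex
  \<open>x\<close>, by induction this neighbour or its complement is in the tree, and then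
  \<open>z\<close> or its complement could be attached. Away from the middle, complements have
  another weight, and the tree is the whole class.\<close>

lemma exists_spanning_tree:
  assumes n: "0 < n" and m: "m \<le> n"
  obtains P where "tree (adjacent n) P" "P \<subseteq> weight_class n m" "\<And>x. x \<in> P \<Longrightarrow> flip_all n x \<notin> P"
    "\<And>z. z \<in> weight_class n m \<Longrightarrow> z \<in> P \<or> flip_all n z \<in> P"
proof -
  define T where "T = {P. tree (adjacent n) P \<and> P \<subseteq> weight_class n m \<and> (\<forall>x\<in>P. flip_all n x \<notin> P)}"
  have fin: "finite (weight_class n m)" by (simp add: weight_class_def)
  then have "finite T" by (intro finite_subset[of T "Pow (weight_class n m)"]) (auto simp: T_def)
  have "mask m \<in> weight_class n m"
  proof -
    have "{j. j < n \<and> bit (mask m :: nat) j} = {..<m}" using m by (auto simp: bit_mask_iff)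
    then have "hamming_weight n (mask m) = m" by (simp add: hamming_weight_def)
    then show ?thesis using m by (auto simp: weight_class_def less_two_power_iff bit_mask_iff)
  qed
  then have "{mask m} \<in> T" using flip_all_neq[OF n] by (auto simp: T_def intro: tree_single)
  then have "Max (card ` T) \<in> card ` T" using \<open>finite T\<close> by (intro Max_in) auto
  then obtain P where P: "P \<in> T" and "Max (card ` T) = card P" by auto
  then have max: "card Q \<le> card P" if "Q \<in> T" for Q
    using Max_ge[of "card ` T" "card Q"] that \<open>finite T\<close> by simp
  have "tree (adjacent n) P" and PW: "P \<subseteq> weight_class n m" and Pc: "\<forall>x\<in>P. flip_all n x \<notin> P"
    using P by (auto simp: T_def)
  have extend: False if "p \<in> P" "adjacent n p y" "y \<in> weight_class n m" "y \<notin> P" "flip_all n y \<notin> P" for p y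
  proof -
    have "tree (adjacent n) (insert y P)" using \<open>tree (adjacent n) P\<close> that by (intro tree_insert) auto
    moreover have "\<forall>x\<in>insert y P. flip_all n x \<notin> insert y P"
      using Pc that flip_all_neq[OF n] by (auto simp: flip_all_eq_iff)
    ultimately have "insert y P \<in> T" using PW that by (simp add: T_def)
    then show False using max[of "insert y P"] that finite_subset[OF PW fin] by simp
  qed
  obtain x where x: "x \<in> P" using tree_finite[OF \<open>tree (adjacent n) P\<close>] by blast
  have cover: "z \<in> P \<or> flip_all n z \<in> P" if "z \<in> weight_class n m" for z
    using that
  proof (induction "distance n x z" arbitrary: z rule: less_induct)
    case less
    show ?case
    proof (rule ccontr)
      assume nz: "\<not> (z \<in> P \<or> flip_all n z \<in> P)"
      have xz: "x < 2 ^ n" "z < 2 ^ n" "hamming_weight n x = hamming_weight n z" "x \<noteq> z"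
        using x PW less.prems nz by (auto simp: weight_class_def)
      obtain i j where ij: "i < n" "j < n" "i \<noteq> j" "bit z i" "\<not> bit x i" "bit x j" "\<not> bit z j"
        using distance_step[OF xz(1,2,4,3)] by metis
      let ?y = "flip2 i j z"
      have "distance n x ?y + 2 = distance n x z" using ij by (intro distance_flip2) auto
      moreover have y: "?y \<in> weight_class n m"
        using less.prems ij by (auto simp: weight_class_def hamming_weight_flip2)
      ultimately have "?y \<in> P \<or> flip_all n ?y \<in> P" using less.hyps by auto
      then show False
      proof
        assume "?y \<in> P"
        moreover have "adjacent n ?y z"
          unfolding adjacent_def using ij by (intro exI[of _ i] exI[of _ j]) (auto simp: bit_flip2)
        ultimately show False using extend less.prems nz by blast
      next
        assume c: "flip_all n ?y \<in> P"
        \<comment> \<open>Complementing both ends of an edge gives an edge, so the complement of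
          \<open>z\<close> can be attached instead.\<close>
        have "adjacent n (flip_all n ?y) (flip_all n z)"
          unfolding adjacent_def using ij
          by (intro exI[of _ i] exI[of _ j]) (auto simp: bit_flip2 bit_flip_all flip_all_flip2)
        moreover have "flip_all n z \<in> weight_class n m"
          using c PW y less.prems hamming_weight_flip_all[of n ?y] hamming_weight_flip_all[of n z]
          by (auto simp: weight_class_def)
        ultimately show False using extend[OF c, of "flip_all n z"] nz by simp
      qed
    qed
  qed
  show thesis using that[of P] \<open>tree (adjacent n) P\<close> PW Pc cover by blast
qed

section \<open>Determinants on invariant subspaces\<close>

text \<open>The basis vectors are dual to evaluation at the points of \<open>B\<close>, so
  coefficients are read off as values. This covers the unit vectors of a weight space as well as the
  parity vectors of an eigenspace.\<close>

locale coordinates =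
  fixes n :: nat and B :: "nat set" and f :: "nat \<Rightarrow> nat \<Rightarrow> complex" and W :: "complex vec set"
  assumes B: "B \<subseteq> {..<2 ^ n}" and f_delta: "x \<in> B \<Longrightarrow> y \<in> B \<Longrightarrow> f x y = of_bool (y = x)"
    and W: "W = {vec (2 ^ n) (\<lambda>a. \<Sum>x\<in>B. c x * f x a) | c. True}"
begin

lemma finite_B: "finite B"
  using B finite_subset by blast

definition xs where "xs = sorted_list_of_set B"

definition bs where "bs = map (\<lambda>x. vec (2 ^ n) (f x)) xs"

lemma xs: "distinct xs" "set xs = B"
  using finite_B by (auto simp: xs_def)

lemma length_bs [simp]: "length bs = length xs"
  by (simp add: bs_def)

lemma sum_xs: "(\<Sum>i<length xs. g (xs ! i)) = (\<Sum>x\<in>B. g x)"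
  using sum.reindex_bij_betw[OF bij_betw_nth[OF xs(1) refl refl], of g] by (simp add: xs(2))

lemma inj_vec: "inj_on (\<lambda>x. vec (2 ^ n) (f x)) B"
proof (rule inj_onI)
  fix x y assume xy: "x \<in> B" "y \<in> B" and e: "vec (2 ^ n) (f x) = vec (2 ^ n) (f y)"
  have "f x x = vec (2 ^ n) (f x) $ x" using xy B by auto
  also have "\<dots> = f y x" unfolding e using xy B by auto
  finally show "x = y" using xy by (simp add: f_delta)
qed

lemma subspace_basis_bs: "subspace_basis (2 ^ n) bs W"
proof -
  interpret vec_space "TYPE(complex)" "2 ^ n" .
  let ?F = "\<lambda>x. vec (2 ^ n) (f x)"
  have set: "set bs = ?F ` B" by (simp add: bs_def xs)
  have car: "?F ` B \<subseteq> carrier_vec (2 ^ n)" by auto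
  have lc: "lincomb g (?F ` B) $ a = (\<Sum>x\<in>B. g (?F x) * f x a)" if "a < 2 ^ n" for g a
    using that by (subst lincomb_index[OF that car]) (simp add: sum.reindex[OF inj_vec])
  have lcd: "lincomb g (?F ` B) \<in> carrier_vec (2 ^ n)" for g using car by (rule lincomb_closed)
  have "lin_indpt (?F ` B)"
  proof (rule finite_lin_indpt2)
    fix g assume z: "lincomb g (?F ` B) = 0\<^sub>v (2 ^ n)"
    show "\<forall>v\<in>?F ` B. g v = 0"
    proof
      fix v assume "v \<in> ?F ` B"
      then obtain y where y: "y \<in> B" "v = ?F y" by blast
      have "(\<Sum>x\<in>B. g (?F x) * f x y) = (\<Sum>x\<in>B. if x = y then g (?F y) else 0)"
        using y by (intro sum.cong refl) (auto simp: f_delta)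
      then show "g v = 0" using lc[of y g] z y B finite_B by auto
    qed
  qed (use finite_B car in auto)
  moreover have "span (?F ` B) = W"
  proof -
    have e1: "lincomb g (?F ` B) = vec (2 ^ n) (\<lambda>a. \<Sum>x\<in>B. g (?F x) * f x a)" for g
      using lcd[of g] lc[of _ g] by (intro eq_vecI) auto
    have e2: "vec (2 ^ n) (\<lambda>a. \<Sum>x\<in>B. c x * f x a) =
        lincomb (\<lambda>v. c (the_inv_into B ?F v)) (?F ` B)" for c
      using lc carrier_vecD[OF lcd] by (intro eq_vecI) (auto simp: the_inv_into_f_f[OF inj_vec] intro!: sum.cong)
    have "{lincomb g (?F ` B) |g. True} = W"
      unfolding W
    proof (intro equalityI subsetI; elim CollectE exE conjE)
      fix v g assume "v = lincomb g (?F ` B)"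
      then show "v \<in> {vec (2 ^ n) (\<lambda>a. \<Sum>x\<in>B. c x * f x a) |c. True}"
        unfolding e1[of g] by (intro CollectI exI[of _ "\<lambda>x. g (?F x)"]) simp
    next
      fix v c assume "v = vec (2 ^ n) (\<lambda>a. \<Sum>x\<in>B. c x * f x a)"
      then show "v \<in> {lincomb g (?F ` B) |g. True}" using e2[of c] by blast
    qed
    then show ?thesis using finite_span[of "?F ` B"] finite_B car by (auto simp: class_ring_simps)
  qed
  moreover have "distinct bs" using inj_vec xs by (simp add: bs_def distinct_map)
  ultimately show ?thesis using car by (simp add: subspace_basis_def vec_span_def set)
qed

definition preserves :: "complex mat \<Rightarrow> bool" where
  "preserves M \<longleftrightarrow> M \<in> carrier_mat (2 ^ n) (2 ^ n) \<and>
     (\<forall>x\<in>B. \<forall>a<2 ^ n. mat_act n M (f x) a = (\<Sum>y\<in>B. mat_act n M (f x) y * f y a))"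

definition restricted :: "complex mat \<Rightarrow> complex mat" where
  "restricted M = mat (length xs) (length xs) (\<lambda>(i, j). mat_act n M (f (xs ! j)) (xs ! i))"

lemma restriction_matrix_restricted:
  assumes M: "preserves M"
  shows "restriction_matrix (2 ^ n) M W bs (restricted M)"
proof -
  let ?C = "mat_of_cols (2 ^ n) bs"
  have car: "M \<in> carrier_mat (2 ^ n) (2 ^ n)" using M by (simp add: preserves_def)
  have C: "?C $$ (a, j) = f (xs ! j) a" if "a < 2 ^ n" "j < length xs" for a j
    using that by (simp add: mat_of_cols_index bs_def)
  have "M * ?C = ?C * restricted M"
  proof (rule eq_matI)
    fix a j assume "a < dim_row (?C * restricted M)" "j < dim_col (?C * restricted M)"
    then have aj: "a < 2 ^ n" "j < length xs" by (auto simp: restricted_def)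
    then have xj: "xs ! j \<in> B" using xs nth_mem by metis
    have "(M * ?C) $$ (a, j) = mat_act n M (f (xs ! j)) a"
      using aj car by (simp add: scalar_prod_def mat_act_def C lessThan_atLeast0)
    also have "\<dots> = (\<Sum>y\<in>B. mat_act n M (f (xs ! j)) y * f y a)" using M xj aj by (auto simp: preserves_def)
    also have "\<dots> = (\<Sum>i<length xs. mat_act n M (f (xs ! j)) (xs ! i) * f (xs ! i) a)" by (rule sum_xs[symmetric])
    also have "\<dots> = (?C * restricted M) $$ (a, j)"
      using aj by (simp add: scalar_prod_def restricted_def C lessThan_atLeast0 mult.commute)
    finally show "(M * ?C) $$ (a, j) = (?C * restricted M) $$ (a, j)" .
  qed (use car in \<open>auto simp: restricted_def\<close>)
  then show ?thesis
    by (simp add: restriction_matrix_def subspace_basis_bs restricted_def)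
qed

lemma det_on_restricted: "preserves M \<Longrightarrow> det_on (2 ^ n) M W = det (restricted M)"
  by (rule det_on_eq[OF _ restriction_matrix_restricted]) (simp add: preserves_def)

lemma det_on_mult:
  assumes M: "preserves M" and L: "preserves L"
  shows "det_on (2 ^ n) (M * L) W = det_on (2 ^ n) M W * det_on (2 ^ n) L W"
proof -
  let ?C = "mat_of_cols (2 ^ n) bs" and ?k = "length bs"
  have cM: "M \<in> carrier_mat (2 ^ n) (2 ^ n)" and cL: "L \<in> carrier_mat (2 ^ n) (2 ^ n)"
    using M L by (auto simp: preserves_def)
  have rM: "restricted M \<in> carrier_mat ?k ?k" and rL: "restricted L \<in> carrier_mat ?k ?k"
    by (auto simp: restricted_def)
  have C: "?C \<in> carrier_mat (2 ^ n) ?k" by (rule mat_of_cols_carrier(1))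
  have eM: "M * ?C = ?C * restricted M" and eL: "L * ?C = ?C * restricted L"
    using restriction_matrix_restricted M L by (auto simp: restriction_matrix_def)
  have "M * L * ?C = M * (L * ?C)" by (rule assoc_mult_mat[OF cM cL C])
  also have "\<dots> = M * ?C * restricted L" unfolding eL by (rule assoc_mult_mat[OF cM C rL, symmetric])
  also have "\<dots> = ?C * (restricted M * restricted L)" unfolding eM by (rule assoc_mult_mat[OF C rM rL])
  finally have "restriction_matrix (2 ^ n) (M * L) W bs (restricted M * restricted L)"
    using mult_carrier_mat[OF rM rL] by (simp add: restriction_matrix_def subspace_basis_bs)
  then have "det_on (2 ^ n) (M * L) W = det (restricted M * restricted L)"
    by (rule det_on_eq[OF mult_carrier_mat[OF cM cL]])
  then show ?thesis using M L by (simp add: det_on_restricted det_mult[OF rM rL])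
qed

text \<open>The shape that elimination leaves behind: the restricted matrix is diagonal, with
  \<open>l\<close> at one place and ones elsewhere.\<close>

lemma det_on_diagonal:
  assumes r: "r \<in> B" and M: "M \<in> carrier_mat (2 ^ n) (2 ^ n)"
    and others: "\<And>x a. x \<in> B \<Longrightarrow> x \<noteq> r \<Longrightarrow> a < 2 ^ n \<Longrightarrow> mat_act n M (f x) a = f x a"
    and root: "\<And>a. a < 2 ^ n \<Longrightarrow> mat_act n M (f r) a = l * f r a"
  shows "det_on (2 ^ n) M W = l"
proof -
  let ?d = "\<lambda>x. if x = r then l else 1"
  have act: "mat_act n M (f x) a = ?d x * f x a" if "x \<in> B" "a < 2 ^ n" for x a
    using others root that by (cases "x = r") auto
  have lt: "x < 2 ^ n" if "x \<in> B" for x using that B by auto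
  have "preserves M"
    unfolding preserves_def
  proof (intro conjI ballI allI impI M)
    fix x a assume x: "x \<in> B" and a: "a < (2::nat) ^ n"
    have "(\<Sum>y\<in>B. mat_act n M (f x) y * f y a) = (\<Sum>y\<in>B. if y = x then ?d x * f x a else 0)"
      using x by (intro sum.cong refl) (auto simp: act lt f_delta)
    then show "mat_act n M (f x) a = (\<Sum>y\<in>B. mat_act n M (f x) y * f y a)"
      using x a finite_B by (simp add: act)
  qed
  then have "det_on (2 ^ n) M W = det (restricted M)" by (rule det_on_restricted)
  also have "restricted M $$ (i, j) = (if i = j then ?d (xs ! i) else 0)" if "i < length xs" "j < length xs" for i j
  proof -
    have "xs ! i \<in> B" "xs ! j \<in> B" using that xs nth_mem by metis+
    then show ?thesis
      using that xs(1) by (simp add: restricted_def act lt f_delta nth_eq_iff_index_eq)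
  qed
  then have "upper_triangular (restricted M)" "diag_mat (restricted M) = map (\<lambda>x. ?d x) xs"
    by (auto simp: upper_triangular_def restricted_def diag_mat_def intro!: nth_equalityI)
  then have "det (restricted M) = prod_list (map (\<lambda>x. ?d x) xs)"
    using det_upper_triangular[of "restricted M" "length xs"] by (simp add: restricted_def)
  also have "\<dots> = (\<Prod>x\<in>B. ?d x)" using prod.distinct_set_conv_list[OF xs(1), of ?d] by (simp add: xs(2))
  also have "\<dots> = l" using r finite_B by (simp add: prod.delta)
  finally show ?thesis .
qed

lemma det_on_one:
  assumes "B \<noteq> {}"
  shows "det_on (2 ^ n) (1\<^sub>m (2 ^ n)) W = 1"
proof -
  obtain r where "r \<in> B" using assms by blast
  then show ?thesis by (rule det_on_diagonal) (auto simp: mat_act_one)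
qed

text \<open>The determinant is multiplicative on the four factors of a commutator and blind to their
  order. Each factor must leave the subspace invariant, which \<open>pres\<close> provides for
  circuits; the diagonal factor is a circuit thanks to a third qubit.\<close>

lemma det_on_realizable:
  assumes n: "3 \<le> n" and B_ne: "B \<noteq> {}"
    and pres: "\<And>k M. realizable n k M \<Longrightarrow> preserves M"
    and M: "realizable n k M"
  shows "det_on (2 ^ n) M W = 1"
proof -
  let ?d = "\<lambda>M. det_on (2 ^ n) M W"
  have gate: "?d (xy_gate n (\<theta>, i, j)) = 1 \<and> preserves (xy_gate n (\<theta>, i, j))"
    if ij: "i \<noteq> j" "i < n" "j < n" for \<theta> i j
  proof -
    obtain l where l: "l < n" "l \<noteq> i" "l \<noteq> j" using exists_third[OF n] by blast
    \<comment> \<open>Any string with different bits at \<open>i\<close> and \<open>j\<close> will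
      do.\<close>
    define x :: nat where "x = 2 ^ i"
    have x: "bit x i \<noteq> bit x j" using ij by (simp add: x_def bit_exp_iff)
    let ?T = "{i, j, l}"
    have synP: "realizable_op n 5 (phase x i j ?T \<alpha>)" for \<alpha>
      by (rule realizable_op_phase3[OF ij(1) l(2,3) ij(2,3) l(1) x])
    obtain A where A: "realizable n 1 A" "acts n A (rot i j (\<theta> / 2))" using realizable_op_rot[OF ij] by (auto simp: realizable_op_def)
    obtain A' where A': "realizable n 1 A'" "acts n A' (rot i j (- (\<theta> / 2)))" using realizable_op_rot[OF ij] by (auto simp: realizable_op_def)
    obtain F where F: "realizable n 5 F" "acts n F (phase x i j ?T (pi / 2))" using synP by (auto simp: realizable_op_def)
    obtain F' where F': "realizable n 5 F'" "acts n F' (phase x i j ?T (- (pi / 2)))" using synP by (auto simp: realizable_op_def)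
    have ag: "bit a i \<noteq> bit a j \<longleftrightarrow> agree x ?T a \<or> agree x ?T (flip2 i j a)" for a
      using ij(1) l x by (auto simp: agree3 bit_flip2)
    have ex: "\<not> (agree x ?T a \<and> agree x ?T (flip2 i j a))" for a
      using agree_not_flip2[OF ij(1) l(2,3), of ?T ?T] by auto
    have ci: "cis (pi / 2) = \<i>" "cis (- (pi / 2)) = - \<i>" by (simp_all add: complex_eq_iff)
    have AA: "A' * A = 1\<^sub>m (2 ^ n)"
      using acts_cong[OF acts_mult[OF A'(2) A(2)], of "\<lambda>\<psi>. \<psi>"] rot_inverse[OF ij(1)] acts_unique acts_one by blast
    have "phase x i j ?T (- (pi / 2)) (phase x i j ?T (pi / 2) \<psi>) a = \<psi> a" for \<psi> a
      using ex[of a] by (auto simp: phase_def ci)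
    then have FF: "F' * F = 1\<^sub>m (2 ^ n)"
      using acts_cong[OF acts_mult[OF F'(2) F(2)], of "\<lambda>\<psi>. \<psi>"] acts_unique acts_one by blast
    \<comment> \<open>A string and its partner have the phases \<i> and - \<i>; their quotient - 1
      multiplies the off-diagonal entries and so reverses the angle.\<close>
    have conj: "phase x i j ?T (pi / 2) (rot i j (- (\<theta> / 2)) (phase x i j ?T (- (pi / 2)) \<psi>)) a = rot i j (\<theta> / 2) \<psi> a" for \<psi> a
      using ex[of a] ag[of a] ij(1)
      by (cases "agree x ?T a"; cases "agree x ?T (flip2 i j a)")
        (simp_all add: phase_def rot_def ci algebra_simps)
    have dbl: "rot i j (\<theta> / 2) (rot i j (\<theta> / 2) \<psi>) a = rot i j \<theta> \<psi> a" for \<psi> a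
    proof -
      define C S where "C = complex_of_real (cos (\<theta> / 2))" "S = complex_of_real (sin (\<theta> / 2))"
      have cs: "complex_of_real (cos \<theta>) = C * C - S * S" "complex_of_real (sin \<theta>) = 2 * S * C"
        using cos_double[of "\<theta> / 2"] sin_double[of "\<theta> / 2"] by (simp_all add: C_S_def power2_eq_square)
      have "C * (C * p + \<i> * S * q) + \<i> * S * (C * q + \<i> * S * p) = (C * C - S * S) * p + \<i> * (2 * S * C) * q" for p q
        by (simp add: algebra_simps)
      then show ?thesis using ij(1) by (auto simp: rot_def bit_flip2 cs simp flip: C_S_def)
    qed
    have "acts n (A * (F * (A' * F'))) (\<lambda>\<psi>. rot i j (\<theta> / 2) (phase x i j ?T (pi / 2) (rot i j (- (\<theta> / 2)) (phase x i j ?T (- (pi / 2)) \<psi>))))"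
      by (rule acts_mult[OF A(2) acts_mult[OF F(2) acts_mult[OF A'(2) F'(2)]]])
    then have "acts n (A * (F * (A' * F'))) (rot i j \<theta>)"
    proof (rule acts_cong)
      fix \<psi> a
      have "phase x i j ?T (pi / 2) (rot i j (- (\<theta> / 2)) (phase x i j ?T (- (pi / 2)) \<psi>)) = rot i j (\<theta> / 2) \<psi>"
        using conj by blast
      then show "rot i j (\<theta> / 2) (phase x i j ?T (pi / 2) (rot i j (- (\<theta> / 2)) (phase x i j ?T (- (pi / 2)) \<psi>))) a = rot i j \<theta> \<psi> a"
        by (simp add: dbl)
    qed
    then have gate: "xy_gate n (\<theta>, i, j) = A * (F * (A' * F'))" using acts_unique acts_xy_gate[OF ij] by blast
    have c: "realizable n (5 + (1 + 5)) (F * (A' * F'))" "realizable n (1 + 5) (A' * F')"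
      by (rule realizable_mult[OF F(1) realizable_mult[OF A'(1) F'(1)]] realizable_mult[OF A'(1) F'(1)])+
    have "?d (xy_gate n (\<theta>, i, j)) = ?d A * (?d F * (?d A' * ?d F'))"
      unfolding gate using pres[OF c(1)] pres[OF c(2)] pres[OF A(1)] pres[OF A'(1)] pres[OF F(1)] pres[OF F'(1)]
      by (simp add: det_on_mult)
    also have "\<dots> = ?d (A' * A) * ?d (F' * F)"
      using pres[OF A(1)] pres[OF A'(1)] pres[OF F(1)] pres[OF F'(1)] by (simp add: det_on_mult)
    finally have "?d (xy_gate n (\<theta>, i, j)) = 1" unfolding AA FF using det_on_one[OF B_ne] by simp
    moreover have "preserves (xy_gate n (\<theta>, i, j))" unfolding gate by (rule pres[OF realizable_mult[OF A(1) c(1)]])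
    ultimately show ?thesis by simp
  qed
  have "?d (circuit_unitary n gs) = 1" if "xy_circuit n gs" for gs
    using that
  proof (induction gs)
    case Nil
    then show ?case by (simp add: circuit_unitary_def det_on_one[OF B_ne])
  next
    case (Cons g gs)
    obtain \<theta> i j where g: "g = (\<theta>, i, j)" by (cases g)
    have ij: "i \<noteq> j" "i < n" "j < n" and gs: "xy_circuit n gs" using Cons.prems by (auto simp: xy_circuit_def g)
    have "preserves (circuit_unitary n gs)" using gs by (intro pres[of "length gs"]) (auto simp: realizable_def)
    then show ?case
      using gate[OF ij, of \<theta>] Cons.IH[OF gs] by (simp add: circuit_unitary_def g det_on_mult)
  qed
  then show ?thesis using M by (auto simp: realizable_def)
qed

end

section \<open>The sectors below the middle\<close>

abbreviation delta :: "nat \<Rightarrow> nat \<Rightarrow> complex" where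
  "delta x \<equiv> \<lambda>a. of_bool (a = x)"

lemma weight_class_ne: "m \<le> n \<Longrightarrow> weight_class n m \<noteq> {}"
  using card_hamming_weight[of n m] zero_less_binomial[of m n] by (metis card.empty less_numeral_extra(3) weight_class_def)

lemma coordinates_weight_space: "coordinates n (weight_class n m) delta (weight_space n m)"
proof -
  \<comment> \<open>The coordinates are set up for the space of explicit combinations, whose basis
    is then recognized as the unit vectors that span \<open>weight_space n m\<close>.\<close>
  let ?W = "{vec (2 ^ n) (\<lambda>a. \<Sum>x\<in>weight_class n m. c x * delta x a) |c. True}"
  interpret coordinates n "weight_class n m" delta ?W
    by unfold_locales (auto simp: weight_class_def)
  have "set bs = {unit_vec (2 ^ n) b |b. b < 2 ^ n \<and> hamming_weight n b = m}"
  proof -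
    have "vec (2 ^ n) (delta b) = unit_vec (2 ^ n) b" if "b < 2 ^ n" for b
      using that by (auto simp: unit_vec_def)
    then have "(\<lambda>b. vec (2 ^ n) (delta b)) ` weight_class n m = unit_vec (2 ^ n) ` weight_class n m"
      by (intro image_cong) (auto simp: weight_class_def)
    moreover have "set bs = (\<lambda>b. vec (2 ^ n) (delta b)) ` weight_class n m" by (simp add: bs_def xs)
    ultimately show ?thesis by (auto simp: weight_class_def)
  qed
  then have "weight_space n m = ?W"
    using subspace_basis_bs by (simp add: weight_space_def subspace_basis_def)
  then show ?thesis using coordinates_axioms by simp
qed

lemma preserves_weight_space:
  assumes M: "symmetric n M"
  shows "coordinates.preserves n (weight_class n m) delta M"
proof -
  interpret coordinates n "weight_class n m" delta "weight_space n m" by (rule coordinates_weight_space)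
  show ?thesis
    unfolding preserves_def
  proof (intro conjI ballI allI impI)
    fix x a assume x: "x \<in> weight_class n m" and a: "a < (2::nat) ^ n"
    have "mat_act n M (delta x) a = 0" if "a \<notin> weight_class n m"
      using M x a that by (intro symmetric_act_weight) (auto simp: weight_class_def)
    moreover have "(\<Sum>y\<in>weight_class n m. mat_act n M (delta x) y * delta y a) =
        (\<Sum>y\<in>weight_class n m. if y = a then mat_act n M (delta x) a else 0)"
      by (intro sum.cong) auto
    ultimately show "mat_act n M (delta x) a = (\<Sum>y\<in>weight_class n m. mat_act n M (delta x) y * delta y a)"
      using finite_B by auto
  qed (use M in \<open>simp add: symmetric_def\<close>)
qed

lemma flip_all_weight: "b < 2 ^ n \<Longrightarrow> hamming_weight n (flip_all n b) = n - hamming_weight n b"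
  using hamming_weight_flip_all[of n b] by simp

lemma weight_class_flip_all_iff: "2 * m = n \<Longrightarrow> flip_all n b \<in> weight_class n m \<longleftrightarrow> b \<in> weight_class n m"
  using hamming_weight_flip_all[of n b] by (auto simp: weight_class_def)

lemma weight_class_flip_all_notin: "2 * m \<noteq> n \<Longrightarrow> b \<in> weight_class n m \<Longrightarrow> flip_all n b \<notin> weight_class n m"
  using hamming_weight_flip_all[of n b] by (auto simp: weight_class_def)

text \<open>A two-level rotation also moves the complements, of weight \<open>n - m\<close>, which
  is why the functions in \<open>?Out\<close> vanish at that weight too. The complements lie outside
  \<open>?B\<close>, so the same circuit serves as cheap and as isolated rotation.\<close>

lemma elimination_weight_space:
  assumes n: "3 \<le> n" and m: "2 * m \<noteq> n"
  shows "elimination n (weight_class n m) delta {\<phi>. \<forall>a. a \<notin> weight_class n m \<longrightarrow> \<phi> a = 0}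
    {\<psi>. \<forall>a. \<not> a < 2 ^ n \<or> hamming_weight n a \<in> {m, n - m} \<longrightarrow> \<psi> a = 0} 1 (adjacent n)
    (gate_bound n) (gate_bound n)"
    (is "elimination n ?B delta ?H ?Out 1 _ ?K ?K")
proof -
  have rotation: "\<exists>M. realizable n ?K M \<and> (\<forall>\<phi>\<in>?H. mat_act n M \<phi> x = of_real c * \<phi> x - cnj s * \<phi> y \<and>
        mat_act n M \<phi> y = of_real c * \<phi> y + s * \<phi> x \<and> (\<forall>z\<in>?B - {x, y}. mat_act n M \<phi> z = \<phi> z)) \<and>
        (\<forall>\<psi>\<in>?Out. mat_act n M \<psi> = \<psi>)"
    if x: "x \<in> ?B" and y: "y \<in> ?B" and adj: "adjacent n x y" and cs: "c\<^sup>2 + (cmod s)\<^sup>2 = 1" for x y c s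
  proof -
    obtain i j where ij: "i < n" "j < n" "i \<noteq> j" "bit x i \<noteq> bit x j" "y = flip2 i j x"
      using adj by (auto simp: adjacent_def)
    have lt: "x < 2 ^ n" "y < 2 ^ n" using x y by (auto simp: weight_class_def)
    have "realizable_op n ?K (two_level n x y c s)"
      unfolding ij(5) by (rule realizable_op_two_level_flip2[OF n ij(3,1,2) lt(1) ij(4) cs])
    then obtain M where M: "realizable n ?K M" "acts n M (two_level n x y c s)" by (auto simp: realizable_op_def)
    have act: "mat_act n M \<phi> a = two_level n x y c s \<phi> a" if "a < 2 ^ n" for \<phi> a
      using M that by (simp add: acts_def)
    have ne: "y \<noteq> x" "y \<noteq> flip_all n x" using ij flip2_neq_flip_all[OF n ij(3)] by auto
    have cB: "flip_all n x \<notin> ?B" "flip_all n y \<notin> ?B" using weight_class_flip_all_notin[OF m] x y by auto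
    have "mat_act n M \<psi> a = \<psi> a" if \<psi>: "\<psi> \<in> ?Out" for \<psi> a
    proof (cases "a < 2 ^ n")
      case True
      have "\<psi> b = 0" if "b \<in> {x, y, flip_all n x, flip_all n y}" for b
        using \<psi> that x y by (auto simp: weight_class_def flip_all_weight)
      then show ?thesis using act[OF True] by (simp add: two_level_def)
    qed (use \<psi> in simp)
    moreover have "mat_act n M \<phi> z = \<phi> z" if "z \<in> ?B - {x, y}" for \<phi> z
    proof -
      have "z < 2 ^ n" "z \<noteq> x" "z \<noteq> y" "z \<noteq> flip_all n x" "z \<noteq> flip_all n y" using that cB by (auto simp: weight_class_def)
      then show ?thesis by (simp add: act two_level_def)
    qed
    ultimately show ?thesis using M(1) act lt ne by (intro exI[of _ M]) (auto simp: two_level_def)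
  qed
  show ?thesis
  proof
    show "\<exists>M. realizable n ?K M \<and> (\<forall>\<phi>\<in>?H. mat_act n M \<phi> x = of_real c * \<phi> x - cnj s * \<phi> y \<and>
        mat_act n M \<phi> y = of_real c * \<phi> y + s * \<phi> x \<and> (\<forall>z\<in>?B - {x, y}. mat_act n M \<phi> z = \<phi> z))"
      if "x \<in> ?B" "y \<in> ?B" "adjacent n x y" "c\<^sup>2 + (cmod s)\<^sup>2 = 1" for x y c s
      using rotation[OF that] by blast
    fix k M \<phi> assume M: "realizable n k M"
    note sym = symmetric_realizable[OF M]
    show "mat_act n M \<phi> \<in> ?H" if "\<phi> \<in> ?H"
    proof (intro CollectI allI impI)
      fix a assume "a \<notin> ?B"
      then show "mat_act n M \<phi> a = 0"
        using that by (cases "a < 2 ^ n") (auto intro!: symmetric_act_weight[OF sym] simp: weight_class_def)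
    qed
    show "mat_act n M \<phi> \<in> ?Out" if "\<phi> \<in> ?Out"
    proof (intro CollectI allI impI)
      fix a assume a: "\<not> a < 2 ^ n \<or> hamming_weight n a \<in> {m, n - m}"
      show "mat_act n M \<phi> a = 0"
      proof (cases "a < 2 ^ n")
        case True
        then show ?thesis using that a by (intro symmetric_act_weight[OF sym]) auto
      qed simp
    qed
  next
    fix x and \<phi> :: "nat \<Rightarrow> complex" assume x: "x \<in> ?B"
    have "inner n (delta x) \<phi> = (\<Sum>a<2 ^ n. if a = x then \<phi> x else 0)"
      unfolding inner_def by (intro sum.cong) auto
    then show "inner n (delta x) \<phi> = 1 * \<phi> x" using x by (auto simp: weight_class_def)
  next
    show "\<exists>M. realizable n ?K M \<and> (\<forall>\<phi>\<in>?H. mat_act n M \<phi> x = of_real c * \<phi> x - cnj s * \<phi> y \<and>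
        mat_act n M \<phi> y = of_real c * \<phi> y + s * \<phi> x \<and> (\<forall>z\<in>?B - {x, y}. mat_act n M \<phi> z = \<phi> z)) \<and>
        (\<forall>\<psi>\<in>?Out. mat_act n M \<psi> = \<psi>)"
      if "x \<in> ?B" "y \<in> ?B" "adjacent n x y" "c\<^sup>2 + (cmod s)\<^sup>2 = 1" for x y c s
      by (rule rotation[OF that])
  next
    fix \<phi> \<psi> :: "nat \<Rightarrow> complex"
    assume eq: "\<phi> \<in> ?H" "\<psi> \<in> ?H" "\<And>x. x \<in> ?B \<Longrightarrow> \<phi> x = \<psi> x"
    show "\<phi> = \<psi>"
    proof
      fix a show "\<phi> a = \<psi> a" using eq by (cases "a \<in> ?B") auto
    qed
  qed (auto simp: weight_class_def)
qed

section \<open>The middle sector\<close>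

text \<open>Left unnormalized so that the value at \<open>x\<close> is one; the squared norm 2
  becomes the constant \<kappa> of the elimination.\<close>

definition parity_vector :: "nat \<Rightarrow> complex \<Rightarrow> nat \<Rightarrow> nat \<Rightarrow> complex" where
  "parity_vector n \<epsilon> x a = of_bool (a = x) + \<epsilon> * of_bool (a = flip_all n x)"

definition parity_space :: "nat \<Rightarrow> complex \<Rightarrow> (nat \<Rightarrow> complex) set" where
  "parity_space n \<epsilon> = {\<phi>. (\<forall>a. \<not> a < 2 ^ n \<or> 2 * hamming_weight n a \<noteq> n \<longrightarrow> \<phi> a = 0) \<and>
     (\<forall>a<2 ^ n. \<phi> (flip_all n a) = \<epsilon> * \<phi> a)}"

text \<open>Opposite parity is demanded at middle weight only: an isolated rotation has to fix
  everything at the other weights, whatever its parity.\<close>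

definition off_parity_space :: "nat \<Rightarrow> complex \<Rightarrow> (nat \<Rightarrow> complex) set" where
  "off_parity_space n \<epsilon> = {\<psi>. (\<forall>a. \<not> a < 2 ^ n \<longrightarrow> \<psi> a = 0) \<and>
     (\<forall>a<2 ^ n. 2 * hamming_weight n a = n \<longrightarrow> \<psi> (flip_all n a) = - \<epsilon> * \<psi> a)}"

text \<open>\<open>P\<close> contains one string of each complementary pair of middle weight, so
  that it indexes a basis of either eigenspace.\<close>

locale middle =
  fixes n m :: nat and P :: "nat set" and \<epsilon> :: complex
  assumes n: "3 \<le> n" and nm: "2 * m = n" and P: "P \<subseteq> weight_class n m"
    and P_flip_all: "x \<in> P \<Longrightarrow> flip_all n x \<notin> P"
    and P_cover: "z \<in> weight_class n m \<Longrightarrow> z \<in> P \<or> flip_all n z \<in> P"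
    and \<epsilon>: "\<epsilon> = 1 \<or> \<epsilon> = - 1"
begin

lemma \<epsilon>_sq: "\<epsilon> * \<epsilon> = 1" "cnj \<epsilon> = \<epsilon>" "\<epsilon> * (\<epsilon> * z) = z"
  using \<epsilon> by auto

lemma P_less: "x \<in> P \<Longrightarrow> x < 2 ^ n" "x \<in> P \<Longrightarrow> hamming_weight n x = m"
  using P by (auto simp: weight_class_def)

lemma finite_P: "finite P"
  using P by (rule finite_subset) (simp add: weight_class_def)

lemma weight_flip_all_iff: "2 * hamming_weight n (flip_all n a) = n \<longleftrightarrow> 2 * hamming_weight n a = n"
  using hamming_weight_flip_all[of n a] by auto

lemma parity_vector_in: "x \<in> P \<Longrightarrow> parity_vector n \<epsilon> x \<in> parity_space n \<epsilon>"
  using P_less[of x] nm weight_flip_all_iff[of x] \<epsilon>_sq flip_all_neq[of n x] n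
  by (auto simp: parity_space_def parity_vector_def flip_all_eq_iff)

lemma parity_vector_delta: "x \<in> P \<Longrightarrow> y \<in> P \<Longrightarrow> parity_vector n \<epsilon> x y = of_bool (y = x)"
  using P_flip_all by (auto simp: parity_vector_def)

lemma parity_space_expand:
  assumes "\<phi> \<in> parity_space n \<epsilon>"
  shows "\<phi> a = (\<Sum>y\<in>P. \<phi> y * parity_vector n \<epsilon> y a)"
proof -
  have "(\<Sum>y\<in>P. \<phi> y * parity_vector n \<epsilon> y a) =
      (\<Sum>y\<in>P. (if y = a then \<phi> a else 0) + (if y = flip_all n a then \<epsilon> * \<phi> (flip_all n a) else 0))"
    by (intro sum.cong) (auto simp: parity_vector_def distrib_left)
  also have "\<dots> = (if a \<in> P then \<phi> a else 0) + (if flip_all n a \<in> P then \<epsilon> * \<phi> (flip_all n a) else 0)"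
    using finite_P by (simp add: sum.distrib)
  also have "\<dots> = \<phi> a"
  proof (cases "a \<in> weight_class n m")
    case True
    then have "\<epsilon> * \<phi> (flip_all n a) = \<phi> a"
      using assms by (simp add: parity_space_def weight_class_def \<epsilon>_sq)
    then show ?thesis using P_cover[OF True] P_flip_all[of a] by auto
  next
    case False
    then have "\<phi> a = 0" using assms nm by (auto simp: parity_space_def weight_class_def)
    moreover have "a \<notin> P" "flip_all n a \<notin> P" using False P weight_class_flip_all_iff[OF nm] by auto
    ultimately show ?thesis by simp
  qed
  finally show ?thesis by simp
qed

lemma parity_space_symmetric:
  assumes M: "symmetric n M" and "\<phi> \<in> parity_space n \<epsilon>"
  shows "mat_act n M \<phi> \<in> parity_space n \<epsilon>"
  unfolding parity_space_def
proof (intro CollectI conjI allI impI)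
  fix a assume "\<not> a < 2 ^ n \<or> 2 * hamming_weight n a \<noteq> n"
  then show "mat_act n M \<phi> a = 0"
    using assms(2) by (cases "a < 2 ^ n") (auto intro!: symmetric_act_weight[OF M] simp: parity_space_def)
next
  fix a assume "a < (2::nat) ^ n"
  then show "mat_act n M \<phi> (flip_all n a) = \<epsilon> * mat_act n M \<phi> a"
    using assms(2) by (intro symmetric_act_parity[OF M]) (auto simp: parity_space_def)
qed

lemma off_parity_space_symmetric:
  assumes M: "symmetric n M" and "\<phi> \<in> off_parity_space n \<epsilon>"
  shows "mat_act n M \<phi> \<in> off_parity_space n \<epsilon>"
  unfolding off_parity_space_def
proof (intro CollectI conjI allI impI)
  fix a assume "a < (2::nat) ^ n" "2 * hamming_weight n a = n"
  then show "mat_act n M \<phi> (flip_all n a) = - \<epsilon> * mat_act n M \<phi> a"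
    using assms(2) by (intro symmetric_act_parity[OF M]) (auto simp: off_parity_space_def)
qed simp

text \<open>Eigenvalue zero of \<open>total_Z n\<close> confines a vector to the strings with
  \<open>n / 2\<close> ones, where the eigenvalue of \<open>all_X n\<close> is the parity; the
  expansion of \<open>parity_space\<close> then applies.\<close>

lemma coordinates_joint_eigenspace: "coordinates n P (parity_vector n \<epsilon>) (joint_eigenspace n 0 \<epsilon>)"
proof
  have tz: "(total_Z n *\<^sub>v v) $ a = (of_nat n - 2 * of_nat (hamming_weight n a)) * v $ a"
    if "a < 2 ^ n" "v \<in> carrier_vec (2 ^ n)" for a v
  proof -
    have "(total_Z n *\<^sub>v v) $ a = (\<Sum>b<2 ^ n. total_Z n $$ (a, b) * v $ b)"
      using that total_Z_carrier[of n] by (simp add: scalar_prod_def lessThan_atLeast0)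
    also have "\<dots> = (\<Sum>b<2 ^ n. if b = a then (of_nat n - 2 * of_nat (hamming_weight n a)) * v $ a else 0)"
      using that by (intro sum.cong refl) (auto simp: total_Z_index)
    finally show ?thesis using that by simp
  qed
  have ax: "(all_X n *\<^sub>v v) $ a = v $ flip_all n a" if "a < 2 ^ n" "v \<in> carrier_vec (2 ^ n)" for a v
  proof -
    have "(all_X n *\<^sub>v v) $ a = (\<Sum>b<2 ^ n. all_X n $$ (a, b) * v $ b)"
      using that all_X_carrier[of n] by (simp add: scalar_prod_def lessThan_atLeast0)
    also have "\<dots> = (\<Sum>b<2 ^ n. if b = flip_all n a then v $ flip_all n a else 0)"
      using that by (intro sum.cong refl) (auto simp: all_X_index)
    finally show ?thesis using that by simp
  qed
  have zero: "(of_nat n :: complex) = 2 * of_nat (hamming_weight n a) \<longleftrightarrow> 2 * hamming_weight n a = n" for a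
    by (metis of_nat_eq_iff of_nat_mult of_nat_numeral)
  have iff: "v \<in> joint_eigenspace n 0 \<epsilon> \<longleftrightarrow> v \<in> carrier_vec (2 ^ n) \<and>
      (\<forall>a<2 ^ n. 2 * hamming_weight n a \<noteq> n \<longrightarrow> v $ a = 0) \<and> (\<forall>a<2 ^ n. v $ flip_all n a = \<epsilon> * v $ a)" for v
  proof (cases "v \<in> carrier_vec (2 ^ n)")
    case True
    have ext: "u = w \<longleftrightarrow> (\<forall>a<2 ^ n. u $ a = w $ a)" if "u \<in> carrier_vec (2 ^ n)" "w \<in> carrier_vec (2 ^ n)" for u w :: "complex vec"
      using that by (metis carrier_vecD eq_vecI)
    have "total_Z n *\<^sub>v v = 0 \<cdot>\<^sub>v v \<longleftrightarrow> (\<forall>a<2 ^ n. (total_Z n *\<^sub>v v) $ a = (0 \<cdot>\<^sub>v v) $ a)"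
      using True by (intro ext mult_mat_vec_carrier[OF total_Z_carrier]) auto
    moreover have "all_X n *\<^sub>v v = \<epsilon> \<cdot>\<^sub>v v \<longleftrightarrow> (\<forall>a<2 ^ n. (all_X n *\<^sub>v v) $ a = (\<epsilon> \<cdot>\<^sub>v v) $ a)"
      using True by (intro ext mult_mat_vec_carrier[OF all_X_carrier]) auto
    ultimately show ?thesis using True by (auto simp: joint_eigenspace_def tz ax zero)
  qed (simp add: joint_eigenspace_def)
  show "joint_eigenspace n 0 \<epsilon> = {vec (2 ^ n) (\<lambda>a. \<Sum>x\<in>P. c x * parity_vector n \<epsilon> x a) |c. True}"
  proof (intro equalityI subsetI)
    fix v assume v: "v \<in> joint_eigenspace n 0 \<epsilon>"
    let ?\<phi> = "\<lambda>a. if a < 2 ^ n then v $ a else 0"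
    have \<phi>: "?\<phi> \<in> parity_space n \<epsilon>" using v by (auto simp: iff parity_space_def)
    have "v = vec (2 ^ n) (\<lambda>a. \<Sum>x\<in>P. ?\<phi> x * parity_vector n \<epsilon> x a)"
    proof (rule eq_vecI)
      fix a assume "a < dim_vec (vec (2 ^ n) (\<lambda>a. \<Sum>x\<in>P. ?\<phi> x * parity_vector n \<epsilon> x a))"
      then have a: "a < 2 ^ n" by simp
      then have "v $ a = ?\<phi> a" by simp
      also have "\<dots> = (\<Sum>x\<in>P. ?\<phi> x * parity_vector n \<epsilon> x a)" by (rule parity_space_expand[OF \<phi>])
      finally show "v $ a = vec (2 ^ n) (\<lambda>a. \<Sum>x\<in>P. ?\<phi> x * parity_vector n \<epsilon> x a) $ a" using a by simp
    qed (use v in \<open>simp add: iff\<close>)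
    then show "v \<in> {vec (2 ^ n) (\<lambda>a. \<Sum>x\<in>P. c x * parity_vector n \<epsilon> x a) |c. True}"
      by (intro CollectI exI[of _ ?\<phi>] conjI) simp_all
  next
    fix v assume "v \<in> {vec (2 ^ n) (\<lambda>a. \<Sum>x\<in>P. c x * parity_vector n \<epsilon> x a) |c. True}"
    then obtain c where v: "v = vec (2 ^ n) (\<lambda>a. \<Sum>x\<in>P. c x * parity_vector n \<epsilon> x a)" by blast
    have pv: "2 * hamming_weight n a \<noteq> n \<Longrightarrow> parity_vector n \<epsilon> x a = 0"
      "parity_vector n \<epsilon> x (flip_all n a) = \<epsilon> * parity_vector n \<epsilon> x a" if "x \<in> P" "a < 2 ^ n" for x a
      using parity_vector_in[OF that(1)] that(2) by (auto simp: parity_space_def)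
    show "v \<in> joint_eigenspace n 0 \<epsilon>"
      unfolding iff
    proof (intro conjI allI impI)
      fix a assume a: "a < (2::nat) ^ n"
      show "v $ a = 0" if "2 * hamming_weight n a \<noteq> n"
        using a pv(1)[OF _ a that] by (simp add: v)
      show "v $ flip_all n a = \<epsilon> * v $ a"
        using a pv(2)[OF _ a] by (simp add: v sum_distrib_left mult.left_commute)
    qed (simp add: v)
  qed
  show "P \<subseteq> {..<2 ^ n}" using P_less by blast
qed (rule parity_vector_delta)

lemma preserves_joint_eigenspace:
  assumes M: "symmetric n M"
  shows "coordinates.preserves n P (parity_vector n \<epsilon>) M"
proof -
  interpret coordinates n P "parity_vector n \<epsilon>" "joint_eigenspace n 0 \<epsilon>" by (rule coordinates_joint_eigenspace)
  show ?thesis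
    unfolding preserves_def
  proof (intro conjI ballI allI impI)
    show "M \<in> carrier_mat (2 ^ n) (2 ^ n)" using M by (simp add: symmetric_def)
  qed (rule parity_space_expand[OF parity_space_symmetric[OF M parity_vector_in]])
qed

text \<open>On parity \<epsilon> the amplitude at the complement of \<open>y\<close> is \<epsilon>
  times that at \<open>y\<close>, which the factor \<epsilon> in the second rotation undoes: both
  factors rotate by the same half angle. On parity - \<epsilon> the sign is reversed and the factors
  are inverse to each other. The path to the complement of \<open>y\<close> costs at most
  \<open>n\<close> times \<open>gate_bound n\<close>, the rotation of \<open>x, y\<close> once
  more.\<close>

lemma isolated_rotation:
  assumes x: "x \<in> P" and y: "y \<in> P" and adj: "adjacent n x y" and cs: "c\<^sup>2 + (cmod s)\<^sup>2 = 1"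
  shows "\<exists>M. realizable n ((n + 1) * gate_bound n) M \<and>
      (\<forall>\<phi>\<in>parity_space n \<epsilon>. mat_act n M \<phi> x = of_real c * \<phi> x - cnj s * \<phi> y \<and>
        mat_act n M \<phi> y = of_real c * \<phi> y + s * \<phi> x \<and> (\<forall>z\<in>P - {x, y}. mat_act n M \<phi> z = \<phi> z)) \<and>
      (\<forall>\<psi>\<in>off_parity_space n \<epsilon>. mat_act n M \<psi> = \<psi>)"
proof -
  obtain \<theta> \<gamma> where polar: "c = cos \<theta>" "s = cis \<gamma> * of_real (sin \<theta>)" using givens_polar[OF cs] .
  obtain c' s0 where h: "c'\<^sup>2 + s0\<^sup>2 = 1" "cos \<theta> = c'\<^sup>2 - s0\<^sup>2" "sin \<theta> = 2 * c' * s0" by (rule half_angle)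
  define s' where "s' = cis \<gamma> * of_real s0"
  define C S where "C = complex_of_real c'" "S = cnj s'"
  have cs': "c'\<^sup>2 + (cmod s')\<^sup>2 = 1" "c'\<^sup>2 + (cmod (\<epsilon> * s'))\<^sup>2 = 1"
    using h(1) \<epsilon> by (auto simp: s'_def norm_mult)
  have SS: "s' * S = of_real s0 * of_real s0"
    using cis_mult_cnj[of \<gamma>] by (simp add: s'_def C_S_def mult.assoc mult.left_commute)
  have one: "C * C + s' * S = 1"
    unfolding SS using arg_cong[OF h(1), of complex_of_real] by (simp add: C_S_def power2_eq_square)
  have full: "of_real c = C * C - s' * S" "s = 2 * C * s'" "cnj s = 2 * C * S"
    unfolding SS polar h by (simp_all add: C_S_def power2_eq_square s'_def)
  obtain i j where ij: "i < n" "j < n" "i \<noteq> j" "bit x i \<noteq> bit x j" "y = flip2 i j x"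
    using adj by (auto simp: adjacent_def)
  have lt: "x < 2 ^ n" "y < 2 ^ n" "flip_all n y < 2 ^ n" using x y P_less by auto
  have ne: "y \<noteq> x" "y \<noteq> flip_all n x" "x \<noteq> flip_all n y" "x \<noteq> flip_all n x" "y \<noteq> flip_all n y"
    using x y P_flip_all[OF x] P_flip_all[OF y] ij flip2_neq[OF ij(3), of x] by metis+
  have "realizable_op n (gate_bound n) (two_level n x y c' s')"
    unfolding ij(5) by (rule realizable_op_two_level_flip2[OF n ij(3,1,2) lt(1) ij(4) cs'(1)])
  then obtain M1 where M1: "realizable n (gate_bound n) M1" "acts n M1 (two_level n x y c' s')" by (auto simp: realizable_op_def)
  have "realizable_op n (distance n x (flip_all n y) * gate_bound n) (two_level n x (flip_all n y) c' (\<epsilon> * s'))"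
  proof (rule realizable_op_two_level_path[OF n lt(1) cs'(2) lt(3)])
    show "hamming_weight n x = hamming_weight n (flip_all n y)"
      using P_less(2)[OF x] P_less(2)[OF y] hamming_weight_flip_all[of n y] nm by simp
  qed (use ne in auto)
  then have "realizable_op n (n * gate_bound n) (two_level n x (flip_all n y) c' (\<epsilon> * s'))"
    using distance_le by (elim realizable_op_mono) simp
  then obtain M2 where M2: "realizable n (n * gate_bound n) M2" "acts n M2 (two_level n x (flip_all n y) c' (\<epsilon> * s'))" by (auto simp: realizable_op_def)
  define M where "M = M1 * M2"
  have "realizable n ((n + 1) * gate_bound n) M"
    unfolding M_def using realizable_mult[OF M1(1) M2(1)] by simp
  note sym = symmetric_realizable[OF this]
  have act: "mat_act n M \<phi> a = two_level n x y c' s' (two_level n x (flip_all n y) c' (\<epsilon> * s') \<phi>) a" if "a < 2 ^ n" for \<phi> a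
    using acts_mult[OF M1(2) M2(2)] that by (simp add: acts_def M_def)
  have at_x: "mat_act n M \<phi> x = C * (C * \<phi> x - S * (\<epsilon> * \<phi> (flip_all n y))) - S * (C * \<phi> y + s' * (\<epsilon> * \<phi> (flip_all n x)))"
    and at_y: "mat_act n M \<phi> y = C * (C * \<phi> y + s' * (\<epsilon> * \<phi> (flip_all n x))) + s' * (C * \<phi> x - S * (\<epsilon> * \<phi> (flip_all n y)))" for \<phi>
    using ne lt by (simp_all add: act two_level_def \<epsilon>_sq C_S_def mult.assoc mult.left_commute)
  have other: "mat_act n M \<phi> z = \<phi> z" if "z < 2 ^ n" "z \<notin> {x, y, flip_all n x, flip_all n y}" for \<phi> z
    using that by (simp add: act two_level_def)
  have even_part: "mat_act n M \<phi> x = of_real c * \<phi> x - cnj s * \<phi> y" "mat_act n M \<phi> y = of_real c * \<phi> y + s * \<phi> x"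
    if \<phi>: "\<phi> \<in> parity_space n \<epsilon>" for \<phi>
  proof -
    have "\<epsilon> * \<phi> (flip_all n y) = \<phi> y" "\<epsilon> * \<phi> (flip_all n x) = \<phi> x"
      using \<phi> lt by (auto simp: parity_space_def \<epsilon>_sq)
    then show "mat_act n M \<phi> x = of_real c * \<phi> x - cnj s * \<phi> y" "mat_act n M \<phi> y = of_real c * \<phi> y + s * \<phi> x"
      by (simp_all add: at_x at_y full(1,3) algebra_simps) (simp_all add: full(2))
  qed
  have odd_part: "mat_act n M \<psi> = \<psi>" if \<psi>: "\<psi> \<in> off_parity_space n \<epsilon>" for \<psi>
  proof
    fix a
    have q: "\<epsilon> * \<psi> (flip_all n y) = - \<psi> y" "\<epsilon> * \<psi> (flip_all n x) = - \<psi> x"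
      using \<psi> lt nm P_less(2)[OF x] P_less(2)[OF y] by (auto simp: off_parity_space_def \<epsilon>_sq)
    have "mat_act n M \<psi> x = (C * C + s' * S) * \<psi> x" "mat_act n M \<psi> y = (C * C + s' * S) * \<psi> y"
      unfolding at_x at_y q by (simp_all add: algebra_simps)
    then have xy: "mat_act n M \<psi> x = \<psi> x" "mat_act n M \<psi> y = \<psi> y" by (simp_all add: one)
    have M\<psi>: "mat_act n M \<psi> \<in> off_parity_space n \<epsilon>" by (rule off_parity_space_symmetric[OF sym \<psi>])
    have flip: "\<phi> (flip_all n b) = - \<epsilon> * \<phi> b" if "\<phi> \<in> off_parity_space n \<epsilon>" "b \<in> P" for \<phi> b
      using that nm P_less[of b] by (auto simp: off_parity_space_def)
    have "mat_act n M \<psi> (flip_all n x) = \<psi> (flip_all n x)" "mat_act n M \<psi> (flip_all n y) = \<psi> (flip_all n y)"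
      using xy flip[OF \<psi> x] flip[OF \<psi> y] flip[OF M\<psi> x] flip[OF M\<psi> y] by simp_all
    then show "mat_act n M \<psi> a = \<psi> a"
      using xy other[of a \<psi>] \<psi> by (cases "a < 2 ^ n") (auto simp: off_parity_space_def)
  qed
  have "mat_act n M \<phi> z = \<phi> z" if "z \<in> P - {x, y}" for \<phi> z
    using that x y P_flip_all P_less by (intro other) (auto simp: flip_all_eq_iff)
  then show ?thesis using \<open>realizable n ((n + 1) * gate_bound n) M\<close> even_part odd_part by blast
qed

text \<open>A two-level rotation acts on both parities alike and is suitable only as the cheap
  rotation; the isolated one is the composite of \<open>isolated_rotation\<close>.\<close>

lemma elimination_joint_eigenspace:
  "elimination n P (parity_vector n \<epsilon>) (parity_space n \<epsilon>) (off_parity_space n \<epsilon>) 2 (adjacent n)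
    (gate_bound n) ((n + 1) * gate_bound n)"
proof
  fix x y c s assume x: "x \<in> P" and y: "y \<in> P" and adj: "adjacent n x y" and cs: "(c::real)\<^sup>2 + (cmod s)\<^sup>2 = 1"
  obtain i j where ij: "i < n" "j < n" "i \<noteq> j" "bit x i \<noteq> bit x j" "y = flip2 i j x"
    using adj by (auto simp: adjacent_def)
  have lt: "x < 2 ^ n" "y < 2 ^ n" using x y P_less by auto
  have "realizable_op n (gate_bound n) (two_level n x y c s)"
    unfolding ij(5) by (rule realizable_op_two_level_flip2[OF n ij(3,1,2) lt(1) ij(4) cs])
  then obtain M where M: "realizable n (gate_bound n) M" "acts n M (two_level n x y c s)" by (auto simp: realizable_op_def)
  have "\<forall>z\<in>P - {x, y}. z \<noteq> flip_all n x \<and> z \<noteq> flip_all n y" using x y P_flip_all by auto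
  moreover have "y \<noteq> x" "y \<noteq> flip_all n x" "x \<noteq> flip_all n x"
    using x y P_flip_all[OF x] P_flip_all[OF y] ij flip2_neq[OF ij(3), of x] by metis+
  ultimately show "\<exists>M. realizable n (gate_bound n) M \<and> (\<forall>\<phi>\<in>parity_space n \<epsilon>. mat_act n M \<phi> x = of_real c * \<phi> x - cnj s * \<phi> y \<and>
      mat_act n M \<phi> y = of_real c * \<phi> y + s * \<phi> x \<and> (\<forall>z\<in>P - {x, y}. mat_act n M \<phi> z = \<phi> z))"
    using M lt P_less by (intro exI[of _ M]) (auto simp: acts_def two_level_def)
next
  fix x and \<phi> :: "nat \<Rightarrow> complex" assume x: "x \<in> P" and \<phi>: "\<phi> \<in> parity_space n \<epsilon>"
  have "inner n (parity_vector n \<epsilon> x) \<phi> =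
      (\<Sum>a<2 ^ n. (if a = x then \<phi> x else 0) + (if a = flip_all n x then \<epsilon> * \<phi> (flip_all n x) else 0))"
    unfolding inner_def by (intro sum.cong) (auto simp: parity_vector_def \<epsilon>_sq distrib_right)
  also have "\<dots> = \<phi> x + \<epsilon> * \<phi> (flip_all n x)" using P_less[OF x] by (simp add: sum.distrib)
  also have "\<dots> = 2 * \<phi> x" using \<phi> P_less[OF x] by (simp add: parity_space_def \<epsilon>_sq)
  finally show "inner n (parity_vector n \<epsilon> x) \<phi> = 2 * \<phi> x" .
next
  fix \<phi> \<psi> assume eq: "\<phi> \<in> parity_space n \<epsilon>" "\<psi> \<in> parity_space n \<epsilon>" "\<And>x. x \<in> P \<Longrightarrow> \<phi> x = \<psi> x"
  show "\<phi> = \<psi>"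
  proof
    fix a
    have "\<phi> a = (\<Sum>y\<in>P. \<phi> y * parity_vector n \<epsilon> y a)" by (rule parity_space_expand[OF eq(1)])
    also have "\<dots> = (\<Sum>y\<in>P. \<psi> y * parity_vector n \<epsilon> y a)" using eq(3) by simp
    also have "\<dots> = \<psi> a" by (rule parity_space_expand[OF eq(2), symmetric])
    finally show "\<phi> a = \<psi> a" .
  qed
next
  show "(\<lambda>a. \<mu> * \<phi> a) \<in> parity_space n \<epsilon>" if "\<phi> \<in> parity_space n \<epsilon>" for \<phi> \<mu>
    using that by (auto simp: parity_space_def)
next
  show "mat_act n M \<phi> \<in> parity_space n \<epsilon>" if "realizable n k M" "\<phi> \<in> parity_space n \<epsilon>" for k M \<phi>
    using that by (intro parity_space_symmetric symmetric_realizable)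
next
  show "mat_act n M \<phi> \<in> off_parity_space n \<epsilon>" if "realizable n k M" "\<phi> \<in> off_parity_space n \<epsilon>" for k M \<phi>
    using that by (intro off_parity_space_symmetric symmetric_realizable)
next
  show "\<phi> a = 0" if "\<phi> \<in> parity_space n \<epsilon>" "\<not> a < 2 ^ n" for \<phi> a
    using that by (simp add: parity_space_def)
next
  show "\<phi> a = 0" if "\<phi> \<in> off_parity_space n \<epsilon>" "\<not> a < 2 ^ n" for \<phi> a
    using that by (simp add: off_parity_space_def)
qed ((rule parity_vector_in parity_vector_delta isolated_rotation zero_neq_numeral[symmetric]; assumption)+)

end

section \<open>Synthesis\<close>

text \<open>The scalar left by the elimination is the determinant of the product of a circuit and
  \<open>V\<close>, both of which have determinant one.\<close>

lemma reduce_sector: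
  assumes E: "elimination n B f H Out \<kappa> (adjacent n) K L" and C: "coordinates n B f W"
    and tree: "tree (adjacent n) B" and n: "3 \<le> n"
    and pres: "\<And>M. symmetric n M \<Longrightarrow> coordinates.preserves n B f M"
    and inv: "\<And>M \<phi>. symmetric n M \<Longrightarrow> \<phi> \<in> H \<Longrightarrow> mat_act n M \<phi> \<in> H"
    and V: "isometric n V" "symmetric n V" "det_on (2 ^ n) V W = 1"
  shows "\<exists>M. realizable n (card B * (2 * card B * K + 2 * L)) M \<and>
    (\<forall>x\<in>B. mat_act n (M * V) (f x) = f x) \<and> (\<forall>\<psi>\<in>Out. mat_act n M \<psi> = \<psi>)"
proof -
  interpret elimination n B f H Out \<kappa> "adjacent n" K L by (rule E)
  interpret C: coordinates n B f W by (rule C)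
  have "fixes_off B V" by (simp add: fixes_off_def)
  then obtain M r l where M: "r \<in> B" "realizable n (card B * (2 * card B * K + 2 * L)) M" "fixes_off {r} (M * V)"
      "mat_act n (M * V) (f r) = (\<lambda>a. l * f r a)" "\<forall>\<psi>\<in>Out. mat_act n M \<psi> = \<psi>"
    using eliminate_tree[OF tree subset_refl V(1) inv[OF V(2)]] by blast
  have car: "M * V \<in> carrier_mat (2 ^ n) (2 ^ n)"
    using realizable_carrier[OF M(2)] isometric_carrier[OF V(1)] by (rule mult_carrier_mat)
  have "det_on (2 ^ n) (M * V) W = l"
    using M(3,4) by (intro C.det_on_diagonal[OF M(1) car]) (auto simp: fixes_off_def)
  moreover have "det_on (2 ^ n) (M * V) W = det_on (2 ^ n) M W * det_on (2 ^ n) V W"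
    by (intro C.det_on_mult pres symmetric_realizable[OF M(2)] V(2))
  moreover have "det_on (2 ^ n) M W = 1"
    using M(1) by (intro C.det_on_realizable[OF n _ pres[OF symmetric_realizable] M(2)]) auto
  ultimately have "l = 1" using V(3) by simp
  then have "mat_act n (M * V) (f x) = f x" if "x \<in> B" for x
    using M(3,4) that by (cases "x = r") (auto simp: fixes_off_def)
  then show ?thesis using M(2,5) by blast
qed

lemma middle_exists:
  assumes "3 \<le> n" "even n"
  obtains P where "\<And>\<epsilon>. \<epsilon> = 1 \<or> \<epsilon> = - 1 \<Longrightarrow> middle n (n div 2) P \<epsilon>" "tree (adjacent n) P"
proof -
  obtain P where P: "tree (adjacent n) P" "P \<subseteq> weight_class n (n div 2)" "\<And>x. x \<in> P \<Longrightarrow> flip_all n x \<notin> P"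
    "\<And>z. z \<in> weight_class n (n div 2) \<Longrightarrow> z \<in> P \<or> flip_all n z \<in> P"
    using exists_spanning_tree[of n "n div 2"] assms by auto
  have "middle n (n div 2) P \<epsilon>" if "\<epsilon> = 1 \<or> \<epsilon> = - 1" for \<epsilon>
    using assms P that by unfold_locales auto
  then show thesis using that P(1) by blast
qed

text \<open>The constraints together with isometry form a class that contains all circuits and is
  closed under products; a partly reduced matrix thus stays in it and the next sector can be
  treated.\<close>

definition admissible :: "nat \<Rightarrow> complex mat \<Rightarrow> bool" where
  "admissible n V \<longleftrightarrow> isometric n V \<and> symmetric n V \<and>
     (\<forall>m\<le>n. det_on (2 ^ n) V (weight_space n m) = 1) \<and>
     (even n \<longrightarrow> (\<forall>\<epsilon>. \<epsilon> = 1 \<or> \<epsilon> = - 1 \<longrightarrow> det_on (2 ^ n) V (joint_eigenspace n 0 \<epsilon>) = 1))"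

lemma admissible_joint:
  "admissible n V \<Longrightarrow> even n \<Longrightarrow> \<epsilon> = 1 \<or> \<epsilon> = - 1 \<Longrightarrow> det_on (2 ^ n) V (joint_eigenspace n 0 \<epsilon>) = 1"
  unfolding admissible_def by blast

lemma admissible_realizable:
  assumes n: "3 \<le> n" and M: "realizable n k M"
  shows "admissible n M"
  unfolding admissible_def
proof (intro conjI allI impI)
  fix m assume "m \<le> n"
  interpret coordinates n "weight_class n m" delta "weight_space n m" by (rule coordinates_weight_space)
  show "det_on (2 ^ n) M (weight_space n m) = 1"
    by (rule det_on_realizable[OF n weight_class_ne[OF \<open>m \<le> n\<close>] preserves_weight_space[OF symmetric_realizable] M])
next
  fix \<epsilon> :: complex assume "even n" "\<epsilon> = 1 \<or> \<epsilon> = - 1"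
  then obtain P where hP: "middle n (n div 2) P \<epsilon>" "tree (adjacent n) P" using middle_exists[OF n] by metis
  interpret middle n "n div 2" P \<epsilon> by (rule hP(1))
  interpret C: coordinates n P "parity_vector n \<epsilon>" "joint_eigenspace n 0 \<epsilon>" by (rule coordinates_joint_eigenspace)
  have "P \<noteq> {}" using tree_finite[OF hP(2)] by blast
  then show "det_on (2 ^ n) M (joint_eigenspace n 0 \<epsilon>) = 1"
    by (rule C.det_on_realizable[OF n _ preserves_joint_eigenspace[OF symmetric_realizable] M])
qed (use isometric_realizable[OF M] symmetric_realizable[OF M] in auto)

lemma admissible_mult:
  assumes n: "3 \<le> n" and hA: "admissible n A" and hB: "admissible n B"
  shows "admissible n (A * B)"
  unfolding admissible_def
proof (intro conjI allI impI)
  fix m assume "m \<le> n"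
  interpret coordinates n "weight_class n m" delta "weight_space n m" by (rule coordinates_weight_space)
  show "det_on (2 ^ n) (A * B) (weight_space n m) = 1"
    using hA hB \<open>m \<le> n\<close> by (subst det_on_mult) (auto simp: admissible_def intro: preserves_weight_space)
next
  fix \<epsilon> :: complex assume e: "even n" "\<epsilon> = 1 \<or> \<epsilon> = - 1"
  then obtain P where hP: "middle n (n div 2) P \<epsilon>" "tree (adjacent n) P" using middle_exists[OF n] by metis
  interpret middle n "n div 2" P \<epsilon> by (rule hP(1))
  interpret C: coordinates n P "parity_vector n \<epsilon>" "joint_eigenspace n 0 \<epsilon>" by (rule coordinates_joint_eigenspace)
  have "det_on (2 ^ n) (A * B) (joint_eigenspace n 0 \<epsilon>) =
      det_on (2 ^ n) A (joint_eigenspace n 0 \<epsilon>) * det_on (2 ^ n) B (joint_eigenspace n 0 \<epsilon>)"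
    using hA hB by (intro C.det_on_mult preserves_joint_eigenspace) (auto simp: admissible_def)
  then show "det_on (2 ^ n) (A * B) (joint_eigenspace n 0 \<epsilon>) = 1" by (simp add: admissible_joint[OF hA e] admissible_joint[OF hB e])
qed (use hA hB in \<open>auto simp: admissible_def intro: isometric_mult symmetric_mult\<close>)

lemma act_mult_assoc:
  assumes "realizable n k A" "realizable n l B" "isometric n V"
  shows "mat_act n (A * B * V) \<psi> = mat_act n A (mat_act n (B * V) \<psi>)"
proof -
  note car = realizable_carrier[OF assms(1)] realizable_carrier[OF assms(2)] isometric_carrier[OF assms(3)]
  show ?thesis
    unfolding mat_act_mult[OF mult_carrier_mat[OF car(1,2)] car(3)] mat_act_mult[OF car(1,2)] mat_act_mult[OF car(2,3)] ..
qed

lemma reduce_below_middle: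
  assumes n: "3 \<le> n" and V: "admissible n V"
  shows "(\<And>m. m < j \<Longrightarrow> 2 * m < n) \<Longrightarrow>
    \<exists>W. realizable n (\<Sum>m<j. 4 * gate_bound n * (n choose m)\<^sup>2) W \<and>
      (\<forall>m<j. \<forall>x\<in>weight_class n m. mat_act n (W * V) (delta x) = delta x)"
proof (induction j)
  case 0
  show ?case by (rule exI[of _ "1\<^sub>m (2 ^ n)"]) (simp add: realizable_one)
next
  case (Suc j)
  let ?K = "gate_bound n" and ?B = "weight_class n j"
  let ?H = "{\<phi>. \<forall>a. a \<notin> ?B \<longrightarrow> \<phi> a = (0::complex)}"
  let ?Out = "{\<psi>. \<forall>a. \<not> a < 2 ^ n \<or> hamming_weight n a \<in> {j, n - j} \<longrightarrow> \<psi> a = (0::complex)}"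
  obtain W where W: "realizable n (\<Sum>m<j. 4 * ?K * (n choose m)\<^sup>2) W"
      "\<forall>m<j. \<forall>x\<in>weight_class n m. mat_act n (W * V) (delta x) = delta x"
    using Suc by auto
  have j: "2 * j < n" using Suc.prems by simp
  have WV: "admissible n (W * V)" by (rule admissible_mult[OF n admissible_realizable[OF n W(1)] V])
  have tree: "tree (adjacent n) ?B"
  proof -
    obtain P where P: "tree (adjacent n) P" "P \<subseteq> ?B" "\<And>x. x \<in> P \<Longrightarrow> flip_all n x \<notin> P" "\<And>z. z \<in> ?B \<Longrightarrow> z \<in> P \<or> flip_all n z \<in> P"
      using exists_spanning_tree[of n j] j by auto
    have "P = ?B" using P(2,4) weight_class_flip_all_notin[of j n] j by blast
    then show ?thesis using P by simp
  qed
  have "\<exists>M. realizable n (card ?B * (2 * card ?B * ?K + 2 * ?K)) M \<and>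
    (\<forall>x\<in>?B. mat_act n (M * (W * V)) (delta x) = delta x) \<and> (\<forall>\<psi>\<in>?Out. mat_act n M \<psi> = \<psi>)"
  proof (rule reduce_sector[OF elimination_weight_space[OF n] coordinates_weight_space tree n preserves_weight_space])
    show "mat_act n M \<phi> \<in> ?H" if M: "symmetric n M" and "\<phi> \<in> ?H" for M \<phi>
    proof (intro CollectI allI impI)
      fix a assume "a \<notin> ?B"
      then show "mat_act n M \<phi> a = 0"
        using that by (cases "a < 2 ^ n") (auto intro!: symmetric_act_weight[OF M] simp: weight_class_def)
    qed
  qed (use WV j in \<open>auto simp: admissible_def\<close>)
  then obtain M where M: "realizable n (card ?B * (2 * card ?B * ?K + 2 * ?K)) M"
      "\<forall>x\<in>?B. mat_act n (M * (W * V)) (delta x) = delta x" "\<forall>\<psi>\<in>?Out. mat_act n M \<psi> = \<psi>"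
    by blast
  have N: "card ?B = n choose j" by (simp add: weight_class_def card_hamming_weight)
  then have "0 < card ?B" using j zero_less_binomial[of j n] by simp
  then have "card ?B * (2 * card ?B * ?K + 2 * ?K) \<le> 4 * ?K * (n choose j)\<^sup>2"
    unfolding N[symmetric] by (simp add: power2_eq_square algebra_simps)
  then have "realizable n (4 * ?K * (n choose j)\<^sup>2) M" by (rule realizable_mono[OF M(1)])
  from realizable_mult[OF this W(1)] have realizable: "realizable n (\<Sum>m<Suc j. 4 * ?K * (n choose m)\<^sup>2) (M * W)"
    by (simp add: add.commute)
  have isoV: "isometric n V" using V by (simp add: admissible_def)
  have "mat_act n (M * W * V) (delta x) = delta x" if m: "m < Suc j" and x: "x \<in> weight_class n m" for m x
  proof (cases "m = j")
    case True
    have "M * W * V = M * (W * V)"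
      by (rule assoc_mult_mat[OF realizable_carrier[OF M(1)] realizable_carrier[OF W(1)] isometric_carrier[OF isoV]])
    then show ?thesis using M(2) x True by simp
  next
    case False
    then have "m < j" using m by simp
    then have "mat_act n (W * V) (delta x) = delta x" using W(2) x by blast
    then have "mat_act n (M * W * V) (delta x) = mat_act n M (delta x)"
      by (simp only: act_mult_assoc[OF M(1) W(1) isoV])
    \<comment> \<open>Since \<open>m < j < n - j\<close>, the strings treated before have neither of
      the two weights that the new circuit moves.\<close>
    moreover have "delta x \<in> ?Out" using x m False j by (auto simp: weight_class_def)
    ultimately show ?thesis using M(3) by simp
  qed
  then show ?case using realizable by blast
qed

text \<open>The reason that the reduction of one eigenspace survives that of the other.\<close>

lemma parity_vector_off_parity:
  assumes "middle n m P \<epsilon>" "x \<in> P"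
  shows "parity_vector n \<epsilon> x \<in> off_parity_space n (- \<epsilon>)"
  using middle.parity_vector_in[OF assms] by (auto simp: parity_space_def off_parity_space_def)

lemma reduce_middle:
  assumes n: "3 \<le> n" "even n" and V: "admissible n V"
  shows "\<exists>W. realizable n (4 * gate_bound n * (n choose (n div 2))\<^sup>2 + 4 * (n + 1) * gate_bound n * (n choose (n div 2))) W \<and>
    (\<forall>x\<in>weight_class n (n div 2). mat_act n (W * V) (delta x) = delta x) \<and>
    (\<forall>z<2 ^ n. 2 * hamming_weight n z \<noteq> n \<longrightarrow> mat_act n W (delta z) = delta z)"
proof -
  obtain P where mid: "\<And>\<epsilon>. \<epsilon> = 1 \<or> \<epsilon> = - 1 \<Longrightarrow> middle n (n div 2) P \<epsilon>" and tree: "tree (adjacent n) P"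
    using middle_exists[OF n] by blast
  let ?K = "gate_bound n" and ?N = "card P"
  let ?c = "?N * (2 * ?N * ?K + 2 * ((n + 1) * ?K))"
  note even = n(2)
  have step: "\<exists>M. realizable n ?c M \<and> (\<forall>x\<in>P. mat_act n (M * U) (parity_vector n \<epsilon> x) = parity_vector n \<epsilon> x) \<and>
      (\<forall>\<psi>\<in>off_parity_space n \<epsilon>. mat_act n M \<psi> = \<psi>)"
    if U: "admissible n U" and \<epsilon>: "\<epsilon> = 1 \<or> \<epsilon> = - 1" for U \<epsilon>
  proof -
    interpret middle n "n div 2" P \<epsilon> by (rule mid[OF \<epsilon>])
    show ?thesis
      by (rule reduce_sector[OF elimination_joint_eigenspace coordinates_joint_eigenspace tree n(1)
            preserves_joint_eigenspace parity_space_symmetric])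
        (use U admissible_joint[OF U even \<epsilon>] in \<open>auto simp: admissible_def\<close>)
  qed
  obtain A where A: "realizable n ?c A" "\<forall>x\<in>P. mat_act n (A * V) (parity_vector n 1 x) = parity_vector n 1 x"
      "\<forall>\<psi>\<in>off_parity_space n 1. mat_act n A \<psi> = \<psi>"
    using step[OF V, of 1] by auto
  have AV: "admissible n (A * V)" by (rule admissible_mult[OF n(1) admissible_realizable[OF n(1) A(1)] V])
  obtain B where B: "realizable n ?c B" "\<forall>x\<in>P. mat_act n (B * (A * V)) (parity_vector n (- 1) x) = parity_vector n (- 1) x"
      "\<forall>\<psi>\<in>off_parity_space n (- 1). mat_act n B \<psi> = \<psi>"
    using step[OF AV, of "- 1"] by auto
  have isoV: "isometric n V" using V by (simp add: admissible_def)
  have BAV: "B * A * V = B * (A * V)"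
    by (rule assoc_mult_mat[OF realizable_carrier[OF B(1)] realizable_carrier[OF A(1)] isometric_carrier[OF isoV]])
  have minus: "mat_act n (B * A * V) (parity_vector n (- 1) x) = parity_vector n (- 1) x" if "x \<in> P" for x
    using B(2) that by (simp add: BAV)
  have plus: "mat_act n (B * A * V) (parity_vector n 1 x) = parity_vector n 1 x" if "x \<in> P" for x
    using A(2) B(3) that parity_vector_off_parity[OF mid[of 1] that]
    unfolding act_mult_assoc[OF B(1) A(1) isoV] by simp
  have deltas: "mat_act n (B * A * V) (delta x) = delta x" "mat_act n (B * A * V) (delta (flip_all n x)) = delta (flip_all n x)" if "x \<in> P" for x
  proof -
    \<comment> \<open>Half the sum and half the difference of the two parity vectors, both of which
      are already fixed.\<close>
    have d: "delta x = (\<lambda>a. 1 / 2 * (parity_vector n 1 x a + parity_vector n (- 1) x a))"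
      "delta (flip_all n x) = (\<lambda>a. 1 / 2 * (parity_vector n 1 x a + - 1 * parity_vector n (- 1) x a))"
      by (auto simp: parity_vector_def fun_eq_iff)
    show "mat_act n (B * A * V) (delta x) = delta x" "mat_act n (B * A * V) (delta (flip_all n x)) = delta (flip_all n x)"
      unfolding d mat_act_scale mat_act_add plus[OF that] minus[OF that] by simp_all
  qed
  have P: "?N \<le> n choose (n div 2)"
  proof -
    have "P \<subseteq> weight_class n (n div 2)" using mid[of 1] by (simp add: middle_def)
    then have "?N \<le> card (weight_class n (n div 2))" by (intro card_mono) (auto simp: weight_class_def)
    then show ?thesis by (simp add: weight_class_def card_hamming_weight)
  qed
  have "?c + ?c = 4 * ?K * ?N\<^sup>2 + 4 * (n + 1) * ?K * ?N" by (simp add: power2_eq_square algebra_simps)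
  also have "\<dots> \<le> 4 * ?K * (n choose (n div 2))\<^sup>2 + 4 * (n + 1) * ?K * (n choose (n div 2))"
    using P by (intro add_mono mult_mono power_mono) auto
  finally have "realizable n (4 * ?K * (n choose (n div 2))\<^sup>2 + 4 * (n + 1) * ?K * (n choose (n div 2))) (B * A)"
    by (rule realizable_mono[OF realizable_mult[OF B(1) A(1)]])
  moreover have "mat_act n (B * A * V) (delta x) = delta x" if "x \<in> weight_class n (n div 2)" for x
    using middle.P_cover[OF mid[of 1] that] deltas[of x] deltas[of "flip_all n x"] by auto
  moreover have "mat_act n (B * A) (delta z) = delta z" if "z < 2 ^ n" "2 * hamming_weight n z \<noteq> n" for z
  proof -
    have "z \<noteq> a" "flip_all n a \<noteq> z" if "2 * hamming_weight n a = n" for a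
      using \<open>2 * hamming_weight n z \<noteq> n\<close> that hamming_weight_flip_all[of n a] by auto
    then have "delta z \<in> off_parity_space n \<epsilon>" for \<epsilon>
      using that by (auto simp: off_parity_space_def)
    then show ?thesis using A(3) B(3) by (simp add: mat_act_mult[OF realizable_carrier[OF B(1)] realizable_carrier[OF A(1)]])
  qed
  ultimately show ?thesis by blast
qed

text \<open>The squared binomial coefficients of all weights add up to
  \<open>(2 * n) choose n\<close>. The second term pays for the isolated rotations at middle weight,
  with the size of that class bounded by \<open>2 ^ n\<close>.\<close>

definition synthesis_bound :: "nat \<Rightarrow> nat" where
  "synthesis_bound n = 4 * gate_bound n * ((2 * n) choose n) + 4 * (n + 1) * gate_bound n * 2 ^ n"

text \<open>Reducing the weights up to \<open>n / 2\<close> suffices, because the flip symmetry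
  determines the rest. \<open>V\<close> is then the inverse of the reducing circuit, which has the
  same gate count.\<close>

lemma synthesis:
  assumes n: "3 \<le> n" and V: "admissible n V"
  shows "realizable n (synthesis_bound n) V"
proof -
  \<comment> \<open>For either parity of \<open>n\<close>, the numbers below \<open>?j\<close> are
    those whose double is less than \<open>n\<close>.\<close>
  let ?K = "gate_bound n" and ?j = "(n + 1) div 2"
  let ?s = "\<lambda>m. 4 * ?K * (n choose m)\<^sup>2"
  have isoV: "isometric n V" using V by (simp add: admissible_def)
  obtain W where W: "realizable n (\<Sum>m<?j. ?s m) W"
      "\<forall>m<?j. \<forall>x\<in>weight_class n m. mat_act n (W * V) (delta x) = delta x"
    using reduce_below_middle[OF n V, of ?j] by force
  have WV: "admissible n (W * V)" by (rule admissible_mult[OF n admissible_realizable[OF n W(1)] V])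
  have total: "(\<Sum>m\<in>S. ?s m) \<le> 4 * ?K * ((2 * n) choose n)" if "S \<subseteq> {..n}" for S
  proof -
    have "(\<Sum>m\<in>S. ?s m) \<le> (\<Sum>m\<le>n. ?s m)" using that by (intro sum_mono2) auto
    then show ?thesis by (simp add: choose_square_sum flip: sum_distrib_left)
  qed
  obtain U where U: "realizable n (synthesis_bound n) U"
      "\<And>x. x < 2 ^ n \<Longrightarrow> 2 * hamming_weight n x \<le> n \<Longrightarrow> mat_act n (U * V) (delta x) = delta x"
  proof (cases "even n")
    case False
    have "{..<?j} \<subseteq> {..n}"
    proof
      fix m assume "m \<in> {..<?j}" then show "m \<in> {..n}" unfolding lessThan_iff atMost_iff by presburger
    qed
    then have "realizable n (synthesis_bound n) W"
      using total[of "{..<?j}"] by (intro realizable_mono[OF W(1)]) (auto simp: synthesis_bound_def)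
    moreover have "mat_act n (W * V) (delta x) = delta x" if "x < 2 ^ n" "2 * hamming_weight n x \<le> n" for x
    proof -
      have "hamming_weight n x < ?j" using that False by presburger
      then show ?thesis using W(2) that by (auto simp: weight_class_def)
    qed
    ultimately show ?thesis using that by blast
  next
    case True
    let ?h = "n div 2"
    obtain A where A: "realizable n (?s ?h + 4 * (n + 1) * ?K * (n choose ?h)) A"
      "\<forall>x\<in>weight_class n ?h. mat_act n (A * (W * V)) (delta x) = delta x"
      "\<forall>z<2 ^ n. 2 * hamming_weight n z \<noteq> n \<longrightarrow> mat_act n A (delta z) = delta z"
      using reduce_middle[OF n True WV] by blast
    have h: "?j = ?h" "{..<Suc ?h} \<subseteq> {..n}" using True by auto
    have "n choose ?h \<le> 2 ^ n" by (rule binomial_le_pow2)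
    then have "4 * (n + 1) * ?K * (n choose ?h) \<le> 4 * (n + 1) * ?K * 2 ^ n" by (rule mult_le_mono2)
    then have "?s ?h + 4 * (n + 1) * ?K * (n choose ?h) + (\<Sum>m<?j. ?s m) \<le> synthesis_bound n"
      using total[OF h(2)] unfolding h(1) synthesis_bound_def sum.lessThan_Suc by linarith
    then have "realizable n (synthesis_bound n) (A * W)" by (rule realizable_mono[OF realizable_mult[OF A(1) W(1)]])
    moreover have "mat_act n (A * W * V) (delta x) = delta x" if x: "x < 2 ^ n" "2 * hamming_weight n x \<le> n" for x
    proof (cases "2 * hamming_weight n x = n")
      case True
      then have "x \<in> weight_class n ?h" using x by (auto simp: weight_class_def)
      moreover have "A * W * V = A * (W * V)"
        by (rule assoc_mult_mat[OF realizable_carrier[OF A(1)] realizable_carrier[OF W(1)] isometric_carrier[OF isoV]])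
      ultimately show ?thesis using A(2) by simp
    next
      case False
      then have "hamming_weight n x < ?j" using x h by auto
      then have "mat_act n (W * V) (delta x) = delta x" using W(2) x by (auto simp: weight_class_def)
      then show ?thesis using A(3) x False by (simp add: act_mult_assoc[OF A(1) W(1) isoV])
    qed
    ultimately show ?thesis using that by blast
  qed
  note carU = realizable_carrier[OF U(1)] and carV = isometric_carrier[OF isoV]
  have sym: "symmetric n (U * V)"
    using V symmetric_realizable[OF U(1)] by (auto simp: admissible_def intro: symmetric_mult)
  have act: "mat_act n (U * V) (delta b) a = delta b a" if ab: "a < 2 ^ n" "b < 2 ^ n" for a b
  proof (cases "2 * hamming_weight n b \<le> n")
    case True
    then show ?thesis using U(2) ab by simp
  next
    case False
    \<comment> \<open>The complement of \<open>b\<close> has less than half of its bits set, so its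
      column is trivial; the symmetry carries this over to \<open>b\<close>.\<close>
    then have "mat_act n (U * V) (delta (flip_all n b)) = delta (flip_all n b)"
      using U(2)[of "flip_all n b"] ab hamming_weight_flip_all[of n b] by simp
    moreover have "mat_act n (U * V) (delta b) (flip_all n (flip_all n a)) = mat_act n (U * V) (\<lambda>c. delta b (flip_all n c)) (flip_all n a)"
      using ab by (intro symmetric_act_flip_all[OF sym]) simp
    moreover have "(\<lambda>c. delta b (flip_all n c)) = delta (flip_all n b)" by (auto simp: flip_all_eq_iff)
    ultimately show ?thesis by (simp add: flip_all_eq_iff)
  qed
  have UV: "U * V = 1\<^sub>m (2 ^ n)"
  proof (rule eq_matI)
    fix a b assume "a < dim_row (1\<^sub>m (2 ^ n))" "b < dim_col (1\<^sub>m (2 ^ n))"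
    then have ab: "a < 2 ^ n" "b < 2 ^ n" by auto
    then show "(U * V) $$ (a, b) = 1\<^sub>m (2 ^ n) $$ (a, b)" using mat_act_delta[OF ab, of "U * V"] act[OF ab] by (cases "a = b") auto
  qed (use carU carV in auto)
  obtain U' where U': "realizable n (synthesis_bound n) U'" "U' * U = 1\<^sub>m (2 ^ n)" using realizable_inverse[OF U(1)] .
  have "V = U' * U * V" using carV by (simp add: U'(2))
  also have "\<dots> = U' * (U * V)" by (rule assoc_mult_mat[OF realizable_carrier[OF U'(1)] carU carV])
  also have "\<dots> = U'" using realizable_carrier[OF U'(1)] by (simp add: UV)
  finally show ?thesis using U'(1) by simp
qed

section \<open>Asymptotics of the gate count\<close>

text \<open>The factor \<open>2 * n + 1\<close> carries the induction: the quotient of consecutive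
  left sides is \<open>4 * (2 * n + 1) * (2 * n + 3)\<close> over the square of
  \<open>n + 1\<close>, and it is at most 16 because \<open>(2 * n + 1) * (2 * n + 3)\<close> is one
  less than the square of \<open>2 * n + 2\<close>.\<close>

lemma central_binomial_bound: "((2 * n) choose n)\<^sup>2 * (2 * n + 1) \<le> 16 ^ n"
proof (induction n)
  case (Suc n)
  let ?c = "(2 * n) choose n" and ?d = "(2 * Suc n) choose Suc n"
  have rec: "(n + 1) * ?d = 2 * (2 * n + 1) * ?c"
  proof -
    have "Suc n * ?d = 2 * Suc n * ((2 * n + 1) choose n)"
      using Suc_times_binomial_eq[of "2 * n + 1" n] by (simp add: mult.commute)
    moreover have "Suc n * ((2 * n + 1) choose n) = (2 * n + 1) * ?c"
    proof -
      have "(2 * n + 1) choose n = (2 * n + 1) choose Suc n"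
        using binomial_symmetric[of n "2 * n + 1"] by simp
      then show ?thesis using Suc_times_binomial_eq[of "2 * n" n] by (simp add: mult.commute)
    qed
    ultimately show ?thesis by (simp add: algebra_simps)
  qed
  have "(n + 1)\<^sup>2 * (d\<^sup>2 * (2 * Suc n + 1)) \<le> (n + 1)\<^sup>2 * 16 ^ Suc n"
    if d: "(n + 1) * d = 2 * (2 * n + 1) * c" and c: "c\<^sup>2 * (2 * n + 1) \<le> 16 ^ n" for c d :: nat
  proof -
    have "(n + 1)\<^sup>2 * (d\<^sup>2 * (2 * Suc n + 1)) = ((n + 1) * d)\<^sup>2 * (2 * n + 3)"
      by (simp only: power_mult_distrib) (simp add: algebra_simps)
    also have "\<dots> = (c\<^sup>2 * (2 * n + 1)) * (4 * (2 * n + 1) * (2 * n + 3))"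
      unfolding d by (simp only: power_mult_distrib) (simp add: power2_eq_square algebra_simps)
    also have "\<dots> \<le> 16 ^ n * (16 * (n + 1)\<^sup>2)"
      by (rule mult_mono[OF c]) (simp_all add: power2_eq_square algebra_simps)
    finally show ?thesis by (simp add: mult_ac)
  qed
  from this[OF rec Suc.IH] show ?case by (subst (asm) mult_le_cancel1) simp
qed simp

text \<open>The factor 2 accommodates 3, whose square exceeds \<open>2 ^ 3\<close>; from 4 on the
  inequality holds without it.\<close>

lemma square_le_two_power: "n\<^sup>2 \<le> 2 * 2 ^ n"
proof (cases "n \<le> 3")
  case True
  then have "n \<in> {0, 1, 2, 3}" by auto
  then show ?thesis by auto
next
  case False
  then have "4 \<le> n" by simp
  then have "n\<^sup>2 \<le> 2 ^ n"
  proof (induction n rule: dec_induct)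
    case (step k)
    have "4 * k \<le> k * k" using step(1) by (rule mult_le_mono1)
    moreover have "2 * k + 1 \<le> 4 * k" using step(1) by simp
    ultimately have "2 * k + 1 \<le> k\<^sup>2" unfolding power2_eq_square by (rule order_trans[rotated])
    then show ?case using step by (simp add: power2_eq_square algebra_simps)
  qed simp
  then show ?thesis by simp
qed

text \<open>The central binomial term contributes 256. The isolated rotations contribute 1024, which
  is 256 doubled once for \<open>n + 1 \<le> 2 * n\<close> and once by
  \<open>square_le_two_power\<close>.\<close>

lemma synthesis_bound_le:
  assumes n: "1 \<le> n"
  shows "real (synthesis_bound n) \<le> 1280 * 4 ^ n * real n powr (3 / 2)"
proof -
  let ?x = "real n"
  have x: "1 \<le> ?x" using n by simp
  have pw: "?x powr (3 / 2) = ?x * sqrt ?x"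
    using x powr_add[of ?x 1 "1 / 2"] by (simp add: powr_half_sqrt)
  have sq: "sqrt ?x * sqrt ?x = ?x" "1 \<le> sqrt ?x" using x by auto
  have "real (((2 * n) choose n)\<^sup>2 * (2 * n + 1)) \<le> real (16 ^ n)"
    using central_binomial_bound[of n] by (simp only: of_nat_le_iff)
  then have "(real ((2 * n) choose n))\<^sup>2 * (2 * ?x + 1) \<le> 16 ^ n" by (simp add: algebra_simps)
  moreover have "(real ((2 * n) choose n))\<^sup>2 * ?x \<le> (real ((2 * n) choose n))\<^sup>2 * (2 * ?x + 1)"
    using x by (intro mult_left_mono) auto
  ultimately have "(real ((2 * n) choose n))\<^sup>2 * ?x \<le> 16 ^ n" by (rule order_trans[rotated])
  moreover have "(16::real) ^ n = (4 ^ n)\<^sup>2" by (simp add: power2_eq_square flip: power_mult_distrib)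
  moreover have "(real ((2 * n) choose n) * sqrt ?x)\<^sup>2 = (real ((2 * n) choose n))\<^sup>2 * ?x"
    by (simp add: power_mult_distrib)
  ultimately have "(real ((2 * n) choose n) * sqrt ?x)\<^sup>2 \<le> (4 ^ n)\<^sup>2" by simp
  then have cb: "real ((2 * n) choose n) * sqrt ?x \<le> 4 ^ n"
    by (rule power2_le_imp_le) simp
  have "real ((2 * n) choose n) * ?x\<^sup>2 = (real ((2 * n) choose n) * sqrt ?x) * (?x * sqrt ?x)"
    using sq(1) by (simp add: power2_eq_square mult_ac)
  also have "\<dots> \<le> 4 ^ n * (?x * sqrt ?x)" using x cb by (intro mult_right_mono) auto
  finally have first: "real ((2 * n) choose n) * ?x\<^sup>2 \<le> 4 ^ n * (?x * sqrt ?x)" .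
  have "real (n\<^sup>2) \<le> real (2 * 2 ^ n)" using square_le_two_power[of n] by (simp only: of_nat_le_iff)
  then have n2: "?x\<^sup>2 \<le> 2 * 2 ^ n" by simp
  \<comment> \<open>Two of the three powers of \<open>n\<close> are absorbed into another factor
    \<open>2 ^ n\<close>, the third is at most \<open>?x * sqrt ?x\<close>.\<close>
  have "?x\<^sup>2 * ?x * 2 ^ n \<le> (2 * 2 ^ n) * (?x * sqrt ?x) * 2 ^ n"
    using n2 x sq(2) by (intro mult_mono) auto
  also have "\<dots> = 2 * (4 ^ n * (?x * sqrt ?x))"
    by (simp add: mult_ac flip: power_mult_distrib)
  finally have second: "?x\<^sup>2 * ?x * 2 ^ n \<le> 2 * (4 ^ n * (?x * sqrt ?x))" .
  have "real (synthesis_bound n) = 256 * (real ((2 * n) choose n) * ?x\<^sup>2) + 256 * ((?x + 1) * ?x\<^sup>2 * 2 ^ n)"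
    by (simp add: synthesis_bound_def gate_bound_def algebra_simps)
  also have "(?x + 1) * ?x\<^sup>2 * 2 ^ n \<le> (2 * ?x) * ?x\<^sup>2 * 2 ^ n" using x by (intro mult_right_mono) auto
  also have "256 * (real ((2 * n) choose n) * ?x\<^sup>2) + 256 * ((2 * ?x) * ?x\<^sup>2 * 2 ^ n) =
      256 * (real ((2 * n) choose n) * ?x\<^sup>2) + 512 * (?x\<^sup>2 * ?x * 2 ^ n)" by simp
  also have "\<dots> \<le> 256 * (4 ^ n * (?x * sqrt ?x)) + 512 * (2 * (4 ^ n * (?x * sqrt ?x)))"
    using first second by (intro add_mono mult_left_mono) auto
  finally show ?thesis by (simp add: pw mult_ac)
qed

lemma admissible_if_constraints:
  assumes V: "unitary (2 ^ n) V" and c: "xy_constraints n V"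
  shows "admissible n V"
proof -
  have "V \<in> carrier_mat (2 ^ n) (2 ^ n)" using V by (simp add: unitary_def)
  then show ?thesis
    using isometric_unitary[OF V] c by (auto simp: admissible_def xy_constraints_def symmetric_iff)
qed

lemma constraints_if_admissible: "admissible n V \<Longrightarrow> xy_constraints n V"
  using symmetric_iff[OF isometric_carrier] by (auto simp: admissible_def xy_constraints_def)

theorem theorem4:
  shows "(\<forall>n\<ge>3. \<forall>V. unitary (2 ^ n) V \<longrightarrow>
            ((\<exists>gs. xy_circuit n gs \<and> V = circuit_unitary n gs) \<longleftrightarrow> xy_constraints n V)) \<and>
         (\<exists>C::real. \<forall>n\<ge>3. \<forall>V. unitary (2 ^ n) V \<and> xy_constraints n V \<longrightarrow>
            (\<exists>gs. xy_circuit n gs \<and> V = circuit_unitary n gs \<and>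
                  real (length gs) \<le> C * 4 ^ n * real n powr (3 / 2)))"
proof (intro conjI allI impI iffI)
  fix n :: nat and V assume "3 \<le> n" "\<exists>gs. xy_circuit n gs \<and> V = circuit_unitary n gs"
  then obtain gs where "xy_circuit n gs" "V = circuit_unitary n gs" by blast
  then have "realizable n (length gs) V" by (auto simp: realizable_def)
  then show "xy_constraints n V" by (intro constraints_if_admissible admissible_realizable[OF \<open>3 \<le> n\<close>])
next
  fix n :: nat and V assume "3 \<le> n" "unitary (2 ^ n) V" "xy_constraints n V"
  then show "\<exists>gs. xy_circuit n gs \<and> V = circuit_unitary n gs"
    using synthesis[OF \<open>3 \<le> n\<close> admissible_if_constraints] by (auto simp: realizable_def)
next
  show "\<exists>C::real. \<forall>n\<ge>3. \<forall>V. unitary (2 ^ n) V \<and> xy_constraints n V \<longrightarrow>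
      (\<exists>gs. xy_circuit n gs \<and> V = circuit_unitary n gs \<and> real (length gs) \<le> C * 4 ^ n * real n powr (3 / 2))"
  proof (intro exI[of _ 1280] allI impI)
    fix n :: nat and V assume n: "3 \<le> n" and V: "unitary (2 ^ n) V \<and> xy_constraints n V"
    then have "realizable n (synthesis_bound n) V" by (intro synthesis admissible_if_constraints) auto
    then obtain gs where gs: "xy_circuit n gs" "V = circuit_unitary n gs" "length gs \<le> synthesis_bound n"
      by (auto simp: realizable_def)
    then have "real (length gs) \<le> 1280 * 4 ^ n * real n powr (3 / 2)"
      using synthesis_bound_le[of n] n by (meson of_nat_le_iff le_trans one_le_numeral order_trans)
    then show "\<exists>gs. xy_circuit n gs \<and> V = circuit_unitary n gs \<and> real (length gs) \<le> 1280 * 4 ^ n * real n powr (3 / 2)"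
      using gs by blast
  qed
qed

end
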